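(* Let $(id,\lambda,id):(H,A,C)\to(H,A',C)$ be a monoidal morphism of Doi-Hopf data, with associated functors $F:{}_A\mathcal{M}(H)^C\to{}_{A'}\mathcal{M}(H)^C$, $F(M)=A'\otimes_AM$, and $G:{}_{A'}\mathcal{M}(H)^C\to{}_A\mathcal{M}(H)^C$, $G(N)=N\square_CC$. Then $F(A)=A'$ (meaning that they are isomorphic in ${}_{A'}\mathcal{M}(H)^C$). Let $M\in{}_A\mathcal{M}(H)^C$ and $N\in{}_{A'}\mathcal{M}(H)^C$ be arbitrary. If $(A,\alpha_A)$ is a Hom-Hopf algebra, then there is an isomorphism in ${}_{A'}\mathcal{M}(H)^C$ $$F(M)\otimes N\simeq F(M\otimes G(N)).$$ If $(A',\alpha_{A'})$ has a twisted antipode, then $$N\otimes F(M)\simeq F(G(N)\otimes M).$$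
   Context: Work over a field $k$, $\otimes=\otimes_k$. Negative powers of structure maps $\alpha$ denote powers of their inverses, which the formulas presuppose. Hom-algebra $(A,\alpha_A)$: a linear multiplication, a unit $1_A$ and a linear $\alpha_A:A\to A$ with $\alpha_A(ab)=\alpha_A(a)\alpha_A(b)$, $\alpha_A(1_A)=1_A$, $1_Aa=\alpha_A(a)=a1_A$, $\alpha_A(a)(bc)=(ab)\alpha_A(c)$. Hom-coalgebra $(C,\alpha_C)$: linear $\Delta:C\to C\otimes C$, $\Delta(c)=c_1\otimes c_2$, $\varepsilon:C\to k$ and $\alpha_C$ with $\varepsilon\circ\alpha_C=\varepsilon$, $(\alpha_C\otimes\alpha_C)\Delta=\Delta\alpha_C$, $(\varepsilon\otimes id)\Delta=\alpha_C=(id\otimes\varepsilon)\Delta$, $(\Delta\otimes\alpha_C)\Delta=(\alpha_C\otimes\Delta)\Delta$. Morphisms preserve all structure and commute with the $\alpha$'s. Hom-bialgebra: a Hom-algebra and Hom-coalgebra with the same $\alpha$ such that $\Delta,\varepsilon$ are Hom-algebra morphisms. Hom-Hopf algebra: a Hom-bialgebra with a linear $S$ (antipode), $S\alpha=\alpha S$, $S(h_1)h_2=h_1S(h_2)=\varepsilon(h)1$. A twisted antipode of a Hom-bialgebra $(B,\alpha)$ is a linear $\bar S:B\to B$ with $\bar S\alpha=\alpha\bar S$, $\bar S(b_2)b_1=b_2\bar S(b_1)=\varepsilon(b)1$. Left $A$-module $(M,\alpha_M)$: linear $A\otimes M\to M$ with $1_A\cdot m=\alpha_M(m)$, $\alpha_M(a\cdot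 m)=\alpha_A(a)\cdot\alpha_M(m)$, $\alpha_A(a)\cdot(b\cdot m)=(ab)\cdot\alpha_M(m)$. Right $C$-comodule $(M,\alpha_M)$: linear $\rho:M\to M\otimes C$, $\rho(m)=m_{(0)}\otimes m_{(1)}$, with $(id\otimes\varepsilon)\rho=\alpha_M$, $(\alpha_M\otimes\alpha_C)\rho=\rho\alpha_M$, $(\rho\otimes\alpha_C)\rho=(\alpha_M\otimes\Delta)\rho$. (Co)module maps are (co)linear and commute with the $\alpha$'s. A (Hom-type) Doi-Hopf datum $(H,A,C)$ consists of a Hom-Hopf algebra $(H,\alpha_H)$, a right $H$-comodule algebra $(A,\alpha_A)$ (a Hom-algebra and right $H$-comodule, $\rho(a)=a_{(0)}\otimes a_{(1)}$, with $\rho(ab)=\rho(a)\rho(b)$, $\rho(1_A)=1_A\otimes1_H$) and a left $H$-module coalgebra $(C,\alpha_C)$ (a Hom-coalgebra and left $H$-module with $\Delta_C(h\cdot c)=h_1\cdot c_1\otimes h_2\cdot c_2$, $\varepsilon_C(h\cdot c)=\varepsilon_H(h)\varepsilon_C(c)$). A Doi-Hopf module over $(H,A,C)$ is $(M,\alpha_M)$ that is a left $A$-module and a right $C$-comodule with $\rho(a\cdot m)=a_{(0)}\cdot m_{(0)}\otimes a_{(1)}\cdot m_{(1)}$. ${}_A\mathcal{M}(H)^C$ is the category of these, with $A$-linear $C$-colinear maps. The datum is monoidal if $A$ and $C$ are Hom-bialgebras and $a_{(0)1}\otimes a_{(0)2}\otimes\alpha_H^2(a_{(1)})\cdot(cd)=a_{1(0)}\otimes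 a_{2(0)}\otimes(a_{1(1)}\cdot c)(a_{2(1)}\cdot d)$, $\varepsilon(a)1_C=\varepsilon(a_{(0)})a_{(1)}\cdot1_C$ for all $a\in A$, $c,d\in C$. Then for Doi-Hopf modules $M,N$, $(M\otimes N,\alpha_M\otimes\alpha_N)$ is a Doi-Hopf module via $a\cdot(m\otimes n)=a_1\cdot m\otimes a_2\cdot n$, $\rho(m\otimes n)=m_{(0)}\otimes n_{(0)}\otimes\alpha_C^{-2}(m_{(1)}n_{(1)})$, and $A$ is a Doi-Hopf module via $a\cdot b=\alpha_A^{-1}(a)b$, $\rho(a)=a_{(0)}\otimes a_{(1)}\cdot1_C$ (likewise $A'$ over $(H,A',C)$). That $(id,\lambda,id)$ is a monoidal morphism means: $(H,A,C)$, $(H,A',C)$ are monoidal Doi-Hopf data and $\lambda:A\to A'$ is a Hom-bialgebra map with $\rho(\lambda(a))=\lambda(a_{(0)})\otimes a_{(1)}$. $F(M)=A'\otimes_AM$ is the quotient of $A'\otimes M$ by the span of all $b'\lambda(a)\otimes\alpha_M(m)-\alpha_{A'}(b')\otimes a\cdot m$, with structure map $\alpha_{A'}\otimes\alpha_M$, action $a'\cdot(b'\otimes m)=\alpha_{A'}(a')b'\otimes\alpha_M(m)$ and coaction $\rho(b'\otimes m)=b'_{(0)}\otimes m_{(0)}\otimes\alpha_C^{-2}(b'_{(1)}\cdot m_{(1)})$. $G(N)=N\square_CC=\{\sum n\otimes c\in N\otimes C\mid\sum\alpha_N(n)\otimes c_1\otimes c_2=\sum n_{(0)}\otimes n_{(1)}\otimes\alpha_C(c)\}$,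 with structure map $\alpha_N\otimes\alpha_C$, action $a\cdot(n\otimes c)=\lambda(a_{(0)})\cdot n\otimes a_{(1)}\cdot c$ and coaction $\rho(n\otimes c)=\alpha_N(n)\otimes c_1\otimes\alpha_C^{-1}(c_2)$.
   Formalization: The first isomorphism assumes that A' (not A) is a Hom-Hopf algebra, and both isomorphisms assume that the structure map of N is bijective; without either change the claim is false. The structure maps of A, A' and C are taken bijective, as the negative powers presuppose. *)

theory Defs
  imports "HOL-Algebra.Module" "HOL-Algebra.AbelCoset"
begin

section \<open>Tensor products of vector spaces\<close>

text \<open>Vector spaces are HOL-Algebra modules over a field \<open>K\<close>. The record fields \<open>mult\<close> and
  \<open>one\<close>, which \<^typ>\<open>('k, 'v) module\<close> inherits from rings, hold the (non-associative)
  multiplication of a Hom-algebra; they are irrelevant for spaces that are not algebras.\<close>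

record ('k, 'v) hom_space = "('k, 'v) module" +
  alpha :: "'v \<Rightarrow> 'v"

record ('k, 'v) hom_bialg = "('k, 'v) hom_space" +
  comul :: "'v \<Rightarrow> ('v \<times> 'v \<Rightarrow> 'k) set"
  counit :: "'v \<Rightarrow> 'k"

definition linear_map ::
    "('k, 'r) ring_scheme \<Rightarrow> ('k, 'v, 'x) module_scheme \<Rightarrow> ('k, 'w, 'y) module_scheme
      \<Rightarrow> ('v \<Rightarrow> 'w) \<Rightarrow> bool" where
  "linear_map K V W f \<longleftrightarrow>
     f \<in> carrier V \<rightarrow> carrier W \<and>
     (\<forall>x\<in>carrier V. \<forall>y\<in>carrier V. f (x \<oplus>\<^bsub>V\<^esub> y) = f x \<oplus>\<^bsub>W\<^esub> f y) \<and>
     (\<forall>k\<in>carrier K. \<forall>x\<in>carrier V. f (k \<odot>\<^bsub>V\<^esub> x) = k \<odot>\<^bsub>W\<^esub> f x)"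

definition linear_form ::
    "('k, 'r) ring_scheme \<Rightarrow> ('k, 'v, 'x) module_scheme \<Rightarrow> ('v \<Rightarrow> 'k) \<Rightarrow> bool" where
  "linear_form K V f \<longleftrightarrow>
     f \<in> carrier V \<rightarrow> carrier K \<and>
     (\<forall>x\<in>carrier V. \<forall>y\<in>carrier V. f (x \<oplus>\<^bsub>V\<^esub> y) = f x \<oplus>\<^bsub>K\<^esub> f y) \<and>
     (\<forall>k\<in>carrier K. \<forall>x\<in>carrier V. f (k \<odot>\<^bsub>V\<^esub> x) = k \<otimes>\<^bsub>K\<^esub> f x)"

definition bilinear_map ::
    "('k, 'r) ring_scheme \<Rightarrow> ('k, 'v, 'x) module_scheme \<Rightarrow> ('k, 'w, 'y) module_scheme
      \<Rightarrow> ('k, 'u, 'z) module_scheme \<Rightarrow> ('v \<Rightarrow> 'w \<Rightarrow> 'u) \<Rightarrow> bool" where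
  "bilinear_map K V W U f \<longleftrightarrow>
     (\<forall>v\<in>carrier V. linear_map K W U (f v)) \<and>
     (\<forall>w\<in>carrier W. linear_map K V U (\<lambda>v. f v w))"

definition lin_span ::
    "('k, 'r) ring_scheme \<Rightarrow> ('k, 'v, 'x) module_scheme \<Rightarrow> 'v set \<Rightarrow> 'v set" where
  "lin_span K V S = \<Inter>{W. submodule W K V \<and> S \<subseteq> W}"

definition quotient_space ::
    "('k, 'v, 'x) module_scheme \<Rightarrow> 'v set \<Rightarrow> ('k, 'v set) module" where
  "quotient_space V W =
     \<lparr>carrier = a_rcosets\<^bsub>V\<^esub> W, mult = undefined, one = undefined,
      zero = W, add = set_add V,
      smult = (\<lambda>k X. \<Union>x\<in>X. W +>\<^bsub>V\<^esub> (k \<odot>\<^bsub>V\<^esub> x))\<rparr>"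

definition free_space :: "('k, 'r) ring_scheme \<Rightarrow> 's set \<Rightarrow> ('k, 's \<Rightarrow> 'k) module" where
  "free_space K S =
     \<lparr>carrier = {u. range u \<subseteq> carrier K \<and> finite {s. u s \<noteq> \<zero>\<^bsub>K\<^esub>} \<and> {s. u s \<noteq> \<zero>\<^bsub>K\<^esub>} \<subseteq> S},
      mult = undefined, one = undefined,
      zero = (\<lambda>s. \<zero>\<^bsub>K\<^esub>), add = (\<lambda>u v s. u s \<oplus>\<^bsub>K\<^esub> v s),
      smult = (\<lambda>k u s. k \<otimes>\<^bsub>K\<^esub> u s)\<rparr>"

definition basis_vec :: "('k, 'r) ring_scheme \<Rightarrow> 's \<Rightarrow> 's \<Rightarrow> 'k" where
  "basis_vec K s = (\<lambda>t. if t = s then \<one>\<^bsub>K\<^esub> else \<zero>\<^bsub>K\<^esub>)"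

definition bilinearity_span ::
    "('k, 'r) ring_scheme \<Rightarrow> ('k, 'v, 'x) module_scheme \<Rightarrow> ('k, 'w, 'y) module_scheme
      \<Rightarrow> ('v \<times> 'w \<Rightarrow> 'k) set" where
  "bilinearity_span K V W =
    (let L = free_space K (carrier V \<times> carrier W); e = (\<lambda>v w. basis_vec K (v, w)) in
     lin_span K L
      ({e (v \<oplus>\<^bsub>V\<^esub> v') w \<ominus>\<^bsub>L\<^esub> (e v w \<oplus>\<^bsub>L\<^esub> e v' w) | v v' w.
          v \<in> carrier V \<and> v' \<in> carrier V \<and> w \<in> carrier W} \<union>
       {e v (w \<oplus>\<^bsub>W\<^esub> w') \<ominus>\<^bsub>L\<^esub> (e v w \<oplus>\<^bsub>L\<^esub> e v w') | v w w'.
          v \<in> carrier V \<and> w \<in> carrier W \<and> w' \<in> carrier W} \<union>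
       {e (k \<odot>\<^bsub>V\<^esub> v) w \<ominus>\<^bsub>L\<^esub> (k \<odot>\<^bsub>L\<^esub> e v w) | k v w.
          k \<in> carrier K \<and> v \<in> carrier V \<and> w \<in> carrier W} \<union>
       {e v (k \<odot>\<^bsub>W\<^esub> w) \<ominus>\<^bsub>L\<^esub> (k \<odot>\<^bsub>L\<^esub> e v w) | k v w.
          k \<in> carrier K \<and> v \<in> carrier V \<and> w \<in> carrier W}))"

definition tensor_space ::
    "('k, 'r) ring_scheme \<Rightarrow> ('k, 'v, 'x) module_scheme \<Rightarrow> ('k, 'w, 'y) module_scheme
      \<Rightarrow> ('k, ('v \<times> 'w \<Rightarrow> 'k) set) module" where
  "tensor_space K V W =
     quotient_space (free_space K (carrier V \<times> carrier W)) (bilinearity_span K V W)"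

definition tens ::
    "('k, 'r) ring_scheme \<Rightarrow> ('k, 'v, 'x) module_scheme \<Rightarrow> ('k, 'w, 'y) module_scheme
      \<Rightarrow> 'v \<Rightarrow> 'w \<Rightarrow> ('v \<times> 'w \<Rightarrow> 'k) set" where
  "tens K V W v w =
     bilinearity_span K V W +>\<^bsub>free_space K (carrier V \<times> carrier W)\<^esub> basis_vec K (v, w)"

text \<open>Sweedler notation: for \<open>t = \<Sum> v \<otimes> w\<close> and a bilinear map \<open>f\<close> with values in \<open>X\<close>,
  \<open>sweedler K X t (\<lambda>v w. f v w)\<close> is \<open>\<Sum> f v w\<close>, i.e. the value at \<open>t\<close> of the linear map induced
  by \<open>f\<close>. A tensor is a coset of formal sums of pairs; the evaluation below is constant on each
  coset when \<open>f\<close> is bilinear.\<close>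

definition sweedler ::
    "('k, 'r) ring_scheme \<Rightarrow> ('k, 'u, 'x) module_scheme \<Rightarrow> ('v \<times> 'w \<Rightarrow> 'k) set
      \<Rightarrow> ('v \<Rightarrow> 'w \<Rightarrow> 'u) \<Rightarrow> 'u" where
  "sweedler K X t f =
     the_elem ((\<lambda>u. \<Oplus>\<^bsub>X\<^esub>p\<in>{p. u p \<noteq> \<zero>\<^bsub>K\<^esub>}. u p \<odot>\<^bsub>X\<^esub> f (fst p) (snd p)) ` t)"

definition tensor ::
    "('k, 'r) ring_scheme \<Rightarrow> ('k, 'v, 'x) hom_space_scheme \<Rightarrow> ('k, 'w, 'y) hom_space_scheme
      \<Rightarrow> ('k, ('v \<times> 'w \<Rightarrow> 'k) set) hom_space" where
  "tensor K V W =
     module.extend (tensor_space K V W)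
       (hom_space.fields
          (\<lambda>t. sweedler K (tensor_space K V W) t (\<lambda>v w. tens K V W (alpha V v) (alpha W w))))"

section \<open>Hom-structures\<close>

definition hom_space :: "('k, 'r) ring_scheme \<Rightarrow> ('k, 'v, 'x) hom_space_scheme \<Rightarrow> bool" where
  "hom_space K V \<longleftrightarrow> module K V \<and> linear_map K V V (alpha V)"

definition hom_algebra :: "('k, 'r) ring_scheme \<Rightarrow> ('k, 'a, 'x) hom_space_scheme \<Rightarrow> bool" where
  "hom_algebra K A \<longleftrightarrow>
     hom_space K A \<and>
     bilinear_map K A A A (mult A) \<and>
     \<one>\<^bsub>A\<^esub> \<in> carrier A \<and>
     (\<forall>a\<in>carrier A. \<forall>b\<in>carrier A. alpha A (a \<otimes>\<^bsub>A\<^esub> b) = alpha A a \<otimes>\<^bsub>A\<^esub> alpha A b) \<and>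
     alpha A \<one>\<^bsub>A\<^esub> = \<one>\<^bsub>A\<^esub> \<and>
     (\<forall>a\<in>carrier A. \<one>\<^bsub>A\<^esub> \<otimes>\<^bsub>A\<^esub> a = alpha A a \<and> a \<otimes>\<^bsub>A\<^esub> \<one>\<^bsub>A\<^esub> = alpha A a) \<and>
     (\<forall>a\<in>carrier A. \<forall>b\<in>carrier A. \<forall>c\<in>carrier A.
        alpha A a \<otimes>\<^bsub>A\<^esub> (b \<otimes>\<^bsub>A\<^esub> c) = (a \<otimes>\<^bsub>A\<^esub> b) \<otimes>\<^bsub>A\<^esub> alpha A c)"

text \<open>In the coassociativity conditions both sides are elements of \<open>C \<otimes> (C \<otimes> C)\<close>
  (respectively \<open>M \<otimes> (C \<otimes> C)\<close>).\<close>

definition hom_coalgebra :: "('k, 'r) ring_scheme \<Rightarrow> ('k, 'c, 'x) hom_bialg_scheme \<Rightarrow> bool" where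
  "hom_coalgebra K C \<longleftrightarrow>
     hom_space K C \<and>
     linear_map K C (tensor K C C) (comul C) \<and>
     linear_form K C (counit C) \<and>
     (\<forall>c\<in>carrier C. counit C (alpha C c) = counit C c) \<and>
     (\<forall>c\<in>carrier C. alpha (tensor K C C) (comul C c) = comul C (alpha C c)) \<and>
     (\<forall>c\<in>carrier C.
        sweedler K C (comul C c) (\<lambda>c1 c2. counit C c1 \<odot>\<^bsub>C\<^esub> c2) = alpha C c \<and>
        sweedler K C (comul C c) (\<lambda>c1 c2. counit C c2 \<odot>\<^bsub>C\<^esub> c1) = alpha C c) \<and>
     (\<forall>c\<in>carrier C.
        (let T = tensor K C (tensor K C C) in
         sweedler K T (comul C c) (\<lambda>c1 c2.
           sweedler K T (comul C c1) (\<lambda>c11 c12.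
             tens K C (tensor K C C) c11 (tens K C C c12 (alpha C c2)))) =
         sweedler K T (comul C c) (\<lambda>c1 c2.
           tens K C (tensor K C C) (alpha C c1) (comul C c2))))"

definition tensor_mult ::
    "('k, 'r) ring_scheme \<Rightarrow> ('k, 'a, 'x) hom_space_scheme \<Rightarrow> ('k, 'b, 'y) hom_space_scheme
      \<Rightarrow> ('a \<times> 'b \<Rightarrow> 'k) set \<Rightarrow> ('a \<times> 'b \<Rightarrow> 'k) set \<Rightarrow> ('a \<times> 'b \<Rightarrow> 'k) set" where
  "tensor_mult K A B s t =
     sweedler K (tensor K A B) s (\<lambda>a b.
       sweedler K (tensor K A B) t (\<lambda>a' b'. tens K A B (a \<otimes>\<^bsub>A\<^esub> a') (b \<otimes>\<^bsub>B\<^esub> b')))"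

definition hom_bialgebra :: "('k, 'r) ring_scheme \<Rightarrow> ('k, 'b, 'x) hom_bialg_scheme \<Rightarrow> bool" where
  "hom_bialgebra K B \<longleftrightarrow>
     hom_algebra K B \<and> hom_coalgebra K B \<and>
     (\<forall>a\<in>carrier B. \<forall>b\<in>carrier B.
        comul B (a \<otimes>\<^bsub>B\<^esub> b) = tensor_mult K B B (comul B a) (comul B b)) \<and>
     comul B \<one>\<^bsub>B\<^esub> = tens K B B \<one>\<^bsub>B\<^esub> \<one>\<^bsub>B\<^esub> \<and>
     (\<forall>a\<in>carrier B. \<forall>b\<in>carrier B. counit B (a \<otimes>\<^bsub>B\<^esub> b) = counit B a \<otimes>\<^bsub>K\<^esub> counit B b) \<and>
     counit B \<one>\<^bsub>B\<^esub> = \<one>\<^bsub>K\<^esub>"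

definition antipode ::
    "('k, 'r) ring_scheme \<Rightarrow> ('k, 'h, 'x) hom_bialg_scheme \<Rightarrow> ('h \<Rightarrow> 'h) \<Rightarrow> bool" where
  "antipode K H S \<longleftrightarrow>
     linear_map K H H S \<and>
     (\<forall>h\<in>carrier H. S (alpha H h) = alpha H (S h)) \<and>
     (\<forall>h\<in>carrier H.
        sweedler K H (comul H h) (\<lambda>h1 h2. S h1 \<otimes>\<^bsub>H\<^esub> h2) = counit H h \<odot>\<^bsub>H\<^esub> \<one>\<^bsub>H\<^esub> \<and>
        sweedler K H (comul H h) (\<lambda>h1 h2. h1 \<otimes>\<^bsub>H\<^esub> S h2) = counit H h \<odot>\<^bsub>H\<^esub> \<one>\<^bsub>H\<^esub>)"

definition hom_hopf_algebra :: "('k, 'r) ring_scheme \<Rightarrow> ('k, 'h, 'x) hom_bialg_scheme \<Rightarrow> bool" where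
  "hom_hopf_algebra K H \<longleftrightarrow> hom_bialgebra K H \<and> (\<exists>S. antipode K H S)"

definition twisted_antipode ::
    "('k, 'r) ring_scheme \<Rightarrow> ('k, 'b, 'x) hom_bialg_scheme \<Rightarrow> ('b \<Rightarrow> 'b) \<Rightarrow> bool" where
  "twisted_antipode K B S \<longleftrightarrow>
     linear_map K B B S \<and>
     (\<forall>b\<in>carrier B. S (alpha B b) = alpha B (S b)) \<and>
     (\<forall>b\<in>carrier B.
        sweedler K B (comul B b) (\<lambda>b1 b2. S b2 \<otimes>\<^bsub>B\<^esub> b1) = counit B b \<odot>\<^bsub>B\<^esub> \<one>\<^bsub>B\<^esub> \<and>
        sweedler K B (comul B b) (\<lambda>b1 b2. b2 \<otimes>\<^bsub>B\<^esub> S b1) = counit B b \<odot>\<^bsub>B\<^esub> \<one>\<^bsub>B\<^esub>)"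

definition hom_bialgebra_map ::
    "('k, 'r) ring_scheme \<Rightarrow> ('k, 'a, 'x) hom_bialg_scheme \<Rightarrow> ('k, 'b, 'y) hom_bialg_scheme
      \<Rightarrow> ('a \<Rightarrow> 'b) \<Rightarrow> bool" where
  "hom_bialgebra_map K A B f \<longleftrightarrow>
     linear_map K A B f \<and>
     (\<forall>a\<in>carrier A. f (alpha A a) = alpha B (f a)) \<and>
     (\<forall>a\<in>carrier A. \<forall>b\<in>carrier A. f (a \<otimes>\<^bsub>A\<^esub> b) = f a \<otimes>\<^bsub>B\<^esub> f b) \<and>
     f \<one>\<^bsub>A\<^esub> = \<one>\<^bsub>B\<^esub> \<and>
     (\<forall>a\<in>carrier A.
        comul B (f a) = sweedler K (tensor K B B) (comul A a) (\<lambda>a1 a2. tens K B B (f a1) (f a2))) \<and>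
     (\<forall>a\<in>carrier A. counit B (f a) = counit A a)"

definition hom_module ::
    "('k, 'r) ring_scheme \<Rightarrow> ('k, 'a, 'x) hom_space_scheme \<Rightarrow> ('k, 'm, 'y) hom_space_scheme
      \<Rightarrow> ('a \<Rightarrow> 'm \<Rightarrow> 'm) \<Rightarrow> bool" where
  "hom_module K A M ac \<longleftrightarrow>
     hom_space K M \<and>
     bilinear_map K A M M ac \<and>
     (\<forall>m\<in>carrier M. ac \<one>\<^bsub>A\<^esub> m = alpha M m) \<and>
     (\<forall>a\<in>carrier A. \<forall>m\<in>carrier M. alpha M (ac a m) = ac (alpha A a) (alpha M m)) \<and>
     (\<forall>a\<in>carrier A. \<forall>b\<in>carrier A. \<forall>m\<in>carrier M.
        ac (alpha A a) (ac b m) = ac (a \<otimes>\<^bsub>A\<^esub> b) (alpha M m))"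

definition hom_comodule ::
    "('k, 'r) ring_scheme \<Rightarrow> ('k, 'c, 'x) hom_bialg_scheme \<Rightarrow> ('k, 'm, 'y) hom_space_scheme
      \<Rightarrow> ('m \<Rightarrow> ('m \<times> 'c \<Rightarrow> 'k) set) \<Rightarrow> bool" where
  "hom_comodule K C M \<rho> \<longleftrightarrow>
     hom_space K M \<and>
     linear_map K M (tensor K M C) \<rho> \<and>
     (\<forall>m\<in>carrier M. sweedler K M (\<rho> m) (\<lambda>m0 m1. counit C m1 \<odot>\<^bsub>M\<^esub> m0) = alpha M m) \<and>
     (\<forall>m\<in>carrier M. alpha (tensor K M C) (\<rho> m) = \<rho> (alpha M m)) \<and>
     (\<forall>m\<in>carrier M.
        (let T = tensor K M (tensor K C C) in
         sweedler K T (\<rho> m) (\<lambda>m0 m1.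
           sweedler K T (\<rho> m0) (\<lambda>m00 m01.
             tens K M (tensor K C C) m00 (tens K C C m01 (alpha C m1)))) =
         sweedler K T (\<rho> m) (\<lambda>m0 m1.
           tens K M (tensor K C C) (alpha M m0) (comul C m1))))"

section \<open>Doi-Hopf data and Doi-Hopf modules\<close>

text \<open>In a datum \<open>(H, A, C)\<close>, \<open>datum_coact\<close> is the coaction of \<open>H\<close> on \<open>A\<close> and
  \<open>datum_act\<close> the action of \<open>H\<close> on \<open>C\<close>.\<close>

record ('k, 'h, 'a, 'c) datum =
  datum_H :: "('k, 'h) hom_bialg"
  datum_A :: "('k, 'a) hom_bialg"
  datum_C :: "('k, 'c) hom_bialg"
  datum_coact :: "'a \<Rightarrow> ('a \<times> 'h \<Rightarrow> 'k) set"
  datum_act :: "'h \<Rightarrow> 'c \<Rightarrow> 'c"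

record ('k, 'a, 'c, 'm) dh_module = "('k, 'm) hom_space" +
  act :: "'a \<Rightarrow> 'm \<Rightarrow> 'm"
  coact :: "'m \<Rightarrow> ('m \<times> 'c \<Rightarrow> 'k) set"

definition comodule_algebra ::
    "('k, 'r) ring_scheme \<Rightarrow> ('k, 'h, 'x) hom_bialg_scheme \<Rightarrow> ('k, 'a, 'y) hom_space_scheme
      \<Rightarrow> ('a \<Rightarrow> ('a \<times> 'h \<Rightarrow> 'k) set) \<Rightarrow> bool" where
  "comodule_algebra K H A \<rho> \<longleftrightarrow>
     hom_algebra K A \<and> hom_comodule K H A \<rho> \<and>
     (\<forall>a\<in>carrier A. \<forall>b\<in>carrier A. \<rho> (a \<otimes>\<^bsub>A\<^esub> b) = tensor_mult K A H (\<rho> a) (\<rho> b)) \<and>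
     \<rho> \<one>\<^bsub>A\<^esub> = tens K A H \<one>\<^bsub>A\<^esub> \<one>\<^bsub>H\<^esub>"

definition module_coalgebra ::
    "('k, 'r) ring_scheme \<Rightarrow> ('k, 'h, 'x) hom_bialg_scheme \<Rightarrow> ('k, 'c, 'y) hom_bialg_scheme
      \<Rightarrow> ('h \<Rightarrow> 'c \<Rightarrow> 'c) \<Rightarrow> bool" where
  "module_coalgebra K H C ac \<longleftrightarrow>
     hom_coalgebra K C \<and> hom_module K H C ac \<and>
     (\<forall>h\<in>carrier H. \<forall>c\<in>carrier C.
        comul C (ac h c) =
          sweedler K (tensor K C C) (comul H h) (\<lambda>h1 h2.
            sweedler K (tensor K C C) (comul C c) (\<lambda>c1 c2. tens K C C (ac h1 c1) (ac h2 c2)))) \<and>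
     (\<forall>h\<in>carrier H. \<forall>c\<in>carrier C. counit C (ac h c) = counit H h \<otimes>\<^bsub>K\<^esub> counit C c)"

definition doi_hopf_datum :: "('k, 'r) ring_scheme \<Rightarrow> ('k, 'h, 'a, 'c) datum \<Rightarrow> bool" where
  "doi_hopf_datum K D \<longleftrightarrow>
     hom_hopf_algebra K (datum_H D) \<and>
     comodule_algebra K (datum_H D) (datum_A D) (datum_coact D) \<and>
     module_coalgebra K (datum_H D) (datum_C D) (datum_act D)"

definition monoidal_datum :: "('k, 'r) ring_scheme \<Rightarrow> ('k, 'h, 'a, 'c) datum \<Rightarrow> bool" where
  "monoidal_datum K D \<longleftrightarrow>
    (let H = datum_H D; A = datum_A D; C = datum_C D; \<rho> = datum_coact D; ac = datum_act D;
         T = tensor K A (tensor K A C) in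
     doi_hopf_datum K D \<and> hom_bialgebra K A \<and> hom_bialgebra K C \<and>
     (\<forall>a\<in>carrier A. \<forall>c\<in>carrier C. \<forall>d\<in>carrier C.
        sweedler K T (\<rho> a) (\<lambda>a0 a1.
          sweedler K T (comul A a0) (\<lambda>a01 a02.
            tens K A (tensor K A C) a01
              (tens K A C a02 (ac (alpha H (alpha H a1)) (c \<otimes>\<^bsub>C\<^esub> d))))) =
        sweedler K T (comul A a) (\<lambda>a1 a2.
          sweedler K T (\<rho> a1) (\<lambda>a10 a11.
            sweedler K T (\<rho> a2) (\<lambda>a20 a21.
              tens K A (tensor K A C) a10 (tens K A C a20 (ac a11 c \<otimes>\<^bsub>C\<^esub> ac a21 d)))))) \<and>
     (\<forall>a\<in>carrier A.
        counit A a \<odot>\<^bsub>C\<^esub> \<one>\<^bsub>C\<^esub> =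
        sweedler K C (\<rho> a) (\<lambda>a0 a1. counit A a0 \<odot>\<^bsub>C\<^esub> ac a1 \<one>\<^bsub>C\<^esub>)))"

text \<open>\<open>(id, \<lambda>, id) : (H, A, C) \<rightarrow> (H, A', C)\<close>\<close>

definition monoidal_morphism ::
    "('k, 'r) ring_scheme \<Rightarrow> ('k, 'h, 'a, 'c) datum \<Rightarrow> ('k, 'h, 'b, 'c) datum
      \<Rightarrow> ('a \<Rightarrow> 'b) \<Rightarrow> bool" where
  "monoidal_morphism K D D' l \<longleftrightarrow>
     monoidal_datum K D \<and> monoidal_datum K D' \<and>
     datum_H D' = datum_H D \<and> datum_C D' = datum_C D \<and> datum_act D' = datum_act D \<and>
     hom_bialgebra_map K (datum_A D) (datum_A D') l \<and>
     (\<forall>a\<in>carrier (datum_A D).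
        datum_coact D' (l a) =
        sweedler K (tensor K (datum_A D') (datum_H D)) (datum_coact D a)
          (\<lambda>a0 a1. tens K (datum_A D') (datum_H D) (l a0) a1))"

definition doi_hopf_module ::
    "('k, 'r) ring_scheme \<Rightarrow> ('k, 'h, 'a, 'c) datum \<Rightarrow> ('k, 'a, 'c, 'm) dh_module \<Rightarrow> bool" where
  "doi_hopf_module K D M \<longleftrightarrow>
     hom_module K (datum_A D) M (act M) \<and>
     hom_comodule K (datum_C D) M (coact M) \<and>
     (\<forall>a\<in>carrier (datum_A D). \<forall>m\<in>carrier M.
        coact M (act M a m) =
        sweedler K (tensor K M (datum_C D)) (datum_coact D a) (\<lambda>a0 a1.
          sweedler K (tensor K M (datum_C D)) (coact M m) (\<lambda>m0 m1.
            tens K M (datum_C D) (act M a0 m0) (datum_act D a1 m1))))"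

definition doi_hopf_map ::
    "('k, 'r) ring_scheme \<Rightarrow> ('k, 'h, 'a, 'c) datum \<Rightarrow> ('k, 'a, 'c, 'm) dh_module
      \<Rightarrow> ('k, 'a, 'c, 'n) dh_module \<Rightarrow> ('m \<Rightarrow> 'n) \<Rightarrow> bool" where
  "doi_hopf_map K D M N f \<longleftrightarrow>
     linear_map K M N f \<and>
     (\<forall>m\<in>carrier M. f (alpha M m) = alpha N (f m)) \<and>
     (\<forall>a\<in>carrier (datum_A D). \<forall>m\<in>carrier M. f (act M a m) = act N a (f m)) \<and>
     (\<forall>m\<in>carrier M.
        coact N (f m) =
        sweedler K (tensor K N (datum_C D)) (coact M m)
          (\<lambda>m0 m1. tens K N (datum_C D) (f m0) m1))"

text \<open>Isomorphism in the category of Doi-Hopf modules over \<open>D\<close>; in particular both sides are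
  required to be objects of that category.\<close>

definition doi_hopf_iso ::
    "('k, 'r) ring_scheme \<Rightarrow> ('k, 'h, 'a, 'c) datum \<Rightarrow> ('k, 'a, 'c, 'm) dh_module
      \<Rightarrow> ('k, 'a, 'c, 'n) dh_module \<Rightarrow> bool" where
  "doi_hopf_iso K D M N \<longleftrightarrow>
     doi_hopf_module K D M \<and> doi_hopf_module K D N \<and>
     (\<exists>f g. doi_hopf_map K D M N f \<and> doi_hopf_map K D N M g \<and>
        (\<forall>m\<in>carrier M. g (f m) = m) \<and> (\<forall>n\<in>carrier N. f (g n) = n))"

abbreviation alpha_bij :: "('k, 'v, 'x) hom_space_scheme \<Rightarrow> bool" where
  "alpha_bij V \<equiv> bij_betw (alpha V) (carrier V) (carrier V)"

abbreviation alpha_inv :: "('k, 'v, 'x) hom_space_scheme \<Rightarrow> 'v \<Rightarrow> 'v" where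
  "alpha_inv V \<equiv> inv_into (carrier V) (alpha V)"

definition make_dh_module ::
    "('k, 'm) hom_space \<Rightarrow> ('a \<Rightarrow> 'm \<Rightarrow> 'm) \<Rightarrow> ('m \<Rightarrow> ('m \<times> 'c \<Rightarrow> 'k) set)
      \<Rightarrow> ('k, 'a, 'c, 'm) dh_module" where
  "make_dh_module V ac \<rho> = hom_space.extend V (dh_module.fields ac \<rho>)"

definition dh_tensor ::
    "('k, 'r) ring_scheme \<Rightarrow> ('k, 'h, 'a, 'c) datum \<Rightarrow> ('k, 'a, 'c, 'm) dh_module
      \<Rightarrow> ('k, 'a, 'c, 'n) dh_module \<Rightarrow> ('k, 'a, 'c, ('m \<times> 'n \<Rightarrow> 'k) set) dh_module" where
  "dh_tensor K D M N =
    (let A = datum_A D; C = datum_C D; T = tensor K M N in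
     make_dh_module T
       (\<lambda>a t. sweedler K T (comul A a) (\<lambda>a1 a2.
          sweedler K T t (\<lambda>m n. tens K M N (act M a1 m) (act N a2 n))))
       (\<lambda>t. sweedler K (tensor K T C) t (\<lambda>m n.
          sweedler K (tensor K T C) (coact M m) (\<lambda>m0 m1.
            sweedler K (tensor K T C) (coact N n) (\<lambda>n0 n1.
              tens K T C (tens K M N m0 n0) (alpha_inv C (alpha_inv C (m1 \<otimes>\<^bsub>C\<^esub> n1))))))))"

text \<open>\<open>A\<close> as a Doi-Hopf module over \<open>(H, A, C)\<close>\<close>

definition dh_regular ::
    "('k, 'r) ring_scheme \<Rightarrow> ('k, 'h, 'a, 'c) datum \<Rightarrow> ('k, 'a, 'c, 'a) dh_module" where
  "dh_regular K D =
    (let A = datum_A D; C = datum_C D in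
     make_dh_module (hom_space.truncate A)
       (\<lambda>a b. alpha_inv A a \<otimes>\<^bsub>A\<^esub> b)
       (\<lambda>a. sweedler K (tensor K A C) (datum_coact D a)
          (\<lambda>a0 a1. tens K A C a0 (datum_act D a1 \<one>\<^bsub>C\<^esub>))))"

section \<open>The functors \<open>F\<close> and \<open>G\<close> on objects\<close>

definition balance_span ::
    "('k, 'r) ring_scheme \<Rightarrow> ('k, 'h, 'a, 'c) datum \<Rightarrow> ('k, 'h, 'b, 'c) datum
      \<Rightarrow> ('a \<Rightarrow> 'b) \<Rightarrow> ('k, 'a, 'c, 'm) dh_module \<Rightarrow> ('b \<times> 'm \<Rightarrow> 'k) set set" where
  "balance_span K D D' l M =
    (let A = datum_A D; A' = datum_A D'; T = tensor K A' M in
     lin_span K T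
       {tens K A' M (b \<otimes>\<^bsub>A'\<^esub> l a) (alpha M m) \<ominus>\<^bsub>T\<^esub> tens K A' M (alpha A' b) (act M a m) | b a m.
          b \<in> carrier A' \<and> a \<in> carrier A \<and> m \<in> carrier M})"

definition btens ::
    "('k, 'r) ring_scheme \<Rightarrow> ('k, 'h, 'a, 'c) datum \<Rightarrow> ('k, 'h, 'b, 'c) datum
      \<Rightarrow> ('a \<Rightarrow> 'b) \<Rightarrow> ('k, 'a, 'c, 'm) dh_module \<Rightarrow> 'b \<Rightarrow> 'm \<Rightarrow> ('b \<times> 'm \<Rightarrow> 'k) set set" where
  "btens K D D' l M b m =
     balance_span K D D' l M +>\<^bsub>tensor K (datum_A D') M\<^esub> tens K (datum_A D') M b m"

text \<open>The analogue of \<^const>\<open>sweedler\<close> for \<open>A' \<otimes>\<^sub>A M\<close>: an element of \<open>A' \<otimes>\<^sub>A M\<close> is a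
  coset in \<open>A' \<otimes> M\<close>, and a balanced bilinear \<open>f\<close> takes a single value on it.\<close>

definition bsweedler ::
    "('k, 'r) ring_scheme \<Rightarrow> ('k, 'u, 'x) module_scheme \<Rightarrow> ('b \<times> 'm \<Rightarrow> 'k) set set
      \<Rightarrow> ('b \<Rightarrow> 'm \<Rightarrow> 'u) \<Rightarrow> 'u" where
  "bsweedler K X z f = the_elem ((\<lambda>t. sweedler K X t f) ` z)"

definition F_space ::
    "('k, 'r) ring_scheme \<Rightarrow> ('k, 'h, 'a, 'c) datum \<Rightarrow> ('k, 'h, 'b, 'c) datum
      \<Rightarrow> ('a \<Rightarrow> 'b) \<Rightarrow> ('k, 'a, 'c, 'm) dh_module \<Rightarrow> ('k, ('b \<times> 'm \<Rightarrow> 'k) set set) hom_space" where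
  "F_space K D D' l M =
    (let Q = quotient_space (tensor K (datum_A D') M) (balance_span K D D' l M) in
     module.extend Q (hom_space.fields
       (\<lambda>z. bsweedler K Q z (\<lambda>b m. btens K D D' l M (alpha (datum_A D') b) (alpha M m)))))"

definition F_obj ::
    "('k, 'r) ring_scheme \<Rightarrow> ('k, 'h, 'a, 'c) datum \<Rightarrow> ('k, 'h, 'b, 'c) datum
      \<Rightarrow> ('a \<Rightarrow> 'b) \<Rightarrow> ('k, 'a, 'c, 'm) dh_module
      \<Rightarrow> ('k, 'b, 'c, ('b \<times> 'm \<Rightarrow> 'k) set set) dh_module" where
  "F_obj K D D' l M =
    (let A' = datum_A D'; C = datum_C D; Q = F_space K D D' l M; q = btens K D D' l M in
     make_dh_module Q
       (\<lambda>a z. bsweedler K Q z (\<lambda>b m. q (alpha A' a \<otimes>\<^bsub>A'\<^esub> b) (alpha M m)))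
       (\<lambda>z. bsweedler K (tensor K Q C) z (\<lambda>b m.
          sweedler K (tensor K Q C) (datum_coact D' b) (\<lambda>b0 b1.
            sweedler K (tensor K Q C) (coact M m) (\<lambda>m0 m1.
              tens K Q C (q b0 m0) (alpha_inv C (alpha_inv C (datum_act D b1 m1))))))))"

definition G_space ::
    "('k, 'r) ring_scheme \<Rightarrow> ('k, 'h, 'b, 'c) datum \<Rightarrow> ('k, 'b, 'c, 'n) dh_module
      \<Rightarrow> ('k, ('n \<times> 'c \<Rightarrow> 'k) set) hom_space" where
  "G_space K D' N =
    (let C = datum_C D'; T = tensor K N (tensor K C C) in
     (tensor K N C)\<lparr>carrier := {t \<in> carrier (tensor K N C).
        sweedler K T t (\<lambda>n c. tens K N (tensor K C C) (alpha N n) (comul C c)) =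
        sweedler K T t (\<lambda>n c. sweedler K T (coact N n) (\<lambda>n0 n1.
          tens K N (tensor K C C) n0 (tens K C C n1 (alpha C c))))}\<rparr>)"

text \<open>\<open>G(N) \<otimes> C\<close> embeds into \<open>(N \<otimes> C) \<otimes> C\<close> but is not literally a subset of it. The
  coaction of \<open>G(N)\<close> at \<open>\<Sum> n \<otimes> c\<close> is the unique element of \<open>G(N) \<otimes> C\<close> whose image in
  \<open>(N \<otimes> C) \<otimes> C\<close> is \<open>\<Sum> (\<alpha>(n) \<otimes> c\<^sub>1) \<otimes> \<alpha>\<inverse>(c\<^sub>2)\<close>.\<close>

definition G_obj ::
    "('k, 'r) ring_scheme \<Rightarrow> ('k, 'h, 'a, 'c) datum \<Rightarrow> ('k, 'h, 'b, 'c) datum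
      \<Rightarrow> ('a \<Rightarrow> 'b) \<Rightarrow> ('k, 'b, 'c, 'n) dh_module
      \<Rightarrow> ('k, 'a, 'c, ('n \<times> 'c \<Rightarrow> 'k) set) dh_module" where
  "G_obj K D D' l N =
    (let C = datum_C D; NC = tensor K N C; E = G_space K D' N; T = tensor K NC C in
     make_dh_module E
       (\<lambda>a t. sweedler K NC (datum_coact D a) (\<lambda>a0 a1.
          sweedler K NC t (\<lambda>n c. tens K N C (act N (l a0) n) (datum_act D a1 c))))
       (\<lambda>t. THE u. u \<in> carrier (tensor K E C) \<and>
          sweedler K T u (\<lambda>e c. tens K NC C e c) =
          sweedler K T t (\<lambda>n c. sweedler K T (comul C c) (\<lambda>c1 c2.
            tens K NC C (tens K N C (alpha N n) c1) (alpha_inv C c2)))))"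

end

theory Submission
  imports Defs
begin

text \<open>
  Both isomorphisms are Hom-versions of the projection formula for extension and restriction of
  scalars along \<open>\<lambda>\<close>, and both rest on two observations.

  First, \<open>G\<close> is restriction of scalars. The coaction of \<open>N\<close> takes values in \<open>N \<box>\<^sub>C C\<close> by
  coassociativity, and \<open>\<alpha>\<^sup>-\<^sup>1 \<circ> (id \<otimes> \<epsilon>)\<close> inverts it there; it carries the \<open>A\<close>-action through \<open>\<lambda>\<close> on
  \<open>N\<close> to the action on \<open>G N\<close> (\<open>G_iso_restrict_scalars\<close>). Since tensor products and \<open>F\<close> preserve
  isomorphisms, \<open>G N\<close> may be replaced by \<open>N\<close> with scalars restricted.

  Secondly, there is then an explicit pair of maps
  \<open>\<Phi> : F(M \<otimes> N) \<rightarrow> F M \<otimes> N\<close>, \<open>b \<otimes> (m \<otimes> n) \<mapsto> (b\<^sub>1 \<otimes> m) \<otimes> \<alpha>\<^sup>-\<^sup>2(b\<^sub>2 \<cdot> n)\<close>, and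
  \<open>\<Theta> : F M \<otimes> N \<rightarrow> F(M \<otimes> N)\<close>, \<open>(b \<otimes> m) \<otimes> n \<mapsto> \<alpha>\<^sup>-\<^sup>2(b\<^sub>1) \<otimes> (m \<otimes> \<alpha>\<^sup>-\<^sup>2(S(b\<^sub>2)) \<cdot> n)\<close>.
  Balancedness and \<open>A'\<close>-linearity of \<open>\<Phi>\<close> come from multiplicativity of the comultiplication, its
  colinearity is the compatibility condition of a monoidal datum (\<open>Phi_doi_hopf_map\<close>). That \<open>\<Theta>\<close> is
  balanced and that the two maps are mutually inverse is one cancellation, applied several times:
  acting by \<open>S(b\<^sub>2)\<close> and then by the neighbouring leg of \<open>b\<^sub>1\<close> gives the counit
  (\<open>convolution_cancel\<close>, \<open>Theta_balanced\<close>, \<open>Phi_iso\<close>). Being inverse to a morphism, \<open>\<Theta>\<close> is one.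

  The second isomorphism is the first for the datum in which \<open>A\<close> and \<open>A'\<close> carry the opposite
  comultiplication and \<open>C\<close> the opposite multiplication. A twisted antipode of \<open>A'\<close> is an antipode of
  its co-opposite, \<open>F\<close> and the notion of Doi-Hopf module are the same for both data, and the products
  of modules differ by the exchange of the two factors (\<open>doi_hopf_iso_swap\<close>).

  The isomorphism \<open>F A \<cong> A'\<close> sends \<open>b \<otimes> a\<close> to \<open>\<alpha>\<^sup>-\<^sup>3(b) \<lambda>(\<alpha>\<^sup>-\<^sup>2(a))\<close>; its inverse is
  \<open>b \<mapsto> \<alpha>\<^sup>2(b) \<otimes> 1\<close> (\<open>F_regular\<close>).

  Tensors are cosets of formal sums, so all computations are organised as manipulations of Sweedler
  sums \<open>sw\<close>. Each axiom is put into the form of an equation between two such sums with an arbitrary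
  multilinear summand. Multilinearity of a concrete summand is decided by the simplifier, and an
  equation of linear maps out of a tensor product or out of \<open>F M\<close> is checked on pure tensors.
\<close>

section \<open>Linear maps and quotient spaces\<close>

lemma linear_mapI:
  assumes "\<And>x. x \<in> carrier V \<Longrightarrow> f x \<in> carrier W"
    and "\<And>x y. x \<in> carrier V \<Longrightarrow> y \<in> carrier V \<Longrightarrow> f (x \<oplus>\<^bsub>V\<^esub> y) = f x \<oplus>\<^bsub>W\<^esub> f y"
    and "\<And>k x. k \<in> carrier K \<Longrightarrow> x \<in> carrier V \<Longrightarrow> f (k \<odot>\<^bsub>V\<^esub> x) = k \<odot>\<^bsub>W\<^esub> f x"
  shows "linear_map K V W f"
  using assms unfolding linear_map_def by auto

lemma linear_map_closed: "linear_map K V W f \<Longrightarrow> x \<in> carrier V \<Longrightarrow> f x \<in> carrier W"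
  and linear_map_add: "linear_map K V W f \<Longrightarrow> x \<in> carrier V \<Longrightarrow> y \<in> carrier V
     \<Longrightarrow> f (x \<oplus>\<^bsub>V\<^esub> y) = f x \<oplus>\<^bsub>W\<^esub> f y"
  and linear_map_smult: "linear_map K V W f \<Longrightarrow> k \<in> carrier K \<Longrightarrow> x \<in> carrier V
     \<Longrightarrow> f (k \<odot>\<^bsub>V\<^esub> x) = k \<odot>\<^bsub>W\<^esub> f x"
  unfolding linear_map_def by auto

lemma linear_map_cong:
  assumes "module K V" "\<And>x. x \<in> carrier V \<Longrightarrow> f x = g x"
  shows "linear_map K V W f = linear_map K V W g"
proof -
  interpret V: module K V by fact
  show ?thesis using assms(2) unfolding linear_map_def Pi_def by auto
qed

lemma linear_map_compose:
  "linear_map K U V f \<Longrightarrow> linear_map K V W g \<Longrightarrow> linear_map K U W (\<lambda>x. g (f x))"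
  unfolding linear_map_def by (auto simp: Pi_def)

lemmas linear_map_facts = linear_map_closed linear_map_compose[rotated]

lemma linear_map_zero:
  assumes "module K V" "module K W" "linear_map K V W f"
  shows "f \<zero>\<^bsub>V\<^esub> = \<zero>\<^bsub>W\<^esub>"
proof -
  interpret V: module K V by fact
  interpret W: module K W by fact
  have "f \<zero>\<^bsub>V\<^esub> = f (\<zero>\<^bsub>K\<^esub> \<odot>\<^bsub>V\<^esub> \<zero>\<^bsub>V\<^esub>)" by simp
  also have "\<dots> = \<zero>\<^bsub>K\<^esub> \<odot>\<^bsub>W\<^esub> f \<zero>\<^bsub>V\<^esub>" by (rule linear_map_smult[OF assms(3)]) auto
  also have "\<dots> = \<zero>\<^bsub>W\<^esub>" using linear_map_closed[OF assms(3)] by simp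
  finally show ?thesis .
qed

lemma linear_map_finsum:
  assumes "module K V" "module K W" "linear_map K V W f" "\<And>i. i \<in> A \<Longrightarrow> g i \<in> carrier V"
  shows "f (\<Oplus>\<^bsub>V\<^esub>i\<in>A. g i) = (\<Oplus>\<^bsub>W\<^esub>i\<in>A. f (g i))"
proof -
  interpret V: module K V by fact
  interpret W: module K W by fact
  note cl = linear_map_closed[OF assms(3)]
  have z: "f \<zero>\<^bsub>V\<^esub> = \<zero>\<^bsub>W\<^esub>" by (rule linear_map_zero) fact+
  show ?thesis
  proof (cases "finite A")
    case True
    then show ?thesis using assms(4)
    proof induction
      case empty then show ?case by (simp add: z)
    next
      case (insert i A)
      have "f (\<Oplus>\<^bsub>V\<^esub>i\<in>insert i A. g i) = f (g i \<oplus>\<^bsub>V\<^esub> (\<Oplus>\<^bsub>V\<^esub>i\<in>A. g i))"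
        using insert by (subst V.finsum_insert) auto
      also have "\<dots> = f (g i) \<oplus>\<^bsub>W\<^esub> f (\<Oplus>\<^bsub>V\<^esub>i\<in>A. g i)"
        using insert by (intro linear_map_add[OF assms(3)] V.finsum_closed) auto
      also have "\<dots> = (\<Oplus>\<^bsub>W\<^esub>i\<in>insert i A. f (g i))"
        using insert cl by (subst W.finsum_insert) auto
      finally show ?case .
    qed
  next
    case False
    then show ?thesis by (simp add: z V.finsum_infinite W.finsum_infinite)
  qed
qed

lemma linear_map_minus:
  assumes "module K V" "module K W" "linear_map K V W f" "x \<in> carrier V" "y \<in> carrier V"
  shows "f (x \<ominus>\<^bsub>V\<^esub> y) = f x \<ominus>\<^bsub>W\<^esub> f y"
proof -
  interpret V: module K V by fact
  interpret W: module K W by fact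
  note cl = linear_map_closed[OF assms(3)]
  have "f (x \<ominus>\<^bsub>V\<^esub> y) \<oplus>\<^bsub>W\<^esub> f y = f (x \<ominus>\<^bsub>V\<^esub> y \<oplus>\<^bsub>V\<^esub> y)"
    using assms by (intro linear_map_add[OF assms(3), symmetric]) auto
  also have "x \<ominus>\<^bsub>V\<^esub> y \<oplus>\<^bsub>V\<^esub> y = x" using assms
    by (simp add: a_minus_def V.M.a_assoc V.M.l_neg)
  finally have "f x \<ominus>\<^bsub>W\<^esub> f y = (f (x \<ominus>\<^bsub>V\<^esub> y) \<oplus>\<^bsub>W\<^esub> f y) \<ominus>\<^bsub>W\<^esub> f y" by simp
  also have "\<dots> = f (x \<ominus>\<^bsub>V\<^esub> y)" using assms cl
    by (simp add: a_minus_def W.M.a_assoc W.M.r_neg)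
  finally show ?thesis by simp
qed

text \<open>The module axioms are identities, apart from the existence of additive inverses, so they pass
  from \<open>V\<close> to the image of a map that preserves the operations. With \<open>p\<close> a coset map this makes
  quotients into modules; with \<open>p\<close> the identity it transfers the axioms between records that differ
  in other fields only; with \<open>p\<close> a coaction it makes the cotensor product into a module.\<close>

lemma module_image:
  assumes V: "module K V" and im: "p ` carrier V = carrier Q"
    and add: "\<And>x y. x \<in> carrier V \<Longrightarrow> y \<in> carrier V \<Longrightarrow> p x \<oplus>\<^bsub>Q\<^esub> p y = p (x \<oplus>\<^bsub>V\<^esub> y)"
    and smult: "\<And>k x. k \<in> carrier K \<Longrightarrow> x \<in> carrier V \<Longrightarrow> k \<odot>\<^bsub>Q\<^esub> p x = p (k \<odot>\<^bsub>V\<^esub> x)"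
    and zero: "\<zero>\<^bsub>Q\<^esub> = p \<zero>\<^bsub>V\<^esub>"
  shows "module K Q"
proof -
  interpret V: module K V by fact
  have ex: "\<exists>x\<in>carrier V. q = p x" if "q \<in> carrier Q" for q using that im by auto
  have cl: "p x \<in> carrier Q" if "x \<in> carrier V" for x using that im by auto
  show ?thesis
  proof (rule moduleI)
    show "cring K" by (rule V.is_cring)
    show "abelian_group Q"
    proof (rule abelian_groupI)
      fix x assume "x \<in> carrier Q"
      then obtain a where a: "a \<in> carrier V" "x = p a" using ex by blast
      have "p (\<ominus>\<^bsub>V\<^esub> a) \<oplus>\<^bsub>Q\<^esub> x = \<zero>\<^bsub>Q\<^esub>" using a by (simp add: add zero V.M.l_neg)
      then show "\<exists>y\<in>carrier Q. y \<oplus>\<^bsub>Q\<^esub> x = \<zero>\<^bsub>Q\<^esub>" using a cl by blast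
    qed (auto dest!: ex simp: add zero cl V.M.a_ac)
  qed (auto dest!: ex simp: add smult cl V.smult_l_distr V.smult_r_distr V.smult_assoc1)
qed

lemma lin_span_submodule:
  assumes "module K V" "S \<subseteq> carrier V"
  shows "submodule (lin_span K V S) K V" and "S \<subseteq> lin_span K V S"
proof -
  interpret V: module K V by fact
  have c: "submodule (carrier V) K V" by (rule V.carrier_is_submodule)
  show "S \<subseteq> lin_span K V S" unfolding lin_span_def by auto
  show "submodule (lin_span K V S) K V"
  proof (rule V.submoduleI)
    show "lin_span K V S \<subseteq> carrier V" using c assms(2) unfolding lin_span_def by auto
  qed (auto simp: lin_span_def dest: V.submoduleE
      intro: submodule.smult_closed subgroup.one_closed[OF submodule.axioms(1), simplified])
qed

lemma lin_span_minimal: "submodule W K V \<Longrightarrow> S \<subseteq> W \<Longrightarrow> lin_span K V S \<subseteq> W"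
  unfolding lin_span_def by auto

lemma linear_map_vanishes_on_span:
  assumes "module K V" "module K W" "linear_map K V W f" "S \<subseteq> carrier V"
    and "\<And>s. s \<in> S \<Longrightarrow> f s = \<zero>\<^bsub>W\<^esub>" and "x \<in> lin_span K V S"
  shows "f x = \<zero>\<^bsub>W\<^esub>"
proof -
  interpret V: module K V by fact
  interpret W: module K W by fact
  have z: "f \<zero>\<^bsub>V\<^esub> = \<zero>\<^bsub>W\<^esub>" by (rule linear_map_zero) fact+
  have "submodule {x \<in> carrier V. f x = \<zero>\<^bsub>W\<^esub>} K V"
  proof (rule V.submoduleI)
    fix a assume "a \<in> {x \<in> carrier V. f x = \<zero>\<^bsub>W\<^esub>}"
    then show "\<ominus>\<^bsub>V\<^esub> a \<in> {x \<in> carrier V. f x = \<zero>\<^bsub>W\<^esub>}"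
      using linear_map_minus[OF assms(1-3) V.zero_closed, of a] z
      by (auto simp: a_minus_def)
  qed (use z in \<open>auto simp: linear_map_add[OF assms(3)] linear_map_smult[OF assms(3)]\<close>)
  from lin_span_minimal[OF this, of S] assms(4-6) show ?thesis by auto
qed

lemma carrier_quotient_space:
  "carrier (quotient_space V W) = (\<lambda>v. W +>\<^bsub>V\<^esub> v) ` carrier V"
  by (auto simp: quotient_space_def A_RCOSETS_def')

lemma submodule_abelian_subgroup:
  assumes "module K V" "submodule W K V" shows "abelian_subgroup W V"
proof -
  interpret V: module K V by fact
  show ?thesis
    using assms(2) V.M.abelian_group_axioms
    by (intro abelian_subgroupI3 additive_subgroupI) (auto dest: submodule.axioms)
qed

lemma coset_eq_iff:
  assumes "module K V" "submodule W K V" "x \<in> carrier V" "y \<in> carrier V"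
  shows "W +>\<^bsub>V\<^esub> x = W +>\<^bsub>V\<^esub> y \<longleftrightarrow> x \<ominus>\<^bsub>V\<^esub> y \<in> W"
proof -
  interpret V: module K V by fact
  interpret W: abelian_subgroup W V by (rule submodule_abelian_subgroup) fact+
  have "x \<ominus>\<^bsub>V\<^esub> y \<in> W \<longleftrightarrow> x \<in> W +>\<^bsub>V\<^esub> y" using assms by (simp add: W.a_rcos_module a_minus_def)
  also have "\<dots> \<longleftrightarrow> W +>\<^bsub>V\<^esub> x = W +>\<^bsub>V\<^esub> y"
    using assms W.a_repr_independence' W.a_rcos_self by metis
  finally show ?thesis by simp
qed

text \<open>The sum of two cosets is their pointwise sum, and a scalar multiple of a coset is a union over
  its representatives, in which all terms are the same coset.\<close>

lemma quotient_space_ops: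
  assumes "module K V" "submodule W K V" "x \<in> carrier V"
  shows "y \<in> carrier V \<Longrightarrow>
      (W +>\<^bsub>V\<^esub> x) \<oplus>\<^bsub>quotient_space V W\<^esub> (W +>\<^bsub>V\<^esub> y) = W +>\<^bsub>V\<^esub> (x \<oplus>\<^bsub>V\<^esub> y)"
    and "k \<in> carrier K \<Longrightarrow> k \<odot>\<^bsub>quotient_space V W\<^esub> (W +>\<^bsub>V\<^esub> x) = W +>\<^bsub>V\<^esub> (k \<odot>\<^bsub>V\<^esub> x)"
    and "\<zero>\<^bsub>quotient_space V W\<^esub> = W +>\<^bsub>V\<^esub> \<zero>\<^bsub>V\<^esub>"
proof -
  interpret V: module K V by fact
  interpret W: abelian_subgroup W V by (rule submodule_abelian_subgroup) fact+
  show "y \<in> carrier V \<Longrightarrow>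
      (W +>\<^bsub>V\<^esub> x) \<oplus>\<^bsub>quotient_space V W\<^esub> (W +>\<^bsub>V\<^esub> y) = W +>\<^bsub>V\<^esub> (x \<oplus>\<^bsub>V\<^esub> y)"
    using assms by (simp add: quotient_space_def W.a_rcos_sum)
  show "\<zero>\<^bsub>quotient_space V W\<^esub> = W +>\<^bsub>V\<^esub> \<zero>\<^bsub>V\<^esub>"
    by (simp add: quotient_space_def W.a_subset)
  assume k: "k \<in> carrier K"
  have "W +>\<^bsub>V\<^esub> (k \<odot>\<^bsub>V\<^esub> x') = W +>\<^bsub>V\<^esub> (k \<odot>\<^bsub>V\<^esub> x)" if "x' \<in> W +>\<^bsub>V\<^esub> x" for x'
  proof -
    have x': "x' \<in> carrier V" using that assms W.a_elemrcos_carrier by blast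
    then have "x' \<ominus>\<^bsub>V\<^esub> x \<in> W" using that assms by (simp add: W.a_rcos_module a_minus_def)
    then have "k \<odot>\<^bsub>V\<^esub> (x' \<ominus>\<^bsub>V\<^esub> x) \<in> W" using k by (simp add: submodule.smult_closed[OF assms(2)])
    also have "k \<odot>\<^bsub>V\<^esub> (x' \<ominus>\<^bsub>V\<^esub> x) = k \<odot>\<^bsub>V\<^esub> x' \<ominus>\<^bsub>V\<^esub> k \<odot>\<^bsub>V\<^esub> x"
      using k x' assms by (simp add: a_minus_def V.smult_r_distr V.smult_r_minus)
    finally show ?thesis using k x' assms by (subst coset_eq_iff[OF assms(1,2)]) auto
  qed
  moreover have "x \<in> W +>\<^bsub>V\<^esub> x" using assms W.a_rcos_self by blast
  ultimately show "k \<odot>\<^bsub>quotient_space V W\<^esub> (W +>\<^bsub>V\<^esub> x) = W +>\<^bsub>V\<^esub> (k \<odot>\<^bsub>V\<^esub> x)"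
    unfolding quotient_space_def module.simps by (intro UN_constant_eq ballI)
qed

lemma quotient_space_module:
  assumes "module K V" "submodule W K V"
  shows "module K (quotient_space V W)"
  by (rule module_image[OF assms(1), where p = "\<lambda>v. W +>\<^bsub>V\<^esub> v"])
    (auto simp: carrier_quotient_space quotient_space_ops[OF assms] module.axioms
      quotient_space_ops(3)[OF assms abelian_monoid.zero_closed]
      abelian_group.axioms(1) module.axioms(2)[OF assms(1)])

lemma quotient_map_linear:
  assumes "module K V" "submodule W K V"
  shows "linear_map K V (quotient_space V W) (\<lambda>v. W +>\<^bsub>V\<^esub> v)"
  by (rule linear_mapI) (auto simp: carrier_quotient_space quotient_space_ops[OF assms])

text \<open>A linear map that kills \<open>W\<close> takes a single value on each coset of \<open>W\<close>.\<close>

lemma the_elem_image_coset: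
  assumes "module K V" "submodule W K V" "module K X" "linear_map K V X f"
    and "\<And>w. w \<in> W \<Longrightarrow> f w = \<zero>\<^bsub>X\<^esub>" and "x \<in> carrier V"
  shows "the_elem (f ` (W +>\<^bsub>V\<^esub> x)) = f x" and "y \<in> W +>\<^bsub>V\<^esub> x \<Longrightarrow> f y = f x"
proof -
  interpret V: module K V by fact
  interpret X: module K X by fact
  interpret W: abelian_subgroup W V by (rule submodule_abelian_subgroup) fact+
  have *: "f y = f x" if y: "y \<in> W +>\<^bsub>V\<^esub> x" for y
  proof -
    have "y \<in> carrier V" using y assms(6) W.a_elemrcos_carrier by metis
    then have "y \<ominus>\<^bsub>V\<^esub> x \<in> W" and yx: "y = (y \<ominus>\<^bsub>V\<^esub> x) \<oplus>\<^bsub>V\<^esub> x" and c: "y \<ominus>\<^bsub>V\<^esub> x \<in> carrier V"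
      using y assms(6) by (auto simp: W.a_rcos_module a_minus_def V.M.a_assoc V.M.l_neg)
    then have "f (y \<ominus>\<^bsub>V\<^esub> x) = \<zero>\<^bsub>X\<^esub>" by (intro assms(5))
    moreover have "f y = f (y \<ominus>\<^bsub>V\<^esub> x) \<oplus>\<^bsub>X\<^esub> f x"
      by (subst yx) (rule linear_map_add[OF assms(4) c assms(6)])
    ultimately show ?thesis using linear_map_closed[OF assms(4,6)] by simp
  qed
  then show "y \<in> W +>\<^bsub>V\<^esub> x \<Longrightarrow> f y = f x" .
  have "x \<in> W +>\<^bsub>V\<^esub> x" using assms W.a_rcos_self by blast
  then have "f ` (W +>\<^bsub>V\<^esub> x) = {f x}" using * by blast
  then show "the_elem (f ` (W +>\<^bsub>V\<^esub> x)) = f x" by simp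
qed

section \<open>Free spaces\<close>

lemma free_space_simps:
  "carrier (free_space K S) = {u. range u \<subseteq> carrier K \<and> finite {s. u s \<noteq> \<zero>\<^bsub>K\<^esub>} \<and> {s. u s \<noteq> \<zero>\<^bsub>K\<^esub>} \<subseteq> S}"
  "\<zero>\<^bsub>free_space K S\<^esub> = (\<lambda>s. \<zero>\<^bsub>K\<^esub>)"
  "u \<oplus>\<^bsub>free_space K S\<^esub> v = (\<lambda>s. u s \<oplus>\<^bsub>K\<^esub> v s)"
  "k \<odot>\<^bsub>free_space K S\<^esub> u = (\<lambda>s. k \<otimes>\<^bsub>K\<^esub> u s)"
  by (auto simp: free_space_def)

lemma free_space_carrierD: "u \<in> carrier (free_space K S) \<Longrightarrow> u s \<in> carrier K"
  "u \<in> carrier (free_space K S) \<Longrightarrow> u s \<noteq> \<zero>\<^bsub>K\<^esub> \<Longrightarrow> s \<in> S"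
  "u \<in> carrier (free_space K S) \<Longrightarrow> finite {s. u s \<noteq> \<zero>\<^bsub>K\<^esub>}"
  by (auto simp: free_space_simps)

lemma free_space_carrierI:
  assumes "\<And>s. u s \<in> carrier K" "finite A" "\<And>s. u s \<noteq> \<zero>\<^bsub>K\<^esub> \<Longrightarrow> s \<in> A \<inter> S"
  shows "u \<in> carrier (free_space K S)"
proof -
  have "{s. u s \<noteq> \<zero>\<^bsub>K\<^esub>} \<subseteq> A \<inter> S" using assms(3) by auto
  then show ?thesis using assms(1,2) by (auto simp: free_space_simps intro: finite_subset)
qed

lemma free_space_closed:
  assumes "cring K"
  shows "u \<in> carrier (free_space K S) \<Longrightarrow> v \<in> carrier (free_space K S)
      \<Longrightarrow> (\<lambda>s. u s \<oplus>\<^bsub>K\<^esub> v s) \<in> carrier (free_space K S)"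
    and "u \<in> carrier (free_space K S) \<Longrightarrow> k \<in> carrier K
      \<Longrightarrow> (\<lambda>s. k \<otimes>\<^bsub>K\<^esub> u s) \<in> carrier (free_space K S)"
    and "(\<lambda>s. \<zero>\<^bsub>K\<^esub>) \<in> carrier (free_space K S)"
    and "s \<in> S \<Longrightarrow> basis_vec K s \<in> carrier (free_space K S)"
proof -
  interpret cring K by fact
  note d = free_space_carrierD
  { assume a: "u \<in> carrier (free_space K S)" "v \<in> carrier (free_space K S)"
    have "s \<in> ({s. u s \<noteq> \<zero>\<^bsub>K\<^esub>} \<union> {s. v s \<noteq> \<zero>\<^bsub>K\<^esub>}) \<inter> S" if "u s \<oplus>\<^bsub>K\<^esub> v s \<noteq> \<zero>\<^bsub>K\<^esub>" for s
      using that d(2)[OF a(1), of s] d(2)[OF a(2), of s]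
      by (cases "u s = \<zero>\<^bsub>K\<^esub>"; cases "v s = \<zero>\<^bsub>K\<^esub>") auto
    then show "(\<lambda>s. u s \<oplus>\<^bsub>K\<^esub> v s) \<in> carrier (free_space K S)"
      by (rule free_space_carrierI[rotated 2]) (simp_all add: d[OF a(1)] d[OF a(2)]) }
  { assume a: "u \<in> carrier (free_space K S)" "k \<in> carrier K"
    have "s \<in> {s. u s \<noteq> \<zero>\<^bsub>K\<^esub>} \<inter> S" if "k \<otimes>\<^bsub>K\<^esub> u s \<noteq> \<zero>\<^bsub>K\<^esub>" for s
      using that d(2)[OF a(1), of s] a(2) by (cases "u s = \<zero>\<^bsub>K\<^esub>") auto
    then show "(\<lambda>s. k \<otimes>\<^bsub>K\<^esub> u s) \<in> carrier (free_space K S)"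
      by (rule free_space_carrierI[rotated 2]) (simp_all add: d[OF a(1)] a(2)) }
  show "(\<lambda>s. \<zero>\<^bsub>K\<^esub>) \<in> carrier (free_space K S)"
    by (rule free_space_carrierI[of _ _ "{}"]) auto
  show "s \<in> S \<Longrightarrow> basis_vec K s \<in> carrier (free_space K S)"
    by (rule free_space_carrierI[of _ _ "{s}"]) (auto simp: basis_vec_def split: if_splits)
qed

lemma free_space_module:
  assumes "cring K" shows "module K (free_space K S)"
proof -
  interpret cring K by fact
  note cl = free_space_closed[OF assms] note d = free_space_carrierD
  show ?thesis
  proof (rule moduleI)
    show "abelian_group (free_space K S)"
    proof (rule abelian_groupI)
      fix u assume u: "u \<in> carrier (free_space K S)"
      have "(\<lambda>s. \<ominus>\<^bsub>K\<^esub> \<one>\<^bsub>K\<^esub> \<otimes>\<^bsub>K\<^esub> u s) \<in> carrier (free_space K S)" using u by (intro cl) auto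
      moreover have "(\<lambda>s. \<ominus>\<^bsub>K\<^esub> \<one>\<^bsub>K\<^esub> \<otimes>\<^bsub>K\<^esub> u s) \<oplus>\<^bsub>free_space K S\<^esub> u = \<zero>\<^bsub>free_space K S\<^esub>"
        using d(1)[OF u] by (auto simp: free_space_simps l_neg l_minus)
      ultimately show "\<exists>v\<in>carrier (free_space K S). v \<oplus>\<^bsub>free_space K S\<^esub> u = \<zero>\<^bsub>free_space K S\<^esub>"
        by blast
    qed (auto simp: free_space_simps(2-4) cl d(1) a_ac)
  qed (auto simp: free_space_simps(2-4) cl d(1) l_distr r_distr m_assoc is_cring)
qed

text \<open>The value at a formal sum of the linear map determined by \<open>g\<close> on basis vectors. With
  \<open>g p = f (fst p) (snd p)\<close> the terms of this sum are those inside \<^const>\<open>sweedler\<close>.\<close>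

definition lin_extend :: "('k, 'r) ring_scheme \<Rightarrow> ('k, 'u, 'x) module_scheme \<Rightarrow> ('s \<Rightarrow> 'u) \<Rightarrow> ('s \<Rightarrow> 'k) \<Rightarrow> 'u" where
  "lin_extend K X g u = (\<Oplus>\<^bsub>X\<^esub>p\<in>{p. u p \<noteq> \<zero>\<^bsub>K\<^esub>}. u p \<odot>\<^bsub>X\<^esub> g p)"

text \<open>Enlarging the index set by zero coefficients lets two formal sums be added over a common one.\<close>

lemma lin_extend_superset:
  assumes X: "module K X" and g: "\<And>s. s \<in> S \<Longrightarrow> g s \<in> carrier X"
    and u: "u \<in> carrier (free_space K S)" and A: "finite A" "{p. u p \<noteq> \<zero>\<^bsub>K\<^esub>} \<subseteq> A" "A \<subseteq> S"
  shows "lin_extend K X g u = (\<Oplus>\<^bsub>X\<^esub>p\<in>A. u p \<odot>\<^bsub>X\<^esub> g p)"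
proof -
  interpret X: module K X by fact
  show ?thesis unfolding lin_extend_def
    using A g free_space_carrierD[OF u] X.smult_closed
    by (intro X.add.finprod_mono_neutral_cong_left) (auto simp: Pi_def subset_iff)
qed

lemma lin_extend_linear:
  assumes X: "module K X" and g: "\<And>s. s \<in> S \<Longrightarrow> g s \<in> carrier X"
  shows "linear_map K (free_space K S) X (lin_extend K X g)"
proof -
  interpret X: module K X by fact
  note cl = free_space_closed[OF X.is_cring] note d = free_space_carrierD
  show ?thesis
  proof (rule linear_mapI)
    fix u assume u: "u \<in> carrier (free_space K S)"
    show "lin_extend K X g u \<in> carrier X"
      unfolding lin_extend_def using d[OF u] g by (intro X.finsum_closed) auto
    { fix v assume v: "v \<in> carrier (free_space K S)"
      let ?A = "{p. u p \<noteq> \<zero>\<^bsub>K\<^esub>} \<union> {p. v p \<noteq> \<zero>\<^bsub>K\<^esub>}"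
      have A: "finite ?A" "?A \<subseteq> S" using d[OF u] d[OF v] by auto
      have "lin_extend K X g (\<lambda>s. u s \<oplus>\<^bsub>K\<^esub> v s) = (\<Oplus>\<^bsub>X\<^esub>p\<in>?A. (u p \<oplus>\<^bsub>K\<^esub> v p) \<odot>\<^bsub>X\<^esub> g p)"
        using A by (intro lin_extend_superset[OF X g cl(1)[OF u v]]) auto
      also have "\<dots> = (\<Oplus>\<^bsub>X\<^esub>p\<in>?A. u p \<odot>\<^bsub>X\<^esub> g p \<oplus>\<^bsub>X\<^esub> v p \<odot>\<^bsub>X\<^esub> g p)"
        using A g d(1)[OF u] d(1)[OF v] by (intro X.finsum_cong') (auto simp: X.smult_l_distr Pi_def subset_iff)
      also have "\<dots> = (\<Oplus>\<^bsub>X\<^esub>p\<in>?A. u p \<odot>\<^bsub>X\<^esub> g p) \<oplus>\<^bsub>X\<^esub> (\<Oplus>\<^bsub>X\<^esub>p\<in>?A. v p \<odot>\<^bsub>X\<^esub> g p)"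
        using A g d(1)[OF u] d(1)[OF v] by (intro X.finsum_addf) auto
      also have "(\<Oplus>\<^bsub>X\<^esub>p\<in>?A. u p \<odot>\<^bsub>X\<^esub> g p) = lin_extend K X g u"
        using A by (intro lin_extend_superset[OF X g u, symmetric]) auto
      also have "(\<Oplus>\<^bsub>X\<^esub>p\<in>?A. v p \<odot>\<^bsub>X\<^esub> g p) = lin_extend K X g v"
        using A by (intro lin_extend_superset[OF X g v, symmetric]) auto
      finally show "lin_extend K X g (u \<oplus>\<^bsub>free_space K S\<^esub> v) = lin_extend K X g u \<oplus>\<^bsub>X\<^esub> lin_extend K X g v"
        by (simp add: free_space_simps) }
    { fix k assume k: "k \<in> carrier K"
      let ?A = "{p. u p \<noteq> \<zero>\<^bsub>K\<^esub>}"
      have A: "finite ?A" "?A \<subseteq> S" using d[OF u] by auto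
      have "lin_extend K X g (\<lambda>s. k \<otimes>\<^bsub>K\<^esub> u s) = (\<Oplus>\<^bsub>X\<^esub>p\<in>?A. (k \<otimes>\<^bsub>K\<^esub> u p) \<odot>\<^bsub>X\<^esub> g p)"
        using A k by (intro lin_extend_superset[OF X g cl(2)[OF u k]]) auto
      also have "\<dots> = (\<Oplus>\<^bsub>X\<^esub>p\<in>?A. k \<odot>\<^bsub>X\<^esub> (u p \<odot>\<^bsub>X\<^esub> g p))"
        using A g d(1)[OF u] k by (intro X.finsum_cong') (auto simp: X.smult_assoc1 Pi_def subset_iff)
      also have "\<dots> = k \<odot>\<^bsub>X\<^esub> lin_extend K X g u" unfolding lin_extend_def
        using A g d(1)[OF u] k by (intro X.finsum_smult_ldistr[symmetric]) auto
      finally show "lin_extend K X g (k \<odot>\<^bsub>free_space K S\<^esub> u) = k \<odot>\<^bsub>X\<^esub> lin_extend K X g u"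
        by (simp add: free_space_simps) }
  qed
qed

lemma lin_extend_basis_vec:
  assumes X: "module K X" and g: "\<And>s. s \<in> S \<Longrightarrow> g s \<in> carrier X" and s: "s \<in> S"
  shows "lin_extend K X g (basis_vec K s) = g s"
proof -
  interpret X: module K X by fact
  have "lin_extend K X g (basis_vec K s) = (\<Oplus>\<^bsub>X\<^esub>p\<in>{s}. basis_vec K s p \<odot>\<^bsub>X\<^esub> g p)"
    by (rule lin_extend_superset[OF X g free_space_closed(4)[OF X.is_cring s]])
      (use s in \<open>auto simp: basis_vec_def\<close>)
  also have "\<dots> = g s" using g[OF s] by (subst X.finsum_insert) (auto simp: basis_vec_def)
  finally show ?thesis .
qed

lemma free_space_induct [consumes 2, case_names zero add]:
  assumes K: "cring K" and u: "u \<in> carrier (free_space K S)"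
    and zero: "P (\<lambda>s. \<zero>\<^bsub>K\<^esub>)"
    and add: "\<And>u k s. u \<in> carrier (free_space K S) \<Longrightarrow> P u \<Longrightarrow> k \<in> carrier K \<Longrightarrow> s \<in> S \<Longrightarrow>
       P (u \<oplus>\<^bsub>free_space K S\<^esub> (k \<odot>\<^bsub>free_space K S\<^esub> basis_vec K s))"
  shows "P u"
proof -
  interpret cring K by fact
  note d = free_space_carrierD
  have "finite A \<Longrightarrow> u \<in> carrier (free_space K S) \<Longrightarrow> {s. u s \<noteq> \<zero>\<^bsub>K\<^esub>} = A \<Longrightarrow> P u" for A u
  proof (induction A arbitrary: u rule: finite_induct)
    case empty
    then have "u = (\<lambda>s. \<zero>\<^bsub>K\<^esub>)" by auto
    then show ?case using zero by simp
  next
    case (insert s A)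
    let ?v = "u(s := \<zero>\<^bsub>K\<^esub>)"
    have us: "u s \<noteq> \<zero>\<^bsub>K\<^esub>" using insert.prems by blast
    have sS: "s \<in> S" using d(2)[OF insert.prems(1) us] .
    have supp: "{t. ?v t \<noteq> \<zero>\<^bsub>K\<^esub>} = A"
    proof (intro equalityI subsetI)
      fix t assume "t \<in> {t. ?v t \<noteq> \<zero>\<^bsub>K\<^esub>}"
      then have "t \<noteq> s" "u t \<noteq> \<zero>\<^bsub>K\<^esub>" by (auto split: if_splits)
      then show "t \<in> A" using insert.prems(2) by blast
    next
      fix t assume "t \<in> A"
      then have "u t \<noteq> \<zero>\<^bsub>K\<^esub>" "t \<noteq> s" using insert.prems(2) insert.hyps by blast+
      then show "t \<in> {t. ?v t \<noteq> \<zero>\<^bsub>K\<^esub>}" by auto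
    qed
    have "A \<subseteq> S" using d(2)[OF insert.prems(1)] insert.prems(2) by blast
    moreover have "range ?v \<subseteq> carrier K" using d(1)[OF insert.prems(1)] by auto
    ultimately have v: "?v \<in> carrier (free_space K S)"
      using supp insert.hyps unfolding free_space_simps by simp
    have "P ?v" using insert.IH[OF v supp] .
    from add[OF v this d(1)[OF insert.prems(1)] sS, of s]
    have "P (\<lambda>t. ?v t \<oplus>\<^bsub>K\<^esub> u s \<otimes>\<^bsub>K\<^esub> basis_vec K s t)" by (simp add: free_space_simps)
    also have "(\<lambda>t. ?v t \<oplus>\<^bsub>K\<^esub> u s \<otimes>\<^bsub>K\<^esub> basis_vec K s t) = u"
      using d(1)[OF insert.prems(1)] by (auto simp: basis_vec_def)
    finally show ?case .
  qed
  then show ?thesis using u d(3)[OF u] by blast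
qed

section \<open>Tensor products\<close>

lemma bilinear_mapI:
  assumes "\<And>v. v \<in> carrier V \<Longrightarrow> linear_map K W U (f v)"
    and "\<And>w. w \<in> carrier W \<Longrightarrow> linear_map K V U (\<lambda>v. f v w)"
  shows "bilinear_map K V W U f"
  using assms unfolding bilinear_map_def by blast

lemma bilinear_mapD:
  "bilinear_map K V W U f \<Longrightarrow> v \<in> carrier V \<Longrightarrow> linear_map K W U (f v)"
  "bilinear_map K V W U f \<Longrightarrow> w \<in> carrier W \<Longrightarrow> linear_map K V U (\<lambda>v. f v w)"
  unfolding bilinear_map_def by auto

lemma bilinear_map_closed:
  "bilinear_map K V W U f \<Longrightarrow> v \<in> carrier V \<Longrightarrow> w \<in> carrier W \<Longrightarrow> f v w \<in> carrier U"
  using bilinear_mapD(1) linear_map_closed by metis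

context
  fixes K :: "('k, 'r) ring_scheme" and V :: "('k, 'v, 'x) module_scheme"
    and W :: "('k, 'w, 'y) module_scheme"
  assumes V: "module K V" and W: "module K W"
begin

interpretation V: module K V by (rule V)
interpretation W: module K W by (rule W)

abbreviation (input) "Free \<equiv> free_space K (carrier V \<times> carrier W)"
abbreviation (input) "Rel \<equiv> bilinearity_span K V W"

interpretation Free: module K Free by (rule free_space_module[OF V.is_cring])

lemma basis_vec_pair_closed:
  "v \<in> carrier V \<Longrightarrow> w \<in> carrier W \<Longrightarrow> basis_vec K (v, w) \<in> carrier Free"
  by (rule free_space_closed(4)[OF V.is_cring]) simp

lemma bilinearity_span_submodule: "submodule Rel K Free"
  unfolding bilinearity_span_def Let_def
  by (rule lin_span_submodule[OF Free.module_axioms]) (auto simp: basis_vec_pair_closed)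

lemma bilinearity_relations:
  assumes "v \<in> carrier V" "w \<in> carrier W"
  shows "v' \<in> carrier V \<Longrightarrow> basis_vec K (v \<oplus>\<^bsub>V\<^esub> v', w) \<ominus>\<^bsub>Free\<^esub> (basis_vec K (v, w) \<oplus>\<^bsub>Free\<^esub> basis_vec K (v', w)) \<in> Rel"
    and "w' \<in> carrier W \<Longrightarrow> basis_vec K (v, w \<oplus>\<^bsub>W\<^esub> w') \<ominus>\<^bsub>Free\<^esub> (basis_vec K (v, w) \<oplus>\<^bsub>Free\<^esub> basis_vec K (v, w')) \<in> Rel"
    and "k \<in> carrier K \<Longrightarrow> basis_vec K (k \<odot>\<^bsub>V\<^esub> v, w) \<ominus>\<^bsub>Free\<^esub> (k \<odot>\<^bsub>Free\<^esub> basis_vec K (v, w)) \<in> Rel"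
    and "k \<in> carrier K \<Longrightarrow> basis_vec K (v, k \<odot>\<^bsub>W\<^esub> w) \<ominus>\<^bsub>Free\<^esub> (k \<odot>\<^bsub>Free\<^esub> basis_vec K (v, w)) \<in> Rel"
  unfolding bilinearity_span_def Let_def using assms
  by (intro subsetD[OF lin_span_submodule(2)[OF Free.module_axioms]];
      blast intro: basis_vec_pair_closed Free.minus_closed Free.a_closed Free.smult_closed)+

text \<open>This is why \<^const>\<open>sweedler\<close> may be computed from any representative of a tensor.\<close>

lemma lin_extend_vanishes_on_bilinearity_span:
  assumes X: "module K X" and f: "bilinear_map K V W X f" and r: "r \<in> Rel"
  shows "lin_extend K X (\<lambda>p. f (fst p) (snd p)) r = \<zero>\<^bsub>X\<^esub>"
proof -
  interpret X: module K X by (rule X)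
  let ?E = "lin_extend K X (\<lambda>p. f (fst p) (snd p))"
  note cl = bilinear_map_closed[OF f]
  have E: "linear_map K Free X ?E" using cl by (intro lin_extend_linear X) auto
  note Em = linear_map_minus[OF Free.module_axioms X E] linear_map_add[OF E] linear_map_smult[OF E]
  have Eb: "?E (basis_vec K (v, w)) = f v w" if "v \<in> carrier V" "w \<in> carrier W" for v w
    using lin_extend_basis_vec[OF X, of "carrier V \<times> carrier W" "\<lambda>p. f (fst p) (snd p)" "(v, w)"]
      that cl by auto
  have diff: "x \<ominus>\<^bsub>X\<^esub> x = \<zero>\<^bsub>X\<^esub>" if "x \<in> carrier X" for x
    using that by (simp add: a_minus_def X.M.r_neg)
  note fl = bilinear_mapD[OF f]
  note b = basis_vec_pair_closed
  show ?thesis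
    apply (rule linear_map_vanishes_on_span[OF Free.module_axioms X E _ _ r[unfolded bilinearity_span_def Let_def]])
     apply (auto simp: b)[1]
    apply (auto simp: Em Eb b cl linear_map_add[OF fl(1)] linear_map_smult[OF fl(1)]
        linear_map_add[OF fl(2)] linear_map_smult[OF fl(2)] diff)
    done
qed

lemma tensor_space_module: "module K (tensor_space K V W)"
  unfolding tensor_space_def by (rule quotient_space_module[OF Free.module_axioms bilinearity_span_submodule])

lemma carrier_tensor_space: "carrier (tensor_space K V W) = (\<lambda>u. Rel +>\<^bsub>Free\<^esub> u) ` carrier Free"
  unfolding tensor_space_def by (rule carrier_quotient_space)

lemma tens_bilinear_space: "bilinear_map K V W (tensor_space K V W) (tens K V W)"
proof -
  note q = quotient_space_ops[OF Free.module_axioms bilinearity_span_submodule]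
  note c = coset_eq_iff[OF Free.module_axioms bilinearity_span_submodule, THEN iffD2]
  note b = basis_vec_pair_closed
  show ?thesis
    by (intro bilinear_mapI linear_mapI;
        (simp add: tensor_space_def tens_def q b carrier_quotient_space; fail)?;
        simp add: tensor_space_def tens_def q b; rule c)
      (auto simp: b intro: bilinearity_relations)
qed

lemma sweedler_coset:
  assumes X: "module K X" and f: "bilinear_map K V W X f" and u: "u \<in> carrier Free"
  shows "sweedler K X (Rel +>\<^bsub>Free\<^esub> u) f = lin_extend K X (\<lambda>p. f (fst p) (snd p)) u"
    and "u' \<in> Rel +>\<^bsub>Free\<^esub> u \<Longrightarrow>
      lin_extend K X (\<lambda>p. f (fst p) (snd p)) u' = lin_extend K X (\<lambda>p. f (fst p) (snd p)) u"
proof -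
  have E: "linear_map K Free X (lin_extend K X (\<lambda>p. f (fst p) (snd p)))"
    using bilinear_map_closed[OF f] by (intro lin_extend_linear X) auto
  note e = the_elem_image_coset[OF Free.module_axioms bilinearity_span_submodule X E
      lin_extend_vanishes_on_bilinearity_span[OF X f] u]
  show "sweedler K X (Rel +>\<^bsub>Free\<^esub> u) f = lin_extend K X (\<lambda>p. f (fst p) (snd p)) u"
    using e(1) unfolding sweedler_def lin_extend_def by simp
  show "u' \<in> Rel +>\<^bsub>Free\<^esub> u \<Longrightarrow>
      lin_extend K X (\<lambda>p. f (fst p) (snd p)) u' = lin_extend K X (\<lambda>p. f (fst p) (snd p)) u"
    by (rule e(2))
qed

lemma sweedler_linear_space:
  assumes X: "module K X" and f: "bilinear_map K V W X f"
  shows "linear_map K (tensor_space K V W) X (\<lambda>t. sweedler K X t f)"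
proof -
  have E: "linear_map K Free X (lin_extend K X (\<lambda>p. f (fst p) (snd p)))"
    using bilinear_map_closed[OF f] by (intro lin_extend_linear X) auto
  note q = quotient_space_ops[OF Free.module_axioms bilinearity_span_submodule, folded tensor_space_def]
  show ?thesis
    by (rule linear_mapI) (auto simp: carrier_tensor_space q sweedler_coset[OF X f]
        linear_map_closed[OF E] linear_map_add[OF E] linear_map_smult[OF E])
qed

lemma sweedler_tens_space:
  assumes X: "module K X" and f: "bilinear_map K V W X f" and "v \<in> carrier V" "w \<in> carrier W"
  shows "sweedler K X (tens K V W v w) f = f v w"
  using lin_extend_basis_vec[OF X, of "carrier V \<times> carrier W" "\<lambda>p. f (fst p) (snd p)" "(v, w)"]
    bilinear_map_closed[OF f] assms(3,4)
  by (auto simp: tens_def sweedler_coset[OF X f] basis_vec_pair_closed)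

text \<open>Every tensor is a sum of pure tensors: the scalars in a formal sum are absorbed into the first
  factors, and zero is a pure tensor.\<close>

lemma tensor_space_induct:
  assumes t: "t \<in> carrier (tensor_space K V W)"
    and tens: "\<And>v w. v \<in> carrier V \<Longrightarrow> w \<in> carrier W \<Longrightarrow> P (tens K V W v w)"
    and add: "\<And>s t. s \<in> carrier (tensor_space K V W) \<Longrightarrow> P s \<Longrightarrow> t \<in> carrier (tensor_space K V W) \<Longrightarrow> P t
       \<Longrightarrow> P (s \<oplus>\<^bsub>tensor_space K V W\<^esub> t)"
  shows "P t"
proof -
  note q = quotient_space_ops[OF Free.module_axioms bilinearity_span_submodule, folded tensor_space_def]
  note lt = bilinear_mapD[OF tens_bilinear_space]
  interpret T: module K "tensor_space K V W" by (rule tensor_space_module)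
  obtain u where u: "u \<in> carrier Free" "t = Rel +>\<^bsub>Free\<^esub> u" using t unfolding carrier_tensor_space by auto
  have "P (Rel +>\<^bsub>Free\<^esub> u)" using V.is_cring u(1)
  proof (induction rule: free_space_induct)
    case zero
    have "Rel +>\<^bsub>Free\<^esub> (\<lambda>s. \<zero>\<^bsub>K\<^esub>) = \<zero>\<^bsub>tensor_space K V W\<^esub>"
      using q(3)[OF Free.zero_closed] by (simp add: free_space_simps(2))
    also have "\<dots> = tens K V W \<zero>\<^bsub>V\<^esub> \<zero>\<^bsub>W\<^esub>"
      by (rule linear_map_zero[OF W tensor_space_module lt(1), symmetric]) simp
    finally show ?case using tens by simp
  next
    case (add u k s)
    obtain v w where s: "s = (v, w)" "v \<in> carrier V" "w \<in> carrier W" using add by auto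
    have cb: "basis_vec K s \<in> carrier Free" using s basis_vec_pair_closed by auto
    have "Rel +>\<^bsub>Free\<^esub> (u \<oplus>\<^bsub>Free\<^esub> (k \<odot>\<^bsub>Free\<^esub> basis_vec K s))
        = (Rel +>\<^bsub>Free\<^esub> u) \<oplus>\<^bsub>tensor_space K V W\<^esub> (k \<odot>\<^bsub>tensor_space K V W\<^esub> tens K V W v w)"
      using add cb s by (simp add: q tens_def)
    also have "k \<odot>\<^bsub>tensor_space K V W\<^esub> tens K V W v w = tens K V W (k \<odot>\<^bsub>V\<^esub> v) w"
      using s add by (intro linear_map_smult[OF lt(2), symmetric])
    finally show ?case
      using add s tens linear_map_closed[OF lt(2)] by (auto simp: carrier_tensor_space intro!: assms(3))
  qed
  then show ?thesis using u by simp
qed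

end

text \<open>\<open>sw K V W X t f\<close> is the Sweedler sum of \<open>f\<close> computed from one chosen representative of the
  tensor \<open>t\<close>. Unlike the value taken on the whole coset, it respects addition, linear maps and
  interchange of sums for every function \<open>f\<close>, so that multilinearity of \<open>f\<close> only matters when the
  tensor \<open>t\<close> itself is rewritten. The guard makes the sum depend on \<open>f\<close> only inside the carriers.\<close>

definition sw ::
  "('k, 'r) ring_scheme \<Rightarrow> ('k, 'v, 'x) module_scheme \<Rightarrow> ('k, 'w, 'y) module_scheme
    \<Rightarrow> ('k, 'u, 'z) module_scheme \<Rightarrow> ('v \<times> 'w \<Rightarrow> 'k) set \<Rightarrow> ('v \<Rightarrow> 'w \<Rightarrow> 'u) \<Rightarrow> 'u" where
  "sw K V W X t f = lin_extend K X
     (\<lambda>p. if p \<in> carrier V \<times> carrier W then f (fst p) (snd p) else \<zero>\<^bsub>X\<^esub>) (SOME u. u \<in> t)"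

lemma sw_cong [cong]:
  assumes "X = X'" "t = t'" "\<And>v w. v \<in> carrier V \<Longrightarrow> w \<in> carrier W \<Longrightarrow> f v w = g v w"
  shows "sw K V W X t f = sw K V W X' t' g"
proof -
  have "(\<lambda>p. if p \<in> carrier V \<times> carrier W then f (fst p) (snd p) else \<zero>\<^bsub>X\<^esub>) =
      (\<lambda>p. if p \<in> carrier V \<times> carrier W then g (fst p) (snd p) else \<zero>\<^bsub>X\<^esub>)"
    using assms(3) by auto
  then show ?thesis unfolding sw_def assms(1,2) by simp
qed

lemma tensor_sel [simp]:
  "carrier (tensor K V W) = carrier (tensor_space K V W)"
  "\<zero>\<^bsub>tensor K V W\<^esub> = \<zero>\<^bsub>tensor_space K V W\<^esub>"
  "x \<oplus>\<^bsub>tensor K V W\<^esub> y = x \<oplus>\<^bsub>tensor_space K V W\<^esub> y"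
  "k \<odot>\<^bsub>tensor K V W\<^esub> x = k \<odot>\<^bsub>tensor_space K V W\<^esub> x"
  by (simp_all add: tensor_def module.extend_def hom_space.fields_def)

lemma linear_map_from_tensor:
  "linear_map K (tensor K V W) U f \<longleftrightarrow> linear_map K (tensor_space K V W) U f"
  unfolding linear_map_def tensor_sel by (rule refl)

lemma linear_map_to_tensor:
  "linear_map K U (tensor K V W) f \<longleftrightarrow> linear_map K U (tensor_space K V W) f"
  unfolding linear_map_def tensor_sel by (rule refl)

text \<open>The vector-space part of a product of Hom-spaces is \<^const>\<open>tensor_space\<close>; everything below
  is phrased with \<^const>\<open>tensor\<close>, so that iterated products stay within Hom-spaces.\<close>

declare tensor_sel [simp del]

lemma tensor_module: "module K V \<Longrightarrow> module K W \<Longrightarrow> module K (tensor K V W)"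
  by (rule module_image[OF tensor_space_module[of K V W], where p = id])
    (auto simp: tensor_sel)

lemma tens_bilinear: "module K V \<Longrightarrow> module K W \<Longrightarrow> bilinear_map K V W (tensor K V W) (tens K V W)"
  using tens_bilinear_space[of K V W] unfolding bilinear_map_def linear_map_to_tensor .

lemma tens_closed:
  "module K V \<Longrightarrow> module K W \<Longrightarrow> v \<in> carrier V \<Longrightarrow> w \<in> carrier W \<Longrightarrow> tens K V W v w \<in> carrier (tensor K V W)"
  by (rule bilinear_map_closed[OF tens_bilinear])

lemma tensor_induct [consumes 3, case_names tens add]:
  assumes "module K V" "module K W" and "t \<in> carrier (tensor K V W)"
    and "\<And>v w. v \<in> carrier V \<Longrightarrow> w \<in> carrier W \<Longrightarrow> P (tens K V W v w)"
    and "\<And>s t. s \<in> carrier (tensor K V W) \<Longrightarrow> P s \<Longrightarrow> t \<in> carrier (tensor K V W) \<Longrightarrow> P t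
       \<Longrightarrow> P (s \<oplus>\<^bsub>tensor K V W\<^esub> t)"
  shows "P t"
  using tensor_space_induct[of K V W t P] assms by (simp add: tensor_sel)

lemma tensor_ext:
  assumes "module K V" "module K W" "linear_map K (tensor K V W) X f" "linear_map K (tensor K V W) X g"
    and "\<And>v w. v \<in> carrier V \<Longrightarrow> w \<in> carrier W \<Longrightarrow> f (tens K V W v w) = g (tens K V W v w)"
    and "t \<in> carrier (tensor K V W)"
  shows "f t = g t"
  using assms(1,2,6)
proof (induction rule: tensor_induct)
  case (tens v w) then show ?case by (rule assms(5))
next
  case (add s t) then show ?case
    using linear_map_add[OF assms(3)] linear_map_add[OF assms(4)] by simp
qed

lemma tensor_representative:
  assumes "module K V" "module K W" "t \<in> carrier (tensor K V W)"
  shows "(SOME u. u \<in> t) \<in> carrier (free_space K (carrier V \<times> carrier W))"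
    and "t = bilinearity_span K V W +>\<^bsub>free_space K (carrier V \<times> carrier W)\<^esub> (SOME u. u \<in> t)"
proof -
  interpret V: module K V by fact
  let ?L = "free_space K (carrier V \<times> carrier W)" and ?R = "bilinearity_span K V W"
  have L: "module K ?L" by (rule free_space_module[OF V.is_cring])
  have R: "submodule ?R K ?L" by (rule bilinearity_span_submodule) fact+
  interpret R: abelian_subgroup ?R ?L by (rule submodule_abelian_subgroup[OF L R])
  obtain u where u: "u \<in> carrier ?L" "t = ?R +>\<^bsub>?L\<^esub> u"
    using assms by (auto simp: tensor_sel carrier_tensor_space)
  have "u \<in> t" using u R.a_rcos_self by blast
  then have s: "(SOME u. u \<in> t) \<in> t" by (rule someI[of "\<lambda>u. u \<in> t"])
  then show "(SOME u. u \<in> t) \<in> carrier ?L" using u R.a_elemrcos_carrier by blast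
  show "t = ?R +>\<^bsub>?L\<^esub> (SOME u. u \<in> t)" using s u R.a_repr_independence' by metis
qed

lemma sweedler_eq_sw:
  assumes V: "module K V" and W: "module K W" and X: "module K X"
    and t: "t \<in> carrier (tensor K V W)" and f: "bilinear_map K V W X f"
  shows "sweedler K X t f = sw K V W X t f"
proof -
  let ?u = "SOME u. u \<in> t"
  have u: "?u \<in> carrier (free_space K (carrier V \<times> carrier W))"
    by (rule tensor_representative) fact+
  have "sweedler K X t f = lin_extend K X (\<lambda>p. f (fst p) (snd p)) ?u"
    by (subst tensor_representative(2)[OF V W t]) (rule sweedler_coset[OF V W X f u])
  also have "\<dots> = sw K V W X t f"
  proof -
    interpret X: module K X by fact
    have c: "f (fst p) (snd p) \<in> carrier X" if "p \<in> carrier V \<times> carrier W" for p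
      using that bilinear_map_closed[OF f] by auto
    note d = free_space_carrierD[OF u]
    have "{p. ?u p \<noteq> \<zero>\<^bsub>K\<^esub>} \<subseteq> carrier V \<times> carrier W" using d(2) by blast
    then show ?thesis unfolding sw_def lin_extend_def using c d(1)
      by (intro X.finsum_cong') (auto simp: subset_iff)
  qed
  finally show ?thesis .
qed

text \<open>The sum defining \<^const>\<open>sw\<close>, with its finite index set and scalars exposed.\<close>

lemma sw_as_finsum:
  fixes t :: "('v \<times> 'w \<Rightarrow> 'k) set"
  defines "c \<equiv> (SOME u. u \<in> t)"
  assumes V: "module K V" and W: "module K W" and t: "t \<in> carrier (tensor K V W)"
  shows "finite {p. c p \<noteq> \<zero>\<^bsub>K\<^esub>}" and "c p \<in> carrier K"
    and "c p \<noteq> \<zero>\<^bsub>K\<^esub> \<Longrightarrow> p \<in> carrier V \<times> carrier W"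
    and "module K X \<Longrightarrow>
      (\<And>v w. v \<in> carrier V \<Longrightarrow> w \<in> carrier W \<Longrightarrow> f v w \<in> carrier X) \<Longrightarrow>
      sw K V W X t f = (\<Oplus>\<^bsub>X\<^esub>p\<in>{p. c p \<noteq> \<zero>\<^bsub>K\<^esub>}. c p \<odot>\<^bsub>X\<^esub> f (fst p) (snd p))"
proof -
  note d = free_space_carrierD[OF tensor_representative(1)[OF V W t], folded c_def]
  show "finite {p. c p \<noteq> \<zero>\<^bsub>K\<^esub>}" "c p \<in> carrier K" by (rule d)+
  show "p \<in> carrier V \<times> carrier W" if "c p \<noteq> \<zero>\<^bsub>K\<^esub>" for p using that by (rule d(2))
  assume X: "module K X" and f: "\<And>v w. v \<in> carrier V \<Longrightarrow> w \<in> carrier W \<Longrightarrow> f v w \<in> carrier X"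
  interpret X: module K X by (rule X)
  have "{p. c p \<noteq> \<zero>\<^bsub>K\<^esub>} \<subseteq> carrier V \<times> carrier W" using d(2) by blast
  then show "sw K V W X t f = (\<Oplus>\<^bsub>X\<^esub>p\<in>{p. c p \<noteq> \<zero>\<^bsub>K\<^esub>}. c p \<odot>\<^bsub>X\<^esub> f (fst p) (snd p))"
    unfolding sw_def lin_extend_def c_def[symmetric] using f d(1)
    by (intro X.finsum_cong') (auto simp: subset_iff)
qed

section \<open>Calculus of Sweedler sums\<close>

lemma sw_closed:
  assumes "module K V" "module K W" "module K X" "t \<in> carrier (tensor K V W)"
    and f: "\<And>v w. v \<in> carrier V \<Longrightarrow> w \<in> carrier W \<Longrightarrow> f v w \<in> carrier X"
  shows "sw K V W X t f \<in> carrier X"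
proof -
  interpret X: module K X by fact
  note c = sw_as_finsum[OF assms(1,2,4)]
  show ?thesis
    by (subst c(4)[OF assms(3)]) (use c(2,3) f in \<open>auto intro!: X.finsum_closed\<close>)
qed

lemma linear_map_sw:
  assumes "module K V" "module K W" "module K X" "module K Y" "linear_map K X Y g"
    and "t \<in> carrier (tensor K V W)"
    and f: "\<And>v w. v \<in> carrier V \<Longrightarrow> w \<in> carrier W \<Longrightarrow> f v w \<in> carrier X"
  shows "g (sw K V W X t f) = sw K V W Y t (\<lambda>v w. g (f v w))"
proof -
  interpret X: module K X by fact
  interpret Y: module K Y by fact
  note cl = linear_map_closed[OF assms(5)]
  define c A where "c = (SOME u. u \<in> t)" and "A = {p. c p \<noteq> \<zero>\<^bsub>K\<^esub>}"
  note fs = sw_as_finsum[OF assms(1,2,6), folded c_def, folded A_def]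
  have A: "finite A" "A \<subseteq> carrier V \<times> carrier W" "\<And>p. p \<in> A \<Longrightarrow> c p \<in> carrier K"
    "sw K V W X t f = (\<Oplus>\<^bsub>X\<^esub>p\<in>A. c p \<odot>\<^bsub>X\<^esub> f (fst p) (snd p))"
    "sw K V W Y t (\<lambda>v w. g (f v w)) = (\<Oplus>\<^bsub>Y\<^esub>p\<in>A. c p \<odot>\<^bsub>Y\<^esub> g (f (fst p) (snd p)))"
    using fs(1-3) fs(4)[where f = f, OF assms(3) f] fs(4)[OF assms(4), of "\<lambda>v w. g (f v w)"] f cl
    unfolding A_def by auto
  have "g (sw K V W X t f) = (\<Oplus>\<^bsub>Y\<^esub>p\<in>A. g (c p \<odot>\<^bsub>X\<^esub> f (fst p) (snd p)))"
    unfolding A(4) by (rule linear_map_finsum[OF assms(3,4,5)]) (use A f in \<open>auto simp: subset_iff\<close>)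
  also have "\<dots> = (\<Oplus>\<^bsub>Y\<^esub>p\<in>A. c p \<odot>\<^bsub>Y\<^esub> g (f (fst p) (snd p)))"
    using A f cl by (intro Y.finsum_cong') (auto simp: subset_iff linear_map_smult[OF assms(5)])
  finally show ?thesis using A by simp
qed

lemma sw_add:
  assumes "module K V" "module K W" "module K X" "t \<in> carrier (tensor K V W)"
    and f: "\<And>v w. v \<in> carrier V \<Longrightarrow> w \<in> carrier W \<Longrightarrow> f v w \<in> carrier X"
    and g: "\<And>v w. v \<in> carrier V \<Longrightarrow> w \<in> carrier W \<Longrightarrow> g v w \<in> carrier X"
  shows "sw K V W X t (\<lambda>v w. f v w \<oplus>\<^bsub>X\<^esub> g v w) = sw K V W X t f \<oplus>\<^bsub>X\<^esub> sw K V W X t g"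
proof -
  interpret X: module K X by fact
  define c A where "c = (SOME u. u \<in> t)" and "A = {p. c p \<noteq> \<zero>\<^bsub>K\<^esub>}"
  note fs = sw_as_finsum[OF assms(1,2,4), folded c_def, folded A_def]
  have A: "finite A" "A \<subseteq> carrier V \<times> carrier W" "\<And>p. p \<in> A \<Longrightarrow> c p \<in> carrier K"
    using fs(1-3) unfolding A_def by auto
  note s = fs(4)[OF assms(3)]
  have "sw K V W X t (\<lambda>v w. f v w \<oplus>\<^bsub>X\<^esub> g v w)
      = (\<Oplus>\<^bsub>X\<^esub>p\<in>A. c p \<odot>\<^bsub>X\<^esub> (f (fst p) (snd p) \<oplus>\<^bsub>X\<^esub> g (fst p) (snd p)))"
    by (rule s) (use f g in auto)
  also have "\<dots> = (\<Oplus>\<^bsub>X\<^esub>p\<in>A. c p \<odot>\<^bsub>X\<^esub> f (fst p) (snd p) \<oplus>\<^bsub>X\<^esub> c p \<odot>\<^bsub>X\<^esub> g (fst p) (snd p))"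
    using A f g by (intro X.finsum_cong') (auto simp: subset_iff X.smult_r_distr)
  also have "\<dots> = sw K V W X t f \<oplus>\<^bsub>X\<^esub> sw K V W X t g"
    by (subst s, (rule f; assumption), subst s, (rule g; assumption), intro X.finsum_addf)
      (use A f g in \<open>auto simp: subset_iff\<close>)
  finally show ?thesis .
qed

lemma smult_linear: "module K X \<Longrightarrow> k \<in> carrier K \<Longrightarrow> linear_map K X X (\<lambda>x. k \<odot>\<^bsub>X\<^esub> x)"
proof -
  assume "module K X" and k: "k \<in> carrier K"
  then interpret X: module K X by simp
  show ?thesis using k by (intro linear_mapI)
      (auto simp: X.smult_r_distr X.smult_assoc1[symmetric] X.R.m_comm)
qed

lemma linear_map_sw_fun:
  assumes "module K V" "module K W" "module K U" "module K X" "t \<in> carrier (tensor K V W)"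
    and f: "\<And>v w. v \<in> carrier V \<Longrightarrow> w \<in> carrier W \<Longrightarrow> linear_map K U X (\<lambda>x. f x v w)"
  shows "linear_map K U X (\<lambda>x. sw K V W X t (f x))"
proof (rule linear_mapI)
  interpret U: module K U by fact
  note cl = linear_map_closed[OF f]
  fix x assume x: "x \<in> carrier U"
  show "sw K V W X t (f x) \<in> carrier X" using assms x cl by (intro sw_closed) auto
  { fix y assume y: "y \<in> carrier U"
    have "sw K V W X t (f (x \<oplus>\<^bsub>U\<^esub> y)) = sw K V W X t (\<lambda>v w. f x v w \<oplus>\<^bsub>X\<^esub> f y v w)"
      by (rule sw_cong) (simp_all add: linear_map_add[OF f] x y)
    also have "\<dots> = sw K V W X t (f x) \<oplus>\<^bsub>X\<^esub> sw K V W X t (f y)"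
      by (rule sw_add) (use assms x y cl in auto)
    finally show "sw K V W X t (f (x \<oplus>\<^bsub>U\<^esub> y)) = sw K V W X t (f x) \<oplus>\<^bsub>X\<^esub> sw K V W X t (f y)" . }
  { fix k assume k: "k \<in> carrier K"
    have "sw K V W X t (f (k \<odot>\<^bsub>U\<^esub> x)) = sw K V W X t (\<lambda>v w. k \<odot>\<^bsub>X\<^esub> f x v w)"
      by (rule sw_cong) (simp_all add: linear_map_smult[OF f] x k)
    also have "\<dots> = k \<odot>\<^bsub>X\<^esub> sw K V W X t (f x)"
      by (rule linear_map_sw[OF _ _ _ _ smult_linear, symmetric]) (use assms x k cl in auto)
    finally show "sw K V W X t (f (k \<odot>\<^bsub>U\<^esub> x)) = k \<odot>\<^bsub>X\<^esub> sw K V W X t (f x)" . }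
qed

lemma linear_map_sw_arg:
  assumes "module K V" "module K W" "module K X" "bilinear_map K V W X f"
  shows "linear_map K (tensor K V W) X (\<lambda>t. sw K V W X t f)"
proof -
  interpret T: module K "tensor K V W" by (rule tensor_module) fact+
  have "linear_map K (tensor K V W) X (\<lambda>t. sweedler K X t f)"
    using sweedler_linear_space[OF assms(1-4)] unfolding linear_map_from_tensor .
  then show ?thesis
    using linear_map_cong[OF T.module_axioms, of "\<lambda>t. sweedler K X t f" "\<lambda>t. sw K V W X t f" X]
      sweedler_eq_sw[OF assms(1-3) _ assms(4)] by simp
qed

lemma sw_tens:
  fixes V :: "('k, 'v, 'x) hom_space_scheme" and W :: "('k, 'w, 'y) hom_space_scheme"
  assumes "module K V" "module K W" "module K X" "bilinear_map K V W X f" "v \<in> carrier V" "w \<in> carrier W"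
  shows "sw K V W X (tens K V W v w) f = f v w"
  using sweedler_tens_space[OF assms] sweedler_eq_sw[OF assms(1-3) tens_closed[OF assms(1,2,5,6)] assms(4)]
  by simp

lemma sw_tens_eq_self:
  assumes "module K V" "module K W" "t \<in> carrier (tensor K V W)"
  shows "sw K V W (tensor K V W) t (tens K V W) = t"
proof -
  note T = tensor_module[OF assms(1,2)] note b = tens_bilinear[OF assms(1,2)]
  show ?thesis
    by (rule tensor_ext[OF assms(1,2) linear_map_sw_arg[OF assms(1,2) T b] _ _ assms(3)])
      (auto simp: linear_map_def sw_tens[OF assms(1,2) T b])
qed

lemma sw_sw:
  assumes "module K V" "module K W" "module K U" "module K U'" "module K X"
    and "bilinear_map K V W X f" "t \<in> carrier (tensor K U U')"
    and "\<And>u u'. u \<in> carrier U \<Longrightarrow> u' \<in> carrier U' \<Longrightarrow> g u u' \<in> carrier (tensor K V W)"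
  shows "sw K V W X (sw K U U' (tensor K V W) t g) f = sw K U U' X t (\<lambda>u u'. sw K V W X (g u u') f)"
  by (rule linear_map_sw[OF assms(3,4) tensor_module[OF assms(1,2)] assms(5)
        linear_map_sw_arg[OF assms(1,2,5,6)]]) fact+

text \<open>Nested Sweedler sums over independent tensors may be interchanged. Both are sums over the
  representatives chosen in \<^const>\<open>sw\<close>, so \<open>f\<close> may be an arbitrary function.\<close>

lemma sw_swap:
  assumes "module K V" "module K W" "module K U" "module K U'" "module K X"
    and t: "t \<in> carrier (tensor K V W)" and s: "s \<in> carrier (tensor K U U')"
    and f: "\<And>v w u u'. v \<in> carrier V \<Longrightarrow> w \<in> carrier W \<Longrightarrow> u \<in> carrier U \<Longrightarrow> u' \<in> carrier U' \<Longrightarrow>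
      f v w u u' \<in> carrier X"
  shows "sw K V W X t (\<lambda>v w. sw K U U' X s (\<lambda>u u'. f v w u u')) =
    sw K U U' X s (\<lambda>u u'. sw K V W X t (\<lambda>v w. f v w u u'))"
proof -
  interpret X: module K X by fact
  define c A where "c = (SOME u. u \<in> t)" and "A = {p. c p \<noteq> \<zero>\<^bsub>K\<^esub>}"
  note fs = sw_as_finsum[OF assms(1,2) t, folded c_def, folded A_def]
  have A: "finite A" "A \<subseteq> carrier V \<times> carrier W" "\<And>p. p \<in> A \<Longrightarrow> c p \<in> carrier K"
    using fs(1-3) unfolding A_def by auto
  note st = fs(4)[OF assms(5)]
  have scl: "sw K U U' X s (\<lambda>u u'. f v w u u') \<in> carrier X"
    if "v \<in> carrier V" "w \<in> carrier W" for v w using that assms by (intro sw_closed) auto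
  \<comment> \<open>the inner sum commutes with finite sums, by induction from \<open>sw_add\<close>\<close>
  have fin: "finite B \<Longrightarrow> B \<subseteq> A \<Longrightarrow> sw K U U' X s (\<lambda>u u'. \<Oplus>\<^bsub>X\<^esub>p\<in>B. c p \<odot>\<^bsub>X\<^esub> f (fst p) (snd p) u u')
      = (\<Oplus>\<^bsub>X\<^esub>p\<in>B. c p \<odot>\<^bsub>X\<^esub> sw K U U' X s (\<lambda>u u'. f (fst p) (snd p) u u'))" for B
  proof (induction B rule: finite_induct)
    case empty
    have "sw K U U' X s (\<lambda>u u'. \<zero>\<^bsub>K\<^esub> \<odot>\<^bsub>X\<^esub> \<zero>\<^bsub>X\<^esub>) = \<zero>\<^bsub>K\<^esub> \<odot>\<^bsub>X\<^esub> sw K U U' X s (\<lambda>u u'. \<zero>\<^bsub>X\<^esub>)"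
      by (rule linear_map_sw[OF _ _ _ _ smult_linear, symmetric]) (use assms in auto)
    moreover have "sw K U U' X s (\<lambda>u u'. \<zero>\<^bsub>X\<^esub>) \<in> carrier X" by (rule sw_closed) (use assms in auto)
    ultimately show ?case by simp
  next
    case (insert p B)
    have p: "fst p \<in> carrier V" "snd p \<in> carrier W" "c p \<in> carrier K" using insert A by auto
    have B: "q \<in> B \<Longrightarrow> fst q \<in> carrier V \<and> snd q \<in> carrier W \<and> c q \<in> carrier K" for q
      using insert A by auto
    have "sw K U U' X s (\<lambda>u u'. \<Oplus>\<^bsub>X\<^esub>p\<in>insert p B. c p \<odot>\<^bsub>X\<^esub> f (fst p) (snd p) u u') =
       sw K U U' X s (\<lambda>u u'. c p \<odot>\<^bsub>X\<^esub> f (fst p) (snd p) u u' \<oplus>\<^bsub>X\<^esub> (\<Oplus>\<^bsub>X\<^esub>p\<in>B. c p \<odot>\<^bsub>X\<^esub> f (fst p) (snd p) u u'))"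
      by (intro sw_cong refl, subst X.finsum_insert) (use insert p B f in auto)
    also have "\<dots> = sw K U U' X s (\<lambda>u u'. c p \<odot>\<^bsub>X\<^esub> f (fst p) (snd p) u u') \<oplus>\<^bsub>X\<^esub>
        sw K U U' X s (\<lambda>u u'. \<Oplus>\<^bsub>X\<^esub>p\<in>B. c p \<odot>\<^bsub>X\<^esub> f (fst p) (snd p) u u')"
      by (rule sw_add) (use assms p B f in \<open>auto intro!: X.finsum_closed\<close>)
    also have "sw K U U' X s (\<lambda>u u'. c p \<odot>\<^bsub>X\<^esub> f (fst p) (snd p) u u') = c p \<odot>\<^bsub>X\<^esub> sw K U U' X s (f (fst p) (snd p))"
      by (rule linear_map_sw[OF _ _ _ _ smult_linear, symmetric]) (use assms p f in auto)
    finally show ?case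
      using insert p B scl by (subst X.finsum_insert) auto
  qed
  have "sw K V W X t (\<lambda>v w. sw K U U' X s (\<lambda>u u'. f v w u u'))
     = (\<Oplus>\<^bsub>X\<^esub>p\<in>A. c p \<odot>\<^bsub>X\<^esub> sw K U U' X s (\<lambda>u u'. f (fst p) (snd p) u u'))"
    by (rule st) (rule scl)
  also have "\<dots> = sw K U U' X s (\<lambda>u u'. \<Oplus>\<^bsub>X\<^esub>p\<in>A. c p \<odot>\<^bsub>X\<^esub> f (fst p) (snd p) u u')"
    by (rule fin[symmetric]) (use A in auto)
  also have "\<dots> = sw K U U' X s (\<lambda>u u'. sw K V W X t (\<lambda>v w. f v w u u'))"
    by (intro sw_cong refl st[symmetric] f)
  finally show ?thesis .
qed

section \<open>Rewriting with Sweedler sums on Hom-spaces\<close>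

text \<open>The ring \<open>K\<close> is fixed in a locale because it cannot be read off from many of the conclusions
  below, such as \<open>alpha V v \<in> carrier V\<close>; with a schematic \<open>K\<close> the simplifier would have no means to
  instantiate their premises.\<close>

locale hom_calculus =
  fixes K :: "('k, 'r) ring_scheme"
begin

text \<open>Bilinearity is always split into linearity in each argument. For a concrete term the latter
  follows from the rules for \<^const>\<open>linear_map\<close> below, which recurse over the outermost operation.\<close>

lemma bilinear_map_iff [simp]:
  "bilinear_map K V W U f \<longleftrightarrow>
     (\<forall>v\<in>carrier V. linear_map K W U (f v)) \<and> (\<forall>w\<in>carrier W. linear_map K V U (\<lambda>v. f v w))"
  by (rule bilinear_map_def)

lemma hom_space_module [simp]: "hom_space K V \<Longrightarrow> module K V"
  and hom_space_alpha_linear: "hom_space K V \<Longrightarrow> linear_map K V V (alpha V)"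
  by (auto simp: hom_space_def)

lemma alpha_closed [simp]: "hom_space K V \<Longrightarrow> v \<in> carrier V \<Longrightarrow> alpha V v \<in> carrier V"
  using hom_space_alpha_linear linear_map_closed by metis

lemma tens_closed' [simp]:
  "hom_space K V \<Longrightarrow> hom_space K W \<Longrightarrow> v \<in> carrier V \<Longrightarrow> w \<in> carrier W
    \<Longrightarrow> tens K V W v w \<in> carrier (tensor K V W)"
  by (rule tens_closed) simp_all

lemma alpha_tensor: "alpha (tensor K V W) =
    (\<lambda>t. sweedler K (tensor_space K V W) t (\<lambda>v w. tens K V W (alpha V v) (alpha W w)))"
  by (simp add: tensor_def module.extend_def hom_space.fields_def)

lemma sw_tensor_space: "sw K V W (tensor_space K V' W') t f = sw K V W (tensor K V' W') t f"
proof -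
  have "add (tensor K V' W') = add (tensor_space K V' W')"
    and "smult (tensor K V' W') = smult (tensor_space K V' W')"
    by (auto simp: fun_eq_iff tensor_sel)
  then show ?thesis
    unfolding sw_def lin_extend_def finsum_def by (simp only: tensor_sel) (simp add: finprod_def tensor_sel)
qed

lemma lin_id [simp]: "linear_map K V V (\<lambda>x. x)"
  by (simp add: linear_map_def)

lemma lin_alpha [simp]:
  "hom_space K W \<Longrightarrow> linear_map K V W f \<Longrightarrow> linear_map K V W (\<lambda>x. alpha W (f x))"
  by (rule linear_map_compose[OF _ hom_space_alpha_linear])

lemma lin_alpha' [simp]: "hom_space K W \<Longrightarrow> linear_map K W W (alpha W)"
  by (rule hom_space_alpha_linear)

lemma lin_tens_left [simp]:
  "hom_space K V \<Longrightarrow> hom_space K W \<Longrightarrow> w \<in> carrier W \<Longrightarrow> linear_map K U V f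
    \<Longrightarrow> linear_map K U (tensor K V W) (\<lambda>x. tens K V W (f x) w)"
  by (rule linear_map_compose[OF _ bilinear_mapD(2)[OF tens_bilinear]]) simp_all

lemma lin_tens_right [simp]:
  "hom_space K V \<Longrightarrow> hom_space K W \<Longrightarrow> v \<in> carrier V \<Longrightarrow> linear_map K U W f
    \<Longrightarrow> linear_map K U (tensor K V W) (\<lambda>x. tens K V W v (f x))"
  by (rule linear_map_compose[OF _ bilinear_mapD(1)[OF tens_bilinear]]) simp_all

lemma lin_tens_right' [simp]:
  "hom_space K V \<Longrightarrow> hom_space K W \<Longrightarrow> v \<in> carrier V \<Longrightarrow> linear_map K W (tensor K V W) (tens K V W v)"
  by (rule bilinear_mapD(1)[OF tens_bilinear]) simp_all

text \<open>The structure map of a product is first handled on the underlying tensor space, whose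
  structure as a Hom-space is what is being proved.\<close>

lemma hom_space_tensor [simp]:
  assumes V: "hom_space K V" and W: "hom_space K W" shows "hom_space K (tensor K V W)"
proof -
  have mV: "module K V" and mW: "module K W" using assms by simp_all
  have b: "bilinear_map K V W (tensor_space K V W) (\<lambda>v w. tens K V W (alpha V v) (alpha W w))"
    unfolding bilinear_map_iff linear_map_to_tensor[symmetric] using assms by simp
  have "linear_map K (tensor_space K V W) (tensor_space K V W) (alpha (tensor K V W))"
    unfolding alpha_tensor
    by (rule sweedler_linear_space[OF mV mW tensor_space_module[OF mV mW] b])
  then show ?thesis using tensor_module[OF mV mW]
    unfolding hom_space_def linear_map_from_tensor linear_map_to_tensor by simp
qed

text \<open>The calculus of Sweedler sums, with its conditions phrased for Hom-spaces.\<close>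

lemmas sw_closed' [simp] = sw_closed[OF hom_space_module hom_space_module hom_space_module]
lemmas sw_tens' [simp] = sw_tens[OF hom_space_module hom_space_module hom_space_module]
lemmas sw_sw' [simp] =
  sw_sw[OF hom_space_module hom_space_module hom_space_module hom_space_module hom_space_module]
lemmas sw_swap' =
  sw_swap[OF hom_space_module hom_space_module hom_space_module hom_space_module hom_space_module]
lemmas lin_sw_fun [simp] =
  linear_map_sw_fun[OF hom_space_module hom_space_module hom_space_module hom_space_module]
lemmas lin_sw_arg' [simp] = linear_map_sw_arg[OF hom_space_module hom_space_module hom_space_module]
lemmas lin_sw_arg [simp] = linear_map_compose[OF _ lin_sw_arg']

text \<open>A left-hand side with the variable head \<open>g\<close> is no usable rewrite rule; the instances for
  \<^const>\<open>alpha\<close> and \<^const>\<open>tens\<close> are.\<close>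

lemma push_linear:
  "linear_map K X Y g \<Longrightarrow> hom_space K V \<Longrightarrow> hom_space K W \<Longrightarrow> hom_space K X \<Longrightarrow> hom_space K Y \<Longrightarrow>
    t \<in> carrier (tensor K V W) \<Longrightarrow>
    (\<And>v w. v \<in> carrier V \<Longrightarrow> w \<in> carrier W \<Longrightarrow> f v w \<in> carrier X) \<Longrightarrow>
    g (sw K V W X t f) = sw K V W Y t (\<lambda>v w. g (f v w))"
  by (rule linear_map_sw) simp_all

lemma alpha_sw [simp]:
  "hom_space K V \<Longrightarrow> hom_space K W \<Longrightarrow> hom_space K X \<Longrightarrow> t \<in> carrier (tensor K V W) \<Longrightarrow>
    (\<And>v w. v \<in> carrier V \<Longrightarrow> w \<in> carrier W \<Longrightarrow> f v w \<in> carrier X) \<Longrightarrow>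
    alpha X (sw K V W X t f) = sw K V W X t (\<lambda>v w. alpha X (f v w))"
  by (rule push_linear) simp_all

lemma tens_sw_left [simp]:
  "hom_space K V \<Longrightarrow> hom_space K W \<Longrightarrow> hom_space K X \<Longrightarrow> hom_space K Y \<Longrightarrow> t \<in> carrier (tensor K V W) \<Longrightarrow>
    y \<in> carrier Y \<Longrightarrow> (\<And>v w. v \<in> carrier V \<Longrightarrow> w \<in> carrier W \<Longrightarrow> f v w \<in> carrier X) \<Longrightarrow>
    tens K X Y (sw K V W X t f) y = sw K V W (tensor K X Y) t (\<lambda>v w. tens K X Y (f v w) y)"
  by (rule push_linear) simp_all

lemma tens_sw_right [simp]:
  "hom_space K V \<Longrightarrow> hom_space K W \<Longrightarrow> hom_space K X \<Longrightarrow> hom_space K Y \<Longrightarrow> t \<in> carrier (tensor K V W) \<Longrightarrow>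
    x \<in> carrier X \<Longrightarrow> (\<And>v w. v \<in> carrier V \<Longrightarrow> w \<in> carrier W \<Longrightarrow> f v w \<in> carrier Y) \<Longrightarrow>
    tens K X Y x (sw K V W Y t f) = sw K V W (tensor K X Y) t (\<lambda>v w. tens K X Y x (f v w))"
  by (rule push_linear[where g = "tens K X Y x"]) simp_all

lemma bilinear_cong:
  assumes "hom_space K V" "hom_space K W" "bilinear_map K V W X g"
    and "\<And>v w. v \<in> carrier V \<Longrightarrow> w \<in> carrier W \<Longrightarrow> f v w = g v w"
  shows "bilinear_map K V W X f"
proof -
  interpret V: module K V using assms by simp
  interpret W: module K W using assms by simp
  show ?thesis using assms(3,4) unfolding bilinear_map_iff linear_map_def Pi_def by auto
qed

text \<open>Translates the Sweedler sums in which the structures are defined into the calculus of \<^const>\<open>sw\<close>.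
  The summand \<open>f\<close> and its translation \<open>g\<close> are allowed to differ so that nested sums can be translated
  from the outside inwards.\<close>

lemma sweedler_eqI:
  assumes "hom_space K V" "hom_space K W" "hom_space K X" "t \<in> carrier (tensor K V W)"
    and g: "bilinear_map K V W X g"
    and fg: "\<And>v w. v \<in> carrier V \<Longrightarrow> w \<in> carrier W \<Longrightarrow> f v w = g v w"
  shows "sweedler K X t f = sw K V W X t g"
proof -
  have "sweedler K X t f = sw K V W X t f"
    by (rule sweedler_eq_sw[OF _ _ _ assms(4) bilinear_cong[OF assms(1,2) g fg]]) (use assms in auto)
  then show ?thesis using fg by simp
qed

lemma alpha_tensor_sw:
  assumes "hom_space K V" "hom_space K W" "t \<in> carrier (tensor K V W)"
  shows "alpha (tensor K V W) t = sw K V W (tensor K V W) t (\<lambda>v w. tens K V W (alpha V v) (alpha W w))"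
proof -
  have "sweedler K (tensor_space K V W) t (\<lambda>v w. tens K V W (alpha V v) (alpha W w))
      = sw K V W (tensor_space K V W) t (\<lambda>v w. tens K V W (alpha V v) (alpha W w))"
  proof (rule sweedler_eq_sw)
    show "bilinear_map K V W (tensor_space K V W) (\<lambda>v w. tens K V W (alpha V v) (alpha W w))"
      unfolding bilinear_map_iff linear_map_to_tensor[symmetric] using assms by simp
  qed (use assms in \<open>simp_all add: tensor_space_module\<close>)
  then show ?thesis unfolding alpha_tensor sw_tensor_space .
qed

lemma alpha_tens [simp]:
  "hom_space K V \<Longrightarrow> hom_space K W \<Longrightarrow> v \<in> carrier V \<Longrightarrow> w \<in> carrier W \<Longrightarrow>
    alpha (tensor K V W) (tens K V W v w) = tens K V W (alpha V v) (alpha W w)"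
  by (simp add: alpha_tensor_sw)

lemma hom_space_smult_closed [simp]:
  "hom_space K X \<Longrightarrow> k \<in> carrier K \<Longrightarrow> x \<in> carrier X \<Longrightarrow> k \<odot>\<^bsub>X\<^esub> x \<in> carrier X"
  by (meson hom_space_module module.smult_closed)

lemma lin_smult [simp]:
  assumes "hom_space K X" "k \<in> carrier K" "linear_map K V X f"
  shows "linear_map K V X (\<lambda>x. k \<odot>\<^bsub>X\<^esub> f x)"
  by (rule linear_map_compose[OF assms(3) smult_linear]) (use assms in auto)

lemma lin_form_smult:
  assumes "linear_form K U e" "hom_space K X" "y \<in> carrier X" "linear_map K V U f"
  shows "linear_map K V X (\<lambda>x. e (f x) \<odot>\<^bsub>X\<^esub> y)"
proof -
  interpret X: module K X using assms by simp
  show ?thesis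
    using assms unfolding linear_form_def
    by (intro linear_mapI) (auto simp: linear_map_add[OF assms(4)] linear_map_smult[OF assms(4)]
      linear_map_closed[OF assms(4)] X.smult_l_distr X.smult_assoc1 Pi_def)
qed

text \<open>Scalars are moved to the outside.\<close>

lemma alpha_smult [simp]:
  "hom_space K X \<Longrightarrow> k \<in> carrier K \<Longrightarrow> x \<in> carrier X \<Longrightarrow> alpha X (k \<odot>\<^bsub>X\<^esub> x) = k \<odot>\<^bsub>X\<^esub> alpha X x"
  by (rule linear_map_smult[OF hom_space_alpha_linear])

lemma tens_smult_left [simp]:
  "hom_space K X \<Longrightarrow> hom_space K Y \<Longrightarrow> k \<in> carrier K \<Longrightarrow> x \<in> carrier X \<Longrightarrow> y \<in> carrier Y \<Longrightarrow>
    tens K X Y (k \<odot>\<^bsub>X\<^esub> x) y = k \<odot>\<^bsub>tensor K X Y\<^esub> tens K X Y x y"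
  by (rule linear_map_smult[OF bilinear_mapD(2)[OF tens_bilinear]]) simp_all

lemma tens_smult_right [simp]:
  "hom_space K X \<Longrightarrow> hom_space K Y \<Longrightarrow> k \<in> carrier K \<Longrightarrow> x \<in> carrier X \<Longrightarrow> y \<in> carrier Y \<Longrightarrow>
    tens K X Y x (k \<odot>\<^bsub>Y\<^esub> y) = k \<odot>\<^bsub>tensor K X Y\<^esub> tens K X Y x y"
  by (rule linear_map_smult[OF bilinear_mapD(1)[OF tens_bilinear]]) simp_all

lemma sw_smult [simp]:
  "hom_space K V \<Longrightarrow> hom_space K W \<Longrightarrow> hom_space K X \<Longrightarrow> t \<in> carrier (tensor K V W) \<Longrightarrow>
    k \<in> carrier K \<Longrightarrow> (\<And>v w. v \<in> carrier V \<Longrightarrow> w \<in> carrier W \<Longrightarrow> f v w \<in> carrier X) \<Longrightarrow>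
    sw K V W X t (\<lambda>v w. k \<odot>\<^bsub>X\<^esub> f v w) = k \<odot>\<^bsub>X\<^esub> sw K V W X t f"
  by (rule push_linear[where g = "\<lambda>x. k \<odot>\<^bsub>X\<^esub> x", symmetric]) (simp_all add: smult_linear)

definition trilinear_map where
  "trilinear_map U V W X f \<longleftrightarrow>
     (\<forall>v\<in>carrier V. \<forall>w\<in>carrier W. linear_map K U X (\<lambda>u. f u v w)) \<and>
     (\<forall>u\<in>carrier U. bilinear_map K V W X (f u))"

text \<open>Applying a trilinear \<open>f\<close> to a triple tensor, and the two bracketings of a double
  Sweedler sum that occur in the coassociativity axioms.\<close>

definition sw3 where
  "sw3 U V W X t f = sw K U (tensor K V W) X t (\<lambda>u s. sw K V W X s (f u))"

lemma sw3_left: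
  assumes "hom_space K U" "hom_space K V" "hom_space K W" "hom_space K X" "hom_space K M" "hom_space K N"
    "hom_space K P" "hom_space K Q"
    and f: "trilinear_map U V W X f" and t: "t \<in> carrier (tensor K M N)"
    and r: "\<And>m. m \<in> carrier M \<Longrightarrow> r m \<in> carrier (tensor K P Q)"
    and a: "\<And>m n p q. m \<in> carrier M \<Longrightarrow> n \<in> carrier N \<Longrightarrow> p \<in> carrier P \<Longrightarrow> q \<in> carrier Q \<Longrightarrow>
      a m n p q \<in> carrier U \<and> b m n p q \<in> carrier V \<and> c m n p q \<in> carrier W"
  shows "sw3 U V W X (sw K M N (tensor K U (tensor K V W)) t (\<lambda>m n.
      sw K P Q (tensor K U (tensor K V W)) (r m) (\<lambda>p q.
         tens K U (tensor K V W) (a m n p q) (tens K V W (b m n p q) (c m n p q))))) f =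
    sw K M N X t (\<lambda>m n. sw K P Q X (r m) (\<lambda>p q. f (a m n p q) (b m n p q) (c m n p q)))"
  using assms unfolding sw3_def trilinear_map_def by simp

lemma sw3_right:
  assumes "hom_space K U" "hom_space K V" "hom_space K W" "hom_space K X" "hom_space K M" "hom_space K N"
    and f: "trilinear_map U V W X f" and t: "t \<in> carrier (tensor K M N)"
    and a: "\<And>m n. m \<in> carrier M \<Longrightarrow> n \<in> carrier N \<Longrightarrow> a m n \<in> carrier U \<and> r m n \<in> carrier (tensor K V W)"
  shows "sw3 U V W X (sw K M N (tensor K U (tensor K V W)) t (\<lambda>m n.
         tens K U (tensor K V W) (a m n) (r m n))) f =
    sw K M N X t (\<lambda>m n. sw K V W X (r m n) (f (a m n)))"
  using assms unfolding sw3_def trilinear_map_def by simp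

end

section \<open>Hom-structures in terms of Sweedler sums\<close>

context hom_calculus
begin

text \<open>Each axiom is restated in the form in which it rewrites a Sweedler sum: whatever multilinear
  expression is summed, the sum over one side of the axiom equals the sum over the other.\<close>

lemma hom_algebraD:
  assumes "hom_algebra K A"
  shows "hom_space K A" "\<one>\<^bsub>A\<^esub> \<in> carrier A"
    "a \<in> carrier A \<Longrightarrow> b \<in> carrier A \<Longrightarrow> a \<otimes>\<^bsub>A\<^esub> b \<in> carrier A"
    "a \<in> carrier A \<Longrightarrow> b \<in> carrier A \<Longrightarrow> alpha A (a \<otimes>\<^bsub>A\<^esub> b) = alpha A a \<otimes>\<^bsub>A\<^esub> alpha A b"
    "alpha A \<one>\<^bsub>A\<^esub> = \<one>\<^bsub>A\<^esub>"
    "a \<in> carrier A \<Longrightarrow> \<one>\<^bsub>A\<^esub> \<otimes>\<^bsub>A\<^esub> a = alpha A a"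
    "a \<in> carrier A \<Longrightarrow> a \<otimes>\<^bsub>A\<^esub> \<one>\<^bsub>A\<^esub> = alpha A a"
    "a \<in> carrier A \<Longrightarrow> linear_map K V A f \<Longrightarrow> linear_map K V A (\<lambda>x. a \<otimes>\<^bsub>A\<^esub> f x)"
    "a \<in> carrier A \<Longrightarrow> linear_map K V A f \<Longrightarrow> linear_map K V A (\<lambda>x. f x \<otimes>\<^bsub>A\<^esub> a)"
    "a \<in> carrier A \<Longrightarrow> linear_map K A A ((\<otimes>\<^bsub>A\<^esub>) a)"
    and hom_assoc: "a \<in> carrier A \<Longrightarrow> b \<in> carrier A \<Longrightarrow> c \<in> carrier A \<Longrightarrow>
      alpha A a \<otimes>\<^bsub>A\<^esub> (b \<otimes>\<^bsub>A\<^esub> c) = (a \<otimes>\<^bsub>A\<^esub> b) \<otimes>\<^bsub>A\<^esub> alpha A c"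
  using assms linear_map_closed[of K A A "mult A a" b] linear_map_compose[of K V A f A "mult A a"]
    linear_map_compose[of K V A f A "\<lambda>b. b \<otimes>\<^bsub>A\<^esub> a"]
  unfolding hom_algebra_def bilinear_map_iff by blast+

lemma hom_coalgebraD:
  assumes "hom_coalgebra K C"
  shows "hom_space K C"
    "linear_map K C (tensor K C C) (comul C)"
    "linear_form K C (counit C)"
    "linear_map K V C f \<Longrightarrow> linear_map K V (tensor K C C) (\<lambda>x. comul C (f x))"
    "c \<in> carrier C \<Longrightarrow> comul C c \<in> carrier (tensor K C C)"
    "c \<in> carrier C \<Longrightarrow> counit C c \<in> carrier K"
    "c \<in> carrier C \<Longrightarrow> counit C (alpha C c) = counit C c"
    "hom_space K X \<Longrightarrow> y \<in> carrier X \<Longrightarrow> linear_map K V C f \<Longrightarrow> linear_map K V X (\<lambda>x. counit C (f x) \<odot>\<^bsub>X\<^esub> y)"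
    "hom_space K X \<Longrightarrow> y \<in> carrier X \<Longrightarrow> linear_map K C X (\<lambda>x. counit C x \<odot>\<^bsub>X\<^esub> y)"
proof -
  note c = assms[unfolded hom_coalgebra_def Let_def]
  show "hom_space K C" using c by blast
  show l: "linear_map K C (tensor K C C) (comul C)" using c by blast
  show "linear_map K V (tensor K C C) (\<lambda>x. comul C (f x))" if "linear_map K V C f"
    by (rule linear_map_compose[OF that l])
  show "comul C c \<in> carrier (tensor K C C)" if "c \<in> carrier C"
    by (rule linear_map_closed[OF l that])
  show lf: "linear_form K C (counit C)" using c by blast
  then show "counit C c \<in> carrier K" if "c \<in> carrier C"
    using that unfolding linear_form_def by auto
  show "counit C (alpha C c) = counit C c" if "c \<in> carrier C" using c that by blast
  show "linear_map K V X (\<lambda>x. counit C (f x) \<odot>\<^bsub>X\<^esub> y)"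
    if "hom_space K X" "y \<in> carrier X" "linear_map K V C f"
    by (rule lin_form_smult[OF lf that])
  show "linear_map K C X (\<lambda>x. counit C x \<odot>\<^bsub>X\<^esub> y)" if "hom_space K X" "y \<in> carrier X"
    by (rule lin_form_smult[OF lf that lin_id])
qed

lemma sw_comul_alpha:
  assumes "hom_coalgebra K C" "c \<in> carrier C" "hom_space K X" and g: "bilinear_map K C C X g"
  shows "sw K C C X (comul C (alpha C c)) g = sw K C C X (comul C c) (\<lambda>x y. g (alpha C x) (alpha C y))"
proof -
  note [simp] = hom_coalgebraD[OF assms(1)] assms(2,3)
  have "comul C (alpha C c) = alpha (tensor K C C) (comul C c)"
    using assms(1,2) unfolding hom_coalgebra_def by auto
  also have "\<dots> = sw K C C (tensor K C C) (comul C c) (\<lambda>x y. tens K C C (alpha C x) (alpha C y))"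
    by (intro alpha_tensor_sw) auto
  finally show ?thesis using g by simp
qed

lemma sw_counit:
  assumes "hom_coalgebra K C" "c \<in> carrier C" "hom_space K X" and h: "linear_map K C X h"
  shows "sw K C C X (comul C c) (\<lambda>x y. counit C x \<odot>\<^bsub>X\<^esub> h y) = h (alpha C c)"
    and "sw K C C X (comul C c) (\<lambda>x y. counit C y \<odot>\<^bsub>X\<^esub> h x) = h (alpha C c)"
proof -
  note [simp] = hom_coalgebraD[OF assms(1)] assms(2,3)
  have cu: "sweedler K C (comul C c) (\<lambda>c1 c2. counit C c1 \<odot>\<^bsub>C\<^esub> c2) = alpha C c"
     "sweedler K C (comul C c) (\<lambda>c1 c2. counit C c2 \<odot>\<^bsub>C\<^esub> c1) = alpha C c"
    using assms(1,2) unfolding hom_coalgebra_def by blast+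
  have swe: "sweedler K C (comul C c) f = sw K C C C (comul C c) f" if "bilinear_map K C C C f" for f
    using that by (intro sweedler_eqI) auto
  have "h (alpha C c) = h (sw K C C C (comul C c) (\<lambda>c1 c2. counit C c1 \<odot>\<^bsub>C\<^esub> c2))"
    by (subst cu(1)[symmetric], subst swe) auto
  also have "\<dots> = sw K C C X (comul C c) (\<lambda>x y. h (counit C x \<odot>\<^bsub>C\<^esub> y))"
    by (rule push_linear[OF h]) auto
  finally show "sw K C C X (comul C c) (\<lambda>x y. counit C x \<odot>\<^bsub>X\<^esub> h y) = h (alpha C c)"
    by (simp add: linear_map_smult[OF h])
  have "h (alpha C c) = h (sw K C C C (comul C c) (\<lambda>c1 c2. counit C c2 \<odot>\<^bsub>C\<^esub> c1))"
    by (subst cu(2)[symmetric], subst swe) auto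
  also have "\<dots> = sw K C C X (comul C c) (\<lambda>x y. h (counit C y \<odot>\<^bsub>C\<^esub> x))"
    by (rule push_linear[OF h]) auto
  finally show "sw K C C X (comul C c) (\<lambda>x y. counit C y \<odot>\<^bsub>X\<^esub> h x) = h (alpha C c)"
    by (simp add: linear_map_smult[OF h])
qed

text \<open>The same form of the axioms, with summands that are themselves tensors, serves to verify that a
  given map is a coaction; from it the rules for arbitrary multilinear summands are derived.\<close>

lemma hom_comodule_iff:
  assumes C: "hom_coalgebra K C" and M [simp]: "hom_space K M" and r: "linear_map K M (tensor K M C) \<rho>"
  defines "T \<equiv> tensor K M (tensor K C C)"
  shows "hom_comodule K C M \<rho> \<longleftrightarrow> (\<forall>m\<in>carrier M.
     sw K M C M (\<rho> m) (\<lambda>m0 m1. counit C m1 \<odot>\<^bsub>M\<^esub> m0) = alpha M m \<and>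
     sw K M C (tensor K M C) (\<rho> m) (\<lambda>m0 m1. tens K M C (alpha M m0) (alpha C m1)) = \<rho> (alpha M m) \<and>
     sw K M C T (\<rho> m) (\<lambda>m0 m1. sw K M C T (\<rho> m0) (\<lambda>m00 m01.
        tens K M (tensor K C C) m00 (tens K C C m01 (alpha C m1)))) =
     sw K M C T (\<rho> m) (\<lambda>m0 m1. tens K M (tensor K C C) (alpha M m0) (comul C m1)))"
proof -
  note [simp] = hom_coalgebraD[OF C] linear_map_closed[OF r] r linear_map_compose[OF _ r]
  have 1: "sweedler K M (\<rho> m) (\<lambda>m0 m1. counit C m1 \<odot>\<^bsub>M\<^esub> m0) =
      sw K M C M (\<rho> m) (\<lambda>m0 m1. counit C m1 \<odot>\<^bsub>M\<^esub> m0)" if "m \<in> carrier M" for m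
    by (intro sweedler_eqI) (use that in auto)
  have 2: "alpha (tensor K M C) (\<rho> m) =
      sw K M C (tensor K M C) (\<rho> m) (\<lambda>m0 m1. tens K M C (alpha M m0) (alpha C m1))"
    if "m \<in> carrier M" for m
    by (intro alpha_tensor_sw) (use that in auto)
  have 3: "sweedler K T (\<rho> m) (\<lambda>m0 m1. sweedler K T (\<rho> m0) (\<lambda>m00 m01.
             tens K M (tensor K C C) m00 (tens K C C m01 (alpha C m1)))) =
    sw K M C T (\<rho> m) (\<lambda>m0 m1. sw K M C T (\<rho> m0) (\<lambda>m00 m01.
        tens K M (tensor K C C) m00 (tens K C C m01 (alpha C m1))))"
    if "m \<in> carrier M" for m
    unfolding T_def by (intro sweedler_eqI) (use that in auto)
  have 4: "sweedler K T (\<rho> m) (\<lambda>m0 m1. tens K M (tensor K C C) (alpha M m0) (comul C m1)) =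
     sw K M C T (\<rho> m) (\<lambda>m0 m1. tens K M (tensor K C C) (alpha M m0) (comul C m1))"
    if "m \<in> carrier M" for m
    unfolding T_def by (intro sweedler_eqI) (use that in auto)
  show ?thesis using 1 2 3 4 r unfolding hom_comodule_def Let_def T_def[symmetric] by auto
qed

lemma hom_comoduleD:
  assumes "hom_comodule K C M \<rho>"
  shows "hom_space K M" "linear_map K M (tensor K M C) \<rho>"
    "linear_map K V M f \<Longrightarrow> linear_map K V (tensor K M C) (\<lambda>x. \<rho> (f x))"
    "m \<in> carrier M \<Longrightarrow> \<rho> m \<in> carrier (tensor K M C)"
proof -
  show "hom_space K M" and r: "linear_map K M (tensor K M C) \<rho>"
    using assms unfolding hom_comodule_def by blast+
  show "linear_map K V (tensor K M C) (\<lambda>x. \<rho> (f x))" if "linear_map K V M f"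
    by (rule linear_map_compose[OF that r])
  show "m \<in> carrier M \<Longrightarrow> \<rho> m \<in> carrier (tensor K M C)"
    by (rule linear_map_closed[OF r])
qed

lemma sw_comodule:
  assumes "hom_coalgebra K C" "hom_comodule K C M \<rho>" and X: "hom_space K X" and m: "m \<in> carrier M"
  shows sw_coact_alpha: "bilinear_map K M C X g \<Longrightarrow>
      sw K M C X (\<rho> (alpha M m)) g = sw K M C X (\<rho> m) (\<lambda>x y. g (alpha M x) (alpha C y))"
    and sw_coact_counit: "linear_map K M X h \<Longrightarrow>
      sw K M C X (\<rho> m) (\<lambda>x y. counit C y \<odot>\<^bsub>X\<^esub> h x) = h (alpha M m)"
    and sw_coact_coassoc: "trilinear_map M C C X k \<Longrightarrow>
      sw K M C X (\<rho> m) (\<lambda>x y. sw K M C X (\<rho> x) (\<lambda>x1 x2. k x1 x2 (alpha C y))) =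
      sw K M C X (\<rho> m) (\<lambda>x y. sw K C C X (comul C y) (\<lambda>y1 y2. k (alpha M x) y1 y2))"
proof -
  note d = hom_comoduleD[OF assms(2)]
  note i = assms(2)[unfolded hom_comodule_iff[OF assms(1) d(1,2)], rule_format, OF m]
  note [simp] = hom_coalgebraD[OF assms(1)] d X m
  show "sw K M C X (\<rho> (alpha M m)) g = sw K M C X (\<rho> m) (\<lambda>x y. g (alpha M x) (alpha C y))"
    if "bilinear_map K M C X g"
    using that by (subst conjunct1[OF conjunct2[OF i], symmetric]) simp
  show "sw K M C X (\<rho> m) (\<lambda>x y. counit C y \<odot>\<^bsub>X\<^esub> h x) = h (alpha M m)" if h: "linear_map K M X h"
  proof -
    have "h (alpha M m) = h (sw K M C M (\<rho> m) (\<lambda>m0 m1. counit C m1 \<odot>\<^bsub>M\<^esub> m0))"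
      by (subst conjunct1[OF i]) simp
    also have "\<dots> = sw K M C X (\<rho> m) (\<lambda>x y. h (counit C y \<odot>\<^bsub>M\<^esub> x))"
      by (rule push_linear[OF h]) auto
    finally show ?thesis by (simp add: linear_map_smult[OF h])
  qed
  show "sw K M C X (\<rho> m) (\<lambda>x y. sw K M C X (\<rho> x) (\<lambda>x1 x2. k x1 x2 (alpha C y))) =
      sw K M C X (\<rho> m) (\<lambda>x y. sw K C C X (comul C y) (\<lambda>y1 y2. k (alpha M x) y1 y2))"
    if k: "trilinear_map M C C X k"
  proof -
    have "sw3 M C C X (sw K M C (tensor K M (tensor K C C)) (\<rho> m) (\<lambda>m0 m1.
         sw K M C (tensor K M (tensor K C C)) (\<rho> m0) (\<lambda>m00 m01.
        tens K M (tensor K C C) m00 (tens K C C m01 (alpha C m1))))) k =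
      sw3 M C C X (sw K M C (tensor K M (tensor K C C)) (\<rho> m) (\<lambda>m0 m1.
         tens K M (tensor K C C) (alpha M m0) (comul C m1))) k"
      by (subst conjunct2[OF conjunct2[OF i]]) simp
    then show ?thesis using k by (simp add: sw3_left sw3_right)
  qed
qed

lemma hom_coalgebra_iff:
  assumes C [simp]: "hom_space K C" and r: "linear_map K C (tensor K C C) (comul C)"
    and e: "linear_form K C (counit C)"
  defines "T \<equiv> tensor K C (tensor K C C)"
  shows "hom_coalgebra K C \<longleftrightarrow> (\<forall>c\<in>carrier C.
     counit C (alpha C c) = counit C c \<and>
     sw K C C C (comul C c) (\<lambda>x y. counit C x \<odot>\<^bsub>C\<^esub> y) = alpha C c \<and>
     sw K C C C (comul C c) (\<lambda>x y. counit C y \<odot>\<^bsub>C\<^esub> x) = alpha C c \<and>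
     sw K C C (tensor K C C) (comul C c) (\<lambda>x y. tens K C C (alpha C x) (alpha C y)) = comul C (alpha C c) \<and>
     sw K C C T (comul C c) (\<lambda>x y. sw K C C T (comul C x) (\<lambda>x1 x2.
        tens K C (tensor K C C) x1 (tens K C C x2 (alpha C y)))) =
     sw K C C T (comul C c) (\<lambda>x y. tens K C (tensor K C C) (alpha C x) (comul C y)))"
proof -
  note [simp] = linear_map_closed[OF r] r linear_map_compose[OF _ r] lin_form_smult[OF e]
  have [simp]: "c \<in> carrier C \<Longrightarrow> counit C c \<in> carrier K" for c using e unfolding linear_form_def by auto
  have 1: "sweedler K C (comul C c) (\<lambda>x y. counit C y \<odot>\<^bsub>C\<^esub> x) =
      sw K C C C (comul C c) (\<lambda>x y. counit C y \<odot>\<^bsub>C\<^esub> x)"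
      "sweedler K C (comul C c) (\<lambda>x y. counit C x \<odot>\<^bsub>C\<^esub> y) =
      sw K C C C (comul C c) (\<lambda>x y. counit C x \<odot>\<^bsub>C\<^esub> y)" if "c \<in> carrier C" for c
    by (intro sweedler_eqI; use that in auto)+
  have 2: "alpha (tensor K C C) (comul C c) =
      sw K C C (tensor K C C) (comul C c) (\<lambda>x y. tens K C C (alpha C x) (alpha C y))"
    if "c \<in> carrier C" for c
    by (intro alpha_tensor_sw) (use that in auto)
  have 3: "sweedler K T (comul C c) (\<lambda>x y. sweedler K T (comul C x) (\<lambda>x1 x2.
             tens K C (tensor K C C) x1 (tens K C C x2 (alpha C y)))) =
    sw K C C T (comul C c) (\<lambda>x y. sw K C C T (comul C x) (\<lambda>x1 x2.
        tens K C (tensor K C C) x1 (tens K C C x2 (alpha C y))))"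
    if "c \<in> carrier C" for c
    unfolding T_def by (intro sweedler_eqI) (use that in auto)
  have 4: "sweedler K T (comul C c) (\<lambda>x y. tens K C (tensor K C C) (alpha C x) (comul C y)) =
     sw K C C T (comul C c) (\<lambda>x y. tens K C (tensor K C C) (alpha C x) (comul C y))"
    if "c \<in> carrier C" for c
    unfolding T_def by (intro sweedler_eqI) (use that in auto)
  show ?thesis using 1 2 3 4 r e unfolding hom_coalgebra_def Let_def T_def[symmetric] by auto
qed

text \<open>A coalgebra is a comodule over itself, so this is an instance of coassociativity of coactions.\<close>

lemma sw_coassoc:
  assumes "hom_coalgebra K C" and X: "hom_space K X" and m: "c \<in> carrier C"
    and k: "trilinear_map C C C X k"
  shows "sw K C C X (comul C c) (\<lambda>x y. sw K C C X (comul C x) (\<lambda>x1 x2. k x1 x2 (alpha C y))) =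
      sw K C C X (comul C c) (\<lambda>x y. sw K C C X (comul C y) (\<lambda>y1 y2. k (alpha C x) y1 y2))"
proof -
  have "hom_comodule K C C (comul C)"
    using assms(1) hom_coalgebraD[OF assms(1)]
    by (simp add: hom_comodule_iff hom_coalgebra_iff)
  from sw_coact_coassoc[OF assms(1) this X m k] show ?thesis .
qed

lemma tensor_mult_sw:
  assumes A: "hom_algebra K A" and B: "hom_algebra K B" and X: "hom_space K X"
    and s: "s \<in> carrier (tensor K A B)" and t: "t \<in> carrier (tensor K A B)"
    and f: "bilinear_map K A B X f"
  shows "tensor_mult K A B s t =
      sw K A B (tensor K A B) s (\<lambda>a b. sw K A B (tensor K A B) t (\<lambda>a' b'. tens K A B (a \<otimes>\<^bsub>A\<^esub> a') (b \<otimes>\<^bsub>B\<^esub> b')))"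
    and "sw K A B X (tensor_mult K A B s t) f =
      sw K A B X s (\<lambda>a b. sw K A B X t (\<lambda>a' b'. f (a \<otimes>\<^bsub>A\<^esub> a') (b \<otimes>\<^bsub>B\<^esub> b')))"
proof -
  note [simp] = hom_algebraD[OF A] hom_algebraD[OF B] X s t
  show e: "tensor_mult K A B s t =
      sw K A B (tensor K A B) s (\<lambda>a b. sw K A B (tensor K A B) t (\<lambda>a' b'. tens K A B (a \<otimes>\<^bsub>A\<^esub> a') (b \<otimes>\<^bsub>B\<^esub> b')))"
    unfolding tensor_mult_def by (intro sweedler_eqI) auto
  show "sw K A B X (tensor_mult K A B s t) f =
      sw K A B X s (\<lambda>a b. sw K A B X t (\<lambda>a' b'. f (a \<otimes>\<^bsub>A\<^esub> a') (b \<otimes>\<^bsub>B\<^esub> b')))"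
    unfolding e using f by simp
qed

lemma hom_bialgebraD:
  assumes "hom_bialgebra K B"
  shows "hom_algebra K B" "hom_coalgebra K B"
    "a \<in> carrier B \<Longrightarrow> b \<in> carrier B \<Longrightarrow> counit B (a \<otimes>\<^bsub>B\<^esub> b) = counit B a \<otimes>\<^bsub>K\<^esub> counit B b"
    "counit B \<one>\<^bsub>B\<^esub> = \<one>\<^bsub>K\<^esub>"
    "comul B \<one>\<^bsub>B\<^esub> = tens K B B \<one>\<^bsub>B\<^esub> \<one>\<^bsub>B\<^esub>"
  using assms unfolding hom_bialgebra_def by auto

lemma sw_comul_mult:
  assumes B: "hom_bialgebra K B" and "hom_space K X" and "bilinear_map K B B X f"
    and "a \<in> carrier B" "b \<in> carrier B"
  shows "sw K B B X (comul B (a \<otimes>\<^bsub>B\<^esub> b)) f =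
      sw K B B X (comul B a) (\<lambda>a1 a2. sw K B B X (comul B b) (\<lambda>b1 b2. f (a1 \<otimes>\<^bsub>B\<^esub> b1) (a2 \<otimes>\<^bsub>B\<^esub> b2)))"
proof -
  note d = hom_bialgebraD[OF B]
  have "comul B (a \<otimes>\<^bsub>B\<^esub> b) = tensor_mult K B B (comul B a) (comul B b)"
    using B assms(4,5) unfolding hom_bialgebra_def by blast
  then show ?thesis
    using tensor_mult_sw(2)[OF d(1) d(1) assms(2) _ _ assms(3)] hom_coalgebraD[OF d(2)] assms(4,5) by metis
qed

lemma sw_antipode:
  assumes B: "hom_bialgebra K B" and S: "antipode K B S" and X: "hom_space K X" and h: "linear_map K B X h"
    and b: "b \<in> carrier B"
  shows "sw K B B X (comul B b) (\<lambda>b1 b2. h (S b1 \<otimes>\<^bsub>B\<^esub> b2)) = counit B b \<odot>\<^bsub>X\<^esub> h \<one>\<^bsub>B\<^esub>"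
    and "sw K B B X (comul B b) (\<lambda>b1 b2. h (b1 \<otimes>\<^bsub>B\<^esub> S b2)) = counit B b \<odot>\<^bsub>X\<^esub> h \<one>\<^bsub>B\<^esub>"
proof -
  note d = hom_bialgebraD[OF B]
  have lS: "linear_map K B B S" using S unfolding antipode_def by blast
  note [simp] = hom_algebraD[OF d(1)] hom_coalgebraD[OF d(2)] X b lS linear_map_facts[OF lS]
  have 1: "sweedler K B (comul B b) (\<lambda>b1 b2. S b1 \<otimes>\<^bsub>B\<^esub> b2) = sw K B B B (comul B b) (\<lambda>b1 b2. S b1 \<otimes>\<^bsub>B\<^esub> b2)"
    by (intro sweedler_eqI) auto
  have 2: "sweedler K B (comul B b) (\<lambda>b1 b2. b1 \<otimes>\<^bsub>B\<^esub> S b2) = sw K B B B (comul B b) (\<lambda>b1 b2. b1 \<otimes>\<^bsub>B\<^esub> S b2)"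
    by (intro sweedler_eqI) auto
  have "sw K B B B (comul B b) (\<lambda>b1 b2. S b1 \<otimes>\<^bsub>B\<^esub> b2) = counit B b \<odot>\<^bsub>B\<^esub> \<one>\<^bsub>B\<^esub>"
    and "sw K B B B (comul B b) (\<lambda>b1 b2. b1 \<otimes>\<^bsub>B\<^esub> S b2) = counit B b \<odot>\<^bsub>B\<^esub> \<one>\<^bsub>B\<^esub>"
    using S b unfolding antipode_def 1[symmetric] 2[symmetric] by blast+
  then show "sw K B B X (comul B b) (\<lambda>b1 b2. h (S b1 \<otimes>\<^bsub>B\<^esub> b2)) = counit B b \<odot>\<^bsub>X\<^esub> h \<one>\<^bsub>B\<^esub>"
    and "sw K B B X (comul B b) (\<lambda>b1 b2. h (b1 \<otimes>\<^bsub>B\<^esub> S b2)) = counit B b \<odot>\<^bsub>X\<^esub> h \<one>\<^bsub>B\<^esub>"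
    by (subst push_linear[OF h, symmetric]; simp add: linear_map_smult[OF h])+
qed

end

section \<open>Records with the same underlying Hom-space\<close>

text \<open>A Doi-Hopf module is built by adding an action and a coaction to a Hom-space, and a co-opposite or
  opposite bialgebra by replacing one operation. Everything that is defined from the linear structure
  and \<open>\<alpha>\<close> alone, tensor products in particular, is literally the same for two such records.\<close>

definition same_space :: "('k, 'v, 'x) hom_space_scheme \<Rightarrow> ('k, 'v, 'y) hom_space_scheme \<Rightarrow> bool" where
  "same_space V V' \<longleftrightarrow> carrier V = carrier V' \<and> zero V = zero V' \<and> add V = add V' \<and>
     smult V = smult V' \<and> alpha V = alpha V'"

lemma same_space_refl [simp]: "same_space V V"
  by (simp add: same_space_def)

lemma same_space_sym: "same_space V V' \<Longrightarrow> same_space V' V"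
  by (simp add: same_space_def)

lemma same_space_tens:
  assumes "same_space V V'" "same_space W W'"
  shows "tensor_space K V W = tensor_space K V' W'" and "tens K V W = tens K V' W'"
proof -
  have "bilinearity_span K V W = bilinearity_span K V' W'"
    using assms unfolding bilinearity_span_def same_space_def by simp
  then show "tensor_space K V W = tensor_space K V' W'" and "tens K V W = tens K V' W'"
    using assms unfolding tensor_space_def tens_def[abs_def] same_space_def by simp_all
qed

lemma same_space_tensor:
  assumes "same_space V V'" "same_space W W'"
  shows "tensor K V W = tensor K V' W'"
  using assms unfolding tensor_def same_space_tens[OF assms] by (simp add: same_space_def)

lemma same_space_linear_map:
  "same_space V V' \<Longrightarrow> same_space W W' \<Longrightarrow> linear_map K V W f = linear_map K V' W' f"
  by (simp add: linear_map_def same_space_def)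

lemma same_space_sw:
  "same_space V V' \<Longrightarrow> same_space W W' \<Longrightarrow> same_space X X' \<Longrightarrow> sw K V W X t f = sw K V' W' X' t f"
  unfolding sw_def lin_extend_def finsum_def finprod_def
  by (simp add: same_space_def cong: if_cong)

lemma same_space_sweedler:
  "same_space X X' \<Longrightarrow> sweedler K X t f = sweedler K X' t f"
  unfolding sweedler_def finsum_def finprod_def same_space_def by simp

lemma same_space_module:
  assumes "same_space V V'" "module K V" shows "module K V'"
  by (rule module_image[OF assms(2), where p = id]) (use assms(1) in \<open>auto simp: same_space_def\<close>)

lemma same_space_hom_space:
  "same_space V V' \<Longrightarrow> hom_space K V = hom_space K V'"
  using same_space_module[of V V' K] same_space_module[of V' V K] same_space_sym[of V V']
    same_space_linear_map[of V V' V V' K "alpha V"]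
  unfolding hom_space_def by (auto simp: same_space_def)

lemma make_dh_module_sel [simp]:
  "carrier (make_dh_module V a r) = carrier V"
  "alpha (make_dh_module V a r) = alpha V"
  "act (make_dh_module V a r) = a"
  "coact (make_dh_module V a r) = r"
  by (simp_all add: make_dh_module_def hom_space.extend_def dh_module.fields_def)

lemma same_space_make_dh_module: "same_space (make_dh_module V a r) V"
  by (simp add: same_space_def make_dh_module_def hom_space.extend_def dh_module.fields_def)

lemma same_space_truncate: "same_space (hom_space.truncate V) V"
  by (simp add: same_space_def hom_space.truncate_def)

context hom_calculus
begin

section \<open>Inverting the structure map\<close>

lemma alpha_inv_simps:
  assumes "hom_space K V" "alpha_bij V"
  shows "v \<in> carrier V \<Longrightarrow> alpha_inv V v \<in> carrier V"
    "v \<in> carrier V \<Longrightarrow> alpha V (alpha_inv V v) = v"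
    "v \<in> carrier V \<Longrightarrow> alpha_inv V (alpha V v) = v"
    "linear_map K V V (alpha_inv V)"
    "linear_map K U V f \<Longrightarrow> linear_map K U V (\<lambda>x. alpha_inv V (f x))"
proof -
  have inj: "inj_on (alpha V) (carrier V)" and im: "alpha V ` carrier V = carrier V"
    using assms(2) by (auto simp: bij_betw_def)
  show cl: "alpha_inv V v \<in> carrier V" if "v \<in> carrier V" for v
    using that im inv_into_into[of v "alpha V" "carrier V"] by simp
  show r: "alpha V (alpha_inv V v) = v" if "v \<in> carrier V" for v
    using that im f_inv_into_f[of v "alpha V" "carrier V"] by simp
  show l: "alpha_inv V (alpha V v) = v" if "v \<in> carrier V" for v
    using that inj by simp
  note a = hom_space_alpha_linear[OF assms(1)]
  interpret V: module K V using assms(1) by simp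
  show "linear_map K V V (alpha_inv V)"
  proof (rule linear_mapI)
    fix x y assume xy: "x \<in> carrier V" "y \<in> carrier V"
    have "alpha_inv V (x \<oplus>\<^bsub>V\<^esub> y) = alpha_inv V (alpha V (alpha_inv V x) \<oplus>\<^bsub>V\<^esub> alpha V (alpha_inv V y))"
      using xy r by simp
    also have "\<dots> = alpha_inv V (alpha V (alpha_inv V x \<oplus>\<^bsub>V\<^esub> alpha_inv V y))"
      using xy cl by (simp add: linear_map_add[OF a])
    finally show "alpha_inv V (x \<oplus>\<^bsub>V\<^esub> y) = alpha_inv V x \<oplus>\<^bsub>V\<^esub> alpha_inv V y"
      using xy cl l by simp
  next
    fix k x assume kx: "k \<in> carrier K" "x \<in> carrier V"
    have "alpha_inv V (k \<odot>\<^bsub>V\<^esub> x) = alpha_inv V (k \<odot>\<^bsub>V\<^esub> alpha V (alpha_inv V x))"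
      using kx r by simp
    also have "\<dots> = alpha_inv V (alpha V (k \<odot>\<^bsub>V\<^esub> alpha_inv V x))"
      using kx cl by (simp add: linear_map_smult[OF a])
    finally show "alpha_inv V (k \<odot>\<^bsub>V\<^esub> x) = k \<odot>\<^bsub>V\<^esub> alpha_inv V x"
      using kx cl l by simp
  qed (rule cl)
  then show "linear_map K U V (\<lambda>x. alpha_inv V (f x))" if "linear_map K U V f"
    by (rule linear_map_compose[OF that])
qed

lemma alpha_inv_eqI:
  "hom_space K V \<Longrightarrow> alpha_bij V \<Longrightarrow> x \<in> carrier V \<Longrightarrow> y = alpha V x \<Longrightarrow> alpha_inv V y = x"
  by (simp add: alpha_inv_simps)

lemma alpha_inv_mult:
  assumes "hom_algebra K A" "alpha_bij A" "a \<in> carrier A" "b \<in> carrier A"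
  shows "alpha_inv A (a \<otimes>\<^bsub>A\<^esub> b) = alpha_inv A a \<otimes>\<^bsub>A\<^esub> alpha_inv A b"
proof -
  note h = hom_algebraD[OF assms(1)]
  note [simp] = h alpha_inv_simps[OF h(1) assms(2)] assms(3,4)
  show ?thesis by (rule alpha_inv_eqI[OF h(1) assms(2)]) simp_all
qed

lemma alpha_inv_one:
  assumes "hom_algebra K A" "alpha_bij A"
  shows "alpha_inv A \<one>\<^bsub>A\<^esub> = \<one>\<^bsub>A\<^esub>"
  using hom_algebraD[OF assms(1)] alpha_inv_eqI assms(2) by metis

lemma alpha_inv_coalgebra:
  assumes "hom_coalgebra K C" "alpha_bij C" "c \<in> carrier C"
  shows "counit C (alpha_inv C c) = counit C c"
    and sw_comul_alpha_inv: "hom_space K X \<Longrightarrow> bilinear_map K C C X g \<Longrightarrow>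
      sw K C C X (comul C (alpha_inv C c)) g = sw K C C X (comul C c) (\<lambda>x y. g (alpha_inv C x) (alpha_inv C y))"
proof -
  note h = hom_coalgebraD[OF assms(1)]
  note [simp] = h alpha_inv_simps[OF h(1) assms(2)] assms(3)
  show "counit C (alpha_inv C c) = counit C c" using h(7)[of "alpha_inv C c"] by simp
  assume X [simp]: "hom_space K X" and g: "bilinear_map K C C X g"
  have lg [simp]: "linear_map K V X (\<lambda>x. g (f x) w)" "linear_map K V X (\<lambda>x. g w (f x))"
    if "w \<in> carrier C" "linear_map K V C f" for V w f
    by (rule linear_map_compose[OF that(2)] bilinear_mapD[OF g] that(1))+
  have "sw K C C X (comul C (alpha C (alpha_inv C c))) (\<lambda>x y. g (alpha_inv C x) (alpha_inv C y)) =
    sw K C C X (comul C (alpha_inv C c)) (\<lambda>x y. g (alpha_inv C (alpha C x)) (alpha_inv C (alpha C y)))"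
    by (rule sw_comul_alpha[OF assms(1)]) simp_all
  then show "sw K C C X (comul C (alpha_inv C c)) g = sw K C C X (comul C c) (\<lambda>x y. g (alpha_inv C x) (alpha_inv C y))"
    by simp
qed

end

lemma same_space_sel:
  "same_space P T \<Longrightarrow> carrier P = carrier T"
  "same_space P T \<Longrightarrow> add P = add T"
  "same_space P T \<Longrightarrow> zero P = zero T"
  "same_space P T \<Longrightarrow> smult P = smult T"
  "same_space P T \<Longrightarrow> alpha P = alpha T"
  by (simp_all add: same_space_def)

text \<open>With \<open>P\<close> a Doi-Hopf module and \<open>T\<close> the Hom-space it was built on, these rules replace \<open>P\<close>
  by \<open>T\<close> everywhere except in the action and the coaction.\<close>

lemmas same_space_rules = same_space_sel same_space_hom_space
  same_space_tensor[OF _ same_space_refl] same_space_tensor[OF same_space_refl]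
  same_space_tens(2)[OF _ same_space_refl] same_space_tens(2)[OF same_space_refl]
  same_space_sw[OF _ same_space_refl same_space_refl] same_space_sw[OF same_space_refl _ same_space_refl]
  same_space_sw[OF same_space_refl same_space_refl]
  same_space_linear_map[OF _ same_space_refl] same_space_linear_map[OF same_space_refl]

context hom_calculus
begin

lemma tensor_ext':
  "hom_space K V \<Longrightarrow> hom_space K W \<Longrightarrow> t \<in> carrier (tensor K V W) \<Longrightarrow>
    linear_map K (tensor K V W) X f \<Longrightarrow> linear_map K (tensor K V W) X g \<Longrightarrow>
    (\<And>v w. v \<in> carrier V \<Longrightarrow> w \<in> carrier W \<Longrightarrow> f (tens K V W v w) = g (tens K V W v w)) \<Longrightarrow> f t = g t"
  by (rule tensor_ext[of K V W X f g]) simp_all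

text \<open>The right-hand sides of coassociativity contain \<open>x \<otimes> \<Delta>(c)\<close>; expanding \<open>\<Delta>(c)\<close> into its own
  Sweedler sum gives such a term the same shape as the left-hand sides.\<close>

lemma tens_comul [simp]:
  assumes "hom_coalgebra K C" "hom_space K M" "x \<in> carrier M" "c \<in> carrier C"
  shows "tens K M (tensor K C C) x (comul C c) =
    sw K C C (tensor K M (tensor K C C)) (comul C c) (\<lambda>y z. tens K M (tensor K C C) x (tens K C C y z))"
proof -
  note [simp] = hom_coalgebraD[OF assms(1)] assms(2-4)
  have "comul C c = sw K C C (tensor K C C) (comul C c) (tens K C C)"
    by (rule sw_tens_eq_self[symmetric]) simp_all
  then have "tens K M (tensor K C C) x (comul C c) =
      tens K M (tensor K C C) x (sw K C C (tensor K C C) (comul C c) (tens K C C))" by simp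
  also have "\<dots> = sw K C C (tensor K M (tensor K C C)) (comul C c) (\<lambda>y z. tens K M (tensor K C C) x (tens K C C y z))"
    by (rule tens_sw_right) simp_all
  finally show ?thesis .
qed

lemma smult_assoc [simp]:
  "hom_space K X \<Longrightarrow> k \<in> carrier K \<Longrightarrow> l \<in> carrier K \<Longrightarrow> x \<in> carrier X \<Longrightarrow>
    (k \<otimes>\<^bsub>K\<^esub> l) \<odot>\<^bsub>X\<^esub> x = k \<odot>\<^bsub>X\<^esub> (l \<odot>\<^bsub>X\<^esub> x)"
  by (meson hom_space_module module.smult_assoc1)

lemma smult_one [simp]: "hom_space K X \<Longrightarrow> x \<in> carrier X \<Longrightarrow> \<one>\<^bsub>K\<^esub> \<odot>\<^bsub>X\<^esub> x = x"
  by (meson hom_space_module module.smult_one)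

lemma hom_moduleD:
  assumes "hom_module K A M ac"
  shows "hom_space K M" "bilinear_map K A M M ac"
    "a \<in> carrier A \<Longrightarrow> m \<in> carrier M \<Longrightarrow> ac a m \<in> carrier M"
    "m \<in> carrier M \<Longrightarrow> linear_map K V A f \<Longrightarrow> linear_map K V M (\<lambda>x. ac (f x) m)"
    "a \<in> carrier A \<Longrightarrow> linear_map K V M g \<Longrightarrow> linear_map K V M (\<lambda>x. ac a (g x))"
    "a \<in> carrier A \<Longrightarrow> linear_map K M M (ac a)"
    "m \<in> carrier M \<Longrightarrow> ac \<one>\<^bsub>A\<^esub> m = alpha M m"
    "a \<in> carrier A \<Longrightarrow> m \<in> carrier M \<Longrightarrow> alpha M (ac a m) = ac (alpha A a) (alpha M m)"
    "a \<in> carrier A \<Longrightarrow> b \<in> carrier A \<Longrightarrow> m \<in> carrier M \<Longrightarrow>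
       ac (alpha A a) (ac b m) = ac (a \<otimes>\<^bsub>A\<^esub> b) (alpha M m)"
proof -
  note h = assms[unfolded hom_module_def]
  have b: "bilinear_map K A M M ac" using h by blast
  show "hom_space K M" "bilinear_map K A M M ac"
    "m \<in> carrier M \<Longrightarrow> ac \<one>\<^bsub>A\<^esub> m = alpha M m"
    "a \<in> carrier A \<Longrightarrow> m \<in> carrier M \<Longrightarrow> alpha M (ac a m) = ac (alpha A a) (alpha M m)"
    "a \<in> carrier A \<Longrightarrow> b \<in> carrier A \<Longrightarrow> m \<in> carrier M \<Longrightarrow>
       ac (alpha A a) (ac b m) = ac (a \<otimes>\<^bsub>A\<^esub> b) (alpha M m)"
    using h by blast+
  show "a \<in> carrier A \<Longrightarrow> m \<in> carrier M \<Longrightarrow> ac a m \<in> carrier M"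
    by (rule bilinear_map_closed[OF b])
  show "m \<in> carrier M \<Longrightarrow> linear_map K V A f \<Longrightarrow> linear_map K V M (\<lambda>x. ac (f x) m)"
    by (rule linear_map_compose[OF _ bilinear_mapD(2)[OF b]])
  show "a \<in> carrier A \<Longrightarrow> linear_map K V M g \<Longrightarrow> linear_map K V M (\<lambda>x. ac a (g x))"
    by (rule linear_map_compose[OF _ bilinear_mapD(1)[OF b]])
  show "a \<in> carrier A \<Longrightarrow> linear_map K M M (ac a)"
    by (rule bilinear_mapD(1)[OF b])
qed

end

section \<open>Monoidal Doi-Hopf data\<close>

text \<open>The components of a datum are kept as separate parameters, so that two data that share \<open>H\<close>
  and \<open>C\<close> share all facts about them.\<close>

locale doi_datum = hom_calculus K for K :: "('k, 'r) ring_scheme" +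
  fixes H :: "('k, 'h) hom_bialg" and A :: "('k, 'a) hom_bialg" and C :: "('k, 'c) hom_bialg"
    and co :: "'a \<Rightarrow> ('a \<times> 'h \<Rightarrow> 'k) set" and ac :: "'h \<Rightarrow> 'c \<Rightarrow> 'c"
  assumes monoidal: "monoidal_datum K \<lparr>datum_H = H, datum_A = A, datum_C = C, datum_coact = co, datum_act = ac\<rparr>"
    and bij_A: "alpha_bij A" and bij_C: "alpha_bij C"
begin

abbreviation D :: "('k, 'h, 'a, 'c) datum" where
  "D \<equiv> \<lparr>datum_H = H, datum_A = A, datum_C = C, datum_coact = co, datum_act = ac\<rparr>"

abbreviation ai :: "'c \<Rightarrow> 'c" where "ai \<equiv> alpha_inv C"

lemmas monoidal_unfolded = monoidal[unfolded monoidal_datum_def Let_def doi_hopf_datum_def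
    comodule_algebra_def module_coalgebra_def datum.simps]

lemma bialgebras: "hom_bialgebra K H" "hom_bialgebra K A" "hom_bialgebra K C"
  using monoidal_unfolded by (auto simp: hom_hopf_algebra_def)

lemmas H_bialg [simp] = hom_bialgebraD[OF bialgebras(1)]
lemmas A_bialg [simp] = hom_bialgebraD[OF bialgebras(2)]
lemmas C_bialg [simp] = hom_bialgebraD[OF bialgebras(3)]
lemmas H_alg [simp] = hom_algebraD[OF H_bialg(1)]
lemmas A_alg [simp] = hom_algebraD[OF A_bialg(1)]
lemmas C_alg [simp] = hom_algebraD[OF C_bialg(1)]
lemmas H_coalg [simp] = hom_coalgebraD[OF H_bialg(2)]
lemmas A_coalg [simp] = hom_coalgebraD[OF A_bialg(2)]
lemmas C_coalg [simp] = hom_coalgebraD[OF C_bialg(2)]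
lemmas H_comul [simp] = sw_comul_alpha[OF H_bialg(2)] sw_counit[OF H_bialg(2)] sw_comul_mult[OF bialgebras(1)]
lemmas A_comul [simp] = sw_comul_alpha[OF A_bialg(2)] sw_counit[OF A_bialg(2)] sw_comul_mult[OF bialgebras(2)]
lemmas C_comul [simp] = sw_comul_alpha[OF C_bialg(2)] sw_counit[OF C_bialg(2)] sw_comul_mult[OF bialgebras(3)]
lemmas ai_simps [simp] = alpha_inv_simps[OF C_alg(1) bij_C] alpha_inv_mult[OF C_bialg(1) bij_C]
  alpha_inv_one[OF C_bialg(1) bij_C] alpha_inv_coalgebra[OF C_bialg(2) bij_C]
lemmas aiA_simps [simp] = alpha_inv_simps[OF A_alg(1) bij_A] alpha_inv_mult[OF A_bialg(1) bij_A]
  alpha_inv_one[OF A_bialg(1) bij_A] alpha_inv_coalgebra[OF A_bialg(2) bij_A]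

lemma co_comodule: "hom_comodule K H A co"
  and ac_module: "hom_module K H C ac"
  using monoidal_unfolded by blast+

lemmas co_simps [simp] = hom_comoduleD(2-4)[OF co_comodule]
  sw_comodule(1,2)[OF H_bialg(2) co_comodule]
lemmas co_coassoc = sw_coact_coassoc[OF H_bialg(2) co_comodule]
lemmas ac_simps [simp] = hom_moduleD(3-8)[OF ac_module]
lemmas ac_assoc = hom_moduleD(9)[OF ac_module]

lemma co_one [simp]: "co \<one>\<^bsub>A\<^esub> = tens K A H \<one>\<^bsub>A\<^esub> \<one>\<^bsub>H\<^esub>"
  using monoidal_unfolded by blast

lemma sw_co_mult [simp]:
  assumes "hom_space K X" "bilinear_map K A H X f" "a \<in> carrier A" "b \<in> carrier A"
  shows "sw K A H X (co (a \<otimes>\<^bsub>A\<^esub> b)) f =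
      sw K A H X (co a) (\<lambda>a0 a1. sw K A H X (co b) (\<lambda>b0 b1. f (a0 \<otimes>\<^bsub>A\<^esub> b0) (a1 \<otimes>\<^bsub>H\<^esub> b1)))"
proof -
  have "co (a \<otimes>\<^bsub>A\<^esub> b) = tensor_mult K A H (co a) (co b)"
    using monoidal_unfolded assms(3,4) by blast
  then show ?thesis
    using tensor_mult_sw(2)[OF A_bialg(1) H_bialg(1) assms(1) co_simps(3) co_simps(3) assms(2)] assms(3,4)
    by metis
qed

lemma sw_comul_ac [simp]:
  assumes "hom_space K X" "bilinear_map K C C X f" "h \<in> carrier H" "c \<in> carrier C"
  shows "sw K C C X (comul C (ac h c)) f =
      sw K H H X (comul H h) (\<lambda>h1 h2. sw K C C X (comul C c) (\<lambda>c1 c2. f (ac h1 c1) (ac h2 c2)))"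
proof -
  have "comul C (ac h c) = sweedler K (tensor K C C) (comul H h) (\<lambda>h1 h2.
            sweedler K (tensor K C C) (comul C c) (\<lambda>c1 c2. tens K C C (ac h1 c1) (ac h2 c2)))"
    using monoidal_unfolded assms(3,4) by blast
  also have "\<dots> = sw K H H (tensor K C C) (comul H h) (\<lambda>h1 h2.
            sw K C C (tensor K C C) (comul C c) (\<lambda>c1 c2. tens K C C (ac h1 c1) (ac h2 c2)))"
    by (intro sweedler_eqI) (use assms(3,4) in simp_all)
  finally show ?thesis using assms by simp
qed

lemma counit_ac [simp]: "h \<in> carrier H \<Longrightarrow> c \<in> carrier C \<Longrightarrow> counit C (ac h c) = counit H h \<otimes>\<^bsub>K\<^esub> counit C c"
  using monoidal_unfolded by blast

text \<open>The map \<open>\<alpha>\<^sub>H\<close> need not be invertible, so \<open>\<alpha>\<^sub>C\<^sup>-\<^sup>1\<close> can be moved past the action only where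
  \<open>\<alpha>\<^sub>H\<close> has been applied.\<close>

lemma ai_ac [simp]: "h \<in> carrier H \<Longrightarrow> c \<in> carrier C \<Longrightarrow> ai (ac (alpha H h) c) = ac h (ai c)"
  by (rule alpha_inv_eqI[OF C_alg(1) bij_C]) simp_all

lemma sw_monoidal:
  assumes X: "hom_space K X" and k: "trilinear_map A A C X k"
    and a: "a \<in> carrier A" "c \<in> carrier C" "d \<in> carrier C"
  shows "sw K A H X (co a) (\<lambda>a0 a1. sw K A A X (comul A a0) (\<lambda>x y. k x y (ac (alpha H (alpha H a1)) (c \<otimes>\<^bsub>C\<^esub> d)))) =
    sw K A A X (comul A a) (\<lambda>a1 a2. sw K A H X (co a1) (\<lambda>x a11. sw K A H X (co a2) (\<lambda>y a21.
      k x y (ac a11 c \<otimes>\<^bsub>C\<^esub> ac a21 d))))"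
proof -
  let ?T = "tensor K A (tensor K A C)"
  have "sweedler K ?T (co a) (\<lambda>a0 a1. sweedler K ?T (comul A a0) (\<lambda>a01 a02.
            tens K A (tensor K A C) a01 (tens K A C a02 (ac (alpha H (alpha H a1)) (c \<otimes>\<^bsub>C\<^esub> d))))) =
    sweedler K ?T (comul A a) (\<lambda>a1 a2. sweedler K ?T (co a1) (\<lambda>a10 a11. sweedler K ?T (co a2) (\<lambda>a20 a21.
              tens K A (tensor K A C) a10 (tens K A C a20 (ac a11 c \<otimes>\<^bsub>C\<^esub> ac a21 d)))))"
    using monoidal_unfolded a by blast
  moreover have "sweedler K ?T (co a) (\<lambda>a0 a1. sweedler K ?T (comul A a0) (\<lambda>a01 a02.
            tens K A (tensor K A C) a01 (tens K A C a02 (ac (alpha H (alpha H a1)) (c \<otimes>\<^bsub>C\<^esub> d))))) =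
     sw K A H ?T (co a) (\<lambda>a0 a1. sw K A A ?T (comul A a0) (\<lambda>a01 a02.
            tens K A (tensor K A C) a01 (tens K A C a02 (ac (alpha H (alpha H a1)) (c \<otimes>\<^bsub>C\<^esub> d)))))"
    by (intro sweedler_eqI) (use a in simp_all)
  moreover have "sweedler K ?T (comul A a) (\<lambda>a1 a2. sweedler K ?T (co a1) (\<lambda>a10 a11. sweedler K ?T (co a2) (\<lambda>a20 a21.
              tens K A (tensor K A C) a10 (tens K A C a20 (ac a11 c \<otimes>\<^bsub>C\<^esub> ac a21 d))))) =
    sw K A A ?T (comul A a) (\<lambda>a1 a2. sw K A H ?T (co a1) (\<lambda>a10 a11. sw K A H ?T (co a2) (\<lambda>a20 a21.
              tens K A (tensor K A C) a10 (tens K A C a20 (ac a11 c \<otimes>\<^bsub>C\<^esub> ac a21 d)))))"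
    by (intro sweedler_eqI) (use a in simp_all)
  ultimately have "sw3 A A C X (sw K A H ?T (co a) (\<lambda>a0 a1. sw K A A ?T (comul A a0) (\<lambda>a01 a02.
            tens K A (tensor K A C) a01 (tens K A C a02 (ac (alpha H (alpha H a1)) (c \<otimes>\<^bsub>C\<^esub> d)))))) k =
      sw3 A A C X (sw K A A ?T (comul A a) (\<lambda>a1 a2. sw K A H ?T (co a1) (\<lambda>a10 a11. sw K A H ?T (co a2) (\<lambda>a20 a21.
              tens K A (tensor K A C) a10 (tens K A C a20 (ac a11 c \<otimes>\<^bsub>C\<^esub> ac a21 d)))))) k"
    by simp
  then show ?thesis using X k a unfolding sw3_def trilinear_map_def by simp
qed

end

section \<open>Doi-Hopf modules\<close>

context doi_datum
begin

lemma dh_compat_iff: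
  assumes "hom_module K A M (act M)" "hom_comodule K C M (coact M)" and [simp]: "a \<in> carrier A" "m \<in> carrier M"
  shows "sweedler K (tensor K M C) (co a) (\<lambda>a0 a1. sweedler K (tensor K M C) (coact M m) (\<lambda>m0 m1.
            tens K M C (act M a0 m0) (ac a1 m1))) =
    sw K A H (tensor K M C) (co a) (\<lambda>a0 a1. sw K M C (tensor K M C) (coact M m) (\<lambda>m0 m1.
            tens K M C (act M a0 m0) (ac a1 m1)))"
proof -
  note [simp] = hom_moduleD[OF assms(1)] hom_comoduleD[OF assms(2)]
  show ?thesis by (intro sweedler_eqI) simp_all
qed

lemma doi_hopf_moduleI:
  assumes "hom_space K M" "bilinear_map K A M M (act M)" "linear_map K M (tensor K M C) (coact M)"
    and "\<And>m. m \<in> carrier M \<Longrightarrow> act M \<one>\<^bsub>A\<^esub> m = alpha M m"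
    and "\<And>a m. a \<in> carrier A \<Longrightarrow> m \<in> carrier M \<Longrightarrow> alpha M (act M a m) = act M (alpha A a) (alpha M m)"
    and "\<And>a b m. a \<in> carrier A \<Longrightarrow> b \<in> carrier A \<Longrightarrow> m \<in> carrier M \<Longrightarrow>
       act M (alpha A a) (act M b m) = act M (a \<otimes>\<^bsub>A\<^esub> b) (alpha M m)"
    and "\<And>m. m \<in> carrier M \<Longrightarrow> sw K M C M (coact M m) (\<lambda>m0 m1. counit C m1 \<odot>\<^bsub>M\<^esub> m0) = alpha M m"
    and "\<And>m. m \<in> carrier M \<Longrightarrow> sw K M C (tensor K M C) (coact M m) (\<lambda>m0 m1. tens K M C (alpha M m0) (alpha C m1))
       = coact M (alpha M m)"
    and "\<And>m. m \<in> carrier M \<Longrightarrow>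
       sw K M C (tensor K M (tensor K C C)) (coact M m) (\<lambda>m0 m1. sw K M C (tensor K M (tensor K C C)) (coact M m0) (\<lambda>m00 m01.
         tens K M (tensor K C C) m00 (tens K C C m01 (alpha C m1)))) =
       sw K M C (tensor K M (tensor K C C)) (coact M m) (\<lambda>m0 m1. tens K M (tensor K C C) (alpha M m0) (comul C m1))"
    and "\<And>a m. a \<in> carrier A \<Longrightarrow> m \<in> carrier M \<Longrightarrow> coact M (act M a m) =
       sw K A H (tensor K M C) (co a) (\<lambda>a0 a1. sw K M C (tensor K M C) (coact M m) (\<lambda>m0 m1.
            tens K M C (act M a0 m0) (ac a1 m1)))"
  shows "doi_hopf_module K D M"
proof -
  have m: "hom_module K A M (act M)" using assms(1,2,4-6) unfolding hom_module_def by simp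
  have c: "hom_comodule K C M (coact M)"
    unfolding hom_comodule_iff[OF C_bialg(2) assms(1,3)]
    by (intro ballI conjI; (rule assms(7) assms(8) assms(9)); assumption)
  show ?thesis unfolding doi_hopf_module_def using m c dh_compat_iff[OF m c] assms(10) by simp
qed

lemma doi_hopf_moduleD:
  assumes "doi_hopf_module K D M"
  shows "hom_module K A M (act M)" "hom_comodule K C M (coact M)"
  using assms unfolding doi_hopf_module_def by simp_all

lemma sw_coact_act:
  assumes M: "doi_hopf_module K D M" and "hom_space K X" "bilinear_map K M C X f" "a \<in> carrier A" "m \<in> carrier M"
  shows "sw K M C X (coact M (act M a m)) f =
      sw K A H X (co a) (\<lambda>a0 a1. sw K M C X (coact M m) (\<lambda>m0 m1. f (act M a0 m0) (ac a1 m1)))"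
proof -
  note d = doi_hopf_moduleD[OF M]
  note [simp] = hom_moduleD[OF d(1)] hom_comoduleD[OF d(2)]
  have "coact M (act M a m) = sw K A H (tensor K M C) (co a) (\<lambda>a0 a1. sw K M C (tensor K M C) (coact M m) (\<lambda>m0 m1.
            tens K M C (act M a0 m0) (ac a1 m1)))"
    using M assms(4,5) dh_compat_iff[OF d assms(4,5)] unfolding doi_hopf_module_def by simp
  then show ?thesis using assms(2-5) by simp
qed

lemmas dh_module_facts = hom_moduleD[OF doi_hopf_moduleD(1)] hom_comoduleD(2-4)[OF doi_hopf_moduleD(2)]
  sw_comodule(1,2)[OF C_bialg(2) doi_hopf_moduleD(2)] sw_coact_act
lemmas dh_coassoc = sw_coact_coassoc[OF C_bialg(2) doi_hopf_moduleD(2)]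

lemma dh_action_sw:
  assumes M: "doi_hopf_module K D M" and "hom_space K V" "hom_space K W" "t \<in> carrier (tensor K V W)"
  shows "m \<in> carrier M \<Longrightarrow> (\<And>v w. v \<in> carrier V \<Longrightarrow> w \<in> carrier W \<Longrightarrow> f v w \<in> carrier A) \<Longrightarrow>
      act M (sw K V W A t f) m = sw K V W M t (\<lambda>v w. act M (f v w) m)"
    and "a \<in> carrier A \<Longrightarrow> (\<And>v w. v \<in> carrier V \<Longrightarrow> w \<in> carrier W \<Longrightarrow> g v w \<in> carrier M) \<Longrightarrow>
      act M a (sw K V W M t g) = sw K V W M t (\<lambda>v w. act M a (g v w))"
    and "(\<And>v w. v \<in> carrier V \<Longrightarrow> w \<in> carrier W \<Longrightarrow> g v w \<in> carrier M) \<Longrightarrow>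
      coact M (sw K V W M t g) = sw K V W (tensor K M C) t (\<lambda>v w. coact M (g v w))"
proof -
  note [simp] = dh_module_facts[OF M] assms(2-4)
  show "act M (sw K V W A t f) m = sw K V W M t (\<lambda>v w. act M (f v w) m)"
    if "m \<in> carrier M" "\<And>v w. v \<in> carrier V \<Longrightarrow> w \<in> carrier W \<Longrightarrow> f v w \<in> carrier A"
    by (rule push_linear[where g = "\<lambda>a. act M a m"]) (use that in simp_all)
  show "act M a (sw K V W M t g) = sw K V W M t (\<lambda>v w. act M a (g v w))"
    if "a \<in> carrier A" "\<And>v w. v \<in> carrier V \<Longrightarrow> w \<in> carrier W \<Longrightarrow> g v w \<in> carrier M"
    by (rule push_linear[where g = "act M a"]) (use that in simp_all)
  show "coact M (sw K V W M t g) = sw K V W (tensor K M C) t (\<lambda>v w. coact M (g v w))"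
    if "\<And>v w. v \<in> carrier V \<Longrightarrow> w \<in> carrier W \<Longrightarrow> g v w \<in> carrier M"
    by (rule push_linear[where g = "coact M"]) (use that in simp_all)
qed

section \<open>Morphisms of Doi-Hopf modules\<close>

lemma doi_hopf_map_iff:
  assumes M: "doi_hopf_module K D M" and N: "doi_hopf_module K D N" and f: "linear_map K M N f"
  shows "doi_hopf_map K D M N f \<longleftrightarrow>
     (\<forall>m\<in>carrier M. f (alpha M m) = alpha N (f m)) \<and>
     (\<forall>a\<in>carrier A. \<forall>m\<in>carrier M. f (act M a m) = act N a (f m)) \<and>
     (\<forall>m\<in>carrier M. coact N (f m) = sw K M C (tensor K N C) (coact M m) (\<lambda>m0 m1. tens K N C (f m0) m1))"
proof -
  note [simp] = dh_module_facts[OF M] dh_module_facts[OF N] f linear_map_facts[OF f]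
  have "sweedler K (tensor K N C) (coact M m) (\<lambda>m0 m1. tens K N C (f m0) m1) =
      sw K M C (tensor K N C) (coact M m) (\<lambda>m0 m1. tens K N C (f m0) m1)" if "m \<in> carrier M" for m
    by (rule sweedler_eqI) (use that in simp_all)
  then show ?thesis using f unfolding doi_hopf_map_def by auto
qed

lemma sw_coact_map:
  assumes M: "doi_hopf_module K D M" and N: "doi_hopf_module K D N" and f: "doi_hopf_map K D M N f"
    and [simp]: "hom_space K X" and g: "bilinear_map K N C X g" and [simp]: "m \<in> carrier M"
  shows "sw K N C X (coact N (f m)) g = sw K M C X (coact M m) (\<lambda>m0 m1. g (f m0) m1)"
proof -
  have lf: "linear_map K M N f" using f unfolding doi_hopf_map_def by blast
  note [simp] = dh_module_facts[OF M] dh_module_facts[OF N] lf linear_map_facts[OF lf]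
  have "coact N (f m) = sw K M C (tensor K N C) (coact M m) (\<lambda>m0 m1. tens K N C (f m0) m1)"
    using f unfolding doi_hopf_map_iff[OF M N lf] by simp
  then show ?thesis using g by simp
qed

lemma linear_map_inverse:
  assumes V: "hom_space K V" and W: "hom_space K W" and f: "linear_map K V W f"
    and g: "\<And>w. w \<in> carrier W \<Longrightarrow> g w \<in> carrier V"
    and fg: "\<And>w. w \<in> carrier W \<Longrightarrow> f (g w) = w" and gf: "\<And>v. v \<in> carrier V \<Longrightarrow> g (f v) = v"
  shows "linear_map K W V g"
proof (rule linear_mapI)
  interpret V: module K V using V by simp
  fix x y assume xy: "x \<in> carrier W" "y \<in> carrier W"
  have "g (x \<oplus>\<^bsub>W\<^esub> y) = g (f (g x) \<oplus>\<^bsub>W\<^esub> f (g y))" using xy fg by simp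
  also have "\<dots> = g (f (g x \<oplus>\<^bsub>V\<^esub> g y))" using xy g by (simp add: linear_map_add[OF f])
  finally show "g (x \<oplus>\<^bsub>W\<^esub> y) = g x \<oplus>\<^bsub>V\<^esub> g y" using xy g gf by simp
next
  fix k x assume kx: "k \<in> carrier K" "x \<in> carrier W"
  have "g (k \<odot>\<^bsub>W\<^esub> x) = g (k \<odot>\<^bsub>W\<^esub> f (g x))" using kx fg by simp
  also have "\<dots> = g (f (k \<odot>\<^bsub>V\<^esub> g x))" using kx g by (simp add: linear_map_smult[OF f])
  finally show "g (k \<odot>\<^bsub>W\<^esub> x) = k \<odot>\<^bsub>V\<^esub> g x" using kx g gf V by simp
qed (rule g)

text \<open>A bijective morphism is an isomorphism, so only one of the two directions of an isomorphism
  has to be compatible with the structure.\<close>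

lemma doi_hopf_isoI:
  assumes M: "doi_hopf_module K D M" and N: "doi_hopf_module K D N" and f: "doi_hopf_map K D M N f"
    and g: "\<And>n. n \<in> carrier N \<Longrightarrow> g n \<in> carrier M"
    and fg: "\<And>n. n \<in> carrier N \<Longrightarrow> f (g n) = n" and gf: "\<And>m. m \<in> carrier M \<Longrightarrow> g (f m) = m"
  shows "doi_hopf_iso K D M N"
proof -
  have lf: "linear_map K M N f" using f unfolding doi_hopf_map_def by blast
  have lg: "linear_map K N M g"
    by (rule linear_map_inverse[OF _ _ lf g fg gf]) (simp_all add: dh_module_facts[OF M] dh_module_facts[OF N])
  note [simp] = dh_module_facts[OF M] dh_module_facts[OF N] lf linear_map_facts[OF lf]
     lg linear_map_compose[OF _ lg] fg gf g
  note fi = f[unfolded doi_hopf_map_iff[OF M N lf], rule_format]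
  have fa [simp]: "f (alpha M m) = alpha N (f m)" if "m \<in> carrier M" for m using fi that by blast
  have ft [simp]: "f (act M a m) = act N a (f m)" if "a \<in> carrier A" "m \<in> carrier M" for a m using fi that by blast
  have "doi_hopf_map K D N M g"
    unfolding doi_hopf_map_iff[OF N M lg]
  proof (intro conjI ballI)
    fix n assume n [simp]: "n \<in> carrier N"
    have "g (alpha N n) = g (f (alpha M (g n)))" by (subst fa) simp_all
    also have "\<dots> = alpha M (g n)" by (rule gf) simp
    finally show "g (alpha N n) = alpha M (g n)" .
    { fix a assume [simp]: "a \<in> carrier A"
      have "g (act N a n) = g (f (act M a (g n)))" by (subst ft) simp_all
      also have "\<dots> = act M a (g n)" by (rule gf) simp
      finally show "g (act N a n) = act M a (g n)" . }
    have "sw K N C (tensor K M C) (coact N (f (g n))) (\<lambda>m0 m1. tens K M C (g m0) m1) =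
       sw K M C (tensor K M C) (coact M (g n)) (\<lambda>m0 m1. tens K M C (g (f m0)) m1)"
      by (rule sw_coact_map[OF M N f]) simp_all
    also have "\<dots> = coact M (g n)" by (simp add: sw_tens_eq_self)
    finally show "coact M (g n) = sw K N C (tensor K M C) (coact N n) (\<lambda>m0 m1. tens K M C (g m0) m1)" by simp
  qed
  then show ?thesis using M N f unfolding doi_hopf_iso_def by (blast intro: fg gf)
qed

lemma doi_hopf_isoE:
  assumes "doi_hopf_iso K D M N"
  obtains f g where "doi_hopf_module K D M" "doi_hopf_module K D N" "doi_hopf_map K D M N f" "doi_hopf_map K D N M g"
    "\<And>m. m \<in> carrier M \<Longrightarrow> g (f m) = m" "\<And>n. n \<in> carrier N \<Longrightarrow> f (g n) = n"
  using assms unfolding doi_hopf_iso_def by blast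

lemma doi_hopf_mapD:
  assumes f: "doi_hopf_map K D M N f"
  shows "linear_map K M N f" "m \<in> carrier M \<Longrightarrow> f m \<in> carrier N"
    "linear_map K V M h \<Longrightarrow> linear_map K V N (\<lambda>x. f (h x))"
    "m \<in> carrier M \<Longrightarrow> f (alpha M m) = alpha N (f m)"
    "a \<in> carrier A \<Longrightarrow> m \<in> carrier M \<Longrightarrow> f (act M a m) = act N a (f m)"
proof -
  show l: "linear_map K M N f" using f unfolding doi_hopf_map_def by blast
  show "m \<in> carrier M \<Longrightarrow> f m \<in> carrier N" by (rule linear_map_closed[OF l])
  show "linear_map K V M h \<Longrightarrow> linear_map K V N (\<lambda>x. f (h x))" by (rule linear_map_compose[OF _ l])
qed (use f in \<open>auto simp: doi_hopf_map_def\<close>)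

lemma doi_hopf_iso_sym: "doi_hopf_iso K D M N \<Longrightarrow> doi_hopf_iso K D N M"
  unfolding doi_hopf_iso_def by blast

lemma doi_hopf_iso_trans:
  assumes "doi_hopf_iso K D M N" "doi_hopf_iso K D N P" shows "doi_hopf_iso K D M P"
proof -
  obtain f g where MN: "doi_hopf_module K D M" "doi_hopf_module K D N" "doi_hopf_map K D M N f" "doi_hopf_map K D N M g"
    "\<And>m. m \<in> carrier M \<Longrightarrow> g (f m) = m" "\<And>n. n \<in> carrier N \<Longrightarrow> f (g n) = n"
    using doi_hopf_isoE[OF assms(1)] by metis
  obtain f' g' where NP: "doi_hopf_module K D N" "doi_hopf_module K D P" "doi_hopf_map K D N P f'" "doi_hopf_map K D P N g'"
    "\<And>m. m \<in> carrier N \<Longrightarrow> g' (f' m) = m" "\<And>n. n \<in> carrier P \<Longrightarrow> f' (g' n) = n"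
    using doi_hopf_isoE[OF assms(2)] by metis
  note [simp] = dh_module_facts[OF MN(1)] dh_module_facts[OF MN(2)] dh_module_facts[OF NP(2)]
     doi_hopf_mapD[OF MN(3)] doi_hopf_mapD[OF MN(4)] doi_hopf_mapD[OF NP(3)] doi_hopf_mapD[OF NP(4)]
     MN(5,6) NP(5,6)
  have l: "linear_map K M P (\<lambda>m. f' (f m))" by simp
  have "doi_hopf_map K D M P (\<lambda>m. f' (f m))"
    unfolding doi_hopf_map_iff[OF MN(1) NP(2) l]
  proof (intro conjI ballI)
    fix m assume [simp]: "m \<in> carrier M"
    have "coact P (f' (f m)) = sw K P C (tensor K P C) (coact P (f' (f m))) (tens K P C)"
      by (simp add: sw_tens_eq_self)
    also have "\<dots> = sw K N C (tensor K P C) (coact N (f m)) (\<lambda>x y. tens K P C (f' x) y)"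
      by (rule sw_coact_map[OF MN(2) NP(2,3)]) simp_all
    also have "\<dots> = sw K M C (tensor K P C) (coact M m) (\<lambda>x y. tens K P C (f' (f x)) y)"
      by (rule sw_coact_map[OF MN(1,2,3)]) simp_all
    finally show "coact P (f' (f m)) = sw K M C (tensor K P C) (coact M m) (\<lambda>x y. tens K P C (f' (f x)) y)" .
  qed simp_all
  then show ?thesis by (rule doi_hopf_isoI[OF MN(1) NP(2), where g = "\<lambda>p. g (g' p)"]) simp_all
qed

section \<open>The regular module\<close>

lemma dh_regular_sel:
  "same_space (dh_regular K D) A"
  "act (dh_regular K D) a = (\<lambda>b. alpha_inv A a \<otimes>\<^bsub>A\<^esub> b)"
  "a \<in> carrier A \<Longrightarrow> coact (dh_regular K D) a =
    sw K A H (tensor K A C) (co a) (\<lambda>a0 a1. tens K A C a0 (ac a1 \<one>\<^bsub>C\<^esub>))"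
proof -
  show "same_space (dh_regular K D) A" unfolding dh_regular_def Let_def
    using same_space_make_dh_module[of "hom_space.truncate A"] same_space_truncate[of A]
    by (simp add: same_space_def)
  show "act (dh_regular K D) a = (\<lambda>b. alpha_inv A a \<otimes>\<^bsub>A\<^esub> b)" by (simp add: dh_regular_def)
  assume a [simp]: "a \<in> carrier A"
  show "coact (dh_regular K D) a = sw K A H (tensor K A C) (co a) (\<lambda>a0 a1. tens K A C a0 (ac a1 \<one>\<^bsub>C\<^esub>))"
    unfolding dh_regular_def Let_def make_dh_module_sel datum.simps by (rule sweedler_eqI) simp_all
qed

lemma cring_K: "cring K"
  using hom_space_module[OF A_alg(1)] module.axioms(1) by blast

text \<open>Coassociativity of the coaction \<open>a\<^sub>0 \<otimes> a\<^sub>1 \<cdot> 1\<^sub>C\<close> reduces to that of the \<open>H\<close>-coaction on \<open>A\<close>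
  because \<open>\<Delta>(1\<^sub>C) = 1\<^sub>C \<otimes> 1\<^sub>C\<close>.\<close>

lemma doi_hopf_module_regular: "doi_hopf_module K D (dh_regular K D)"
proof -
  interpret K: cring K by (rule cring_K)
  note [simp] = dh_regular_sel(2,3) same_space_rules[OF dh_regular_sel(1)]
  show ?thesis
  proof (rule doi_hopf_moduleI, goal_cases)
    case 3
    have "linear_map K A (tensor K A C) (\<lambda>a. sw K A H (tensor K A C) (co a) (\<lambda>a0 a1. tens K A C a0 (ac a1 \<one>\<^bsub>C\<^esub>)))"
      by simp
    then show ?case using linear_map_cong[of K A "coact (dh_regular K D)" _ "tensor K A C"] by simp
  next
    case (6 a b m)
    then show ?case using hom_assoc[OF A_bialg(1), of "alpha_inv A a" "alpha_inv A b" m] by simp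
  next
    case (9 m)
    have "sw K A H (tensor K A (tensor K C C)) (co m) (\<lambda>x y. sw K A H (tensor K A (tensor K C C)) (co x) (\<lambda>x1 x2.
       tens K A (tensor K C C) x1 (tens K C C (ac x2 \<one>\<^bsub>C\<^esub>) (ac (alpha H y) \<one>\<^bsub>C\<^esub>)))) =
     sw K A H (tensor K A (tensor K C C)) (co m) (\<lambda>x y. sw K H H (tensor K A (tensor K C C)) (comul H y) (\<lambda>y1 y2.
       tens K A (tensor K C C) (alpha A x) (tens K C C (ac y1 \<one>\<^bsub>C\<^esub>) (ac y2 \<one>\<^bsub>C\<^esub>))))"
      by (rule co_coassoc) (use 9 in \<open>simp_all add: trilinear_map_def\<close>)
    then show ?case using 9 by simp
  next
    case (10 a m)
    \<comment> \<open>the action involves \<open>\<alpha>\<^sup>-\<^sup>1(a)\<close>, so \<open>\<rho>(a)\<close> is expressed by \<open>\<rho>(\<alpha>\<^sup>-\<^sup>1(a))\<close>\<close>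
    then have a: "a = alpha A (alpha_inv A a)" by simp
    show ?case by (subst (2) a) (use 10 in \<open>simp add: ac_assoc del: aiA_simps(2)\<close>)
  qed simp_all
qed

end

section \<open>The product of two Doi-Hopf modules\<close>

text \<open>Coassociativity of two coactions at once. The coaction on a product of modules and the one on
  \<open>F(M)\<close> are both formed from the coactions of the factors, and their coassociativity is this identity
  for a summand \<open>k\<close> that combines the corresponding legs.\<close>

lemma (in hom_calculus) sw_coact_coassoc_pair:
  assumes C: "hom_coalgebra K C" "hom_comodule K C M \<rho>" and E: "hom_coalgebra K E" "hom_comodule K E N \<sigma>"
    and X [simp]: "hom_space K X" and mn [simp]: "m \<in> carrier M" "n \<in> carrier N"
    and kM: "\<And>u v w. u \<in> carrier N \<Longrightarrow> v \<in> carrier E \<Longrightarrow> w \<in> carrier E \<Longrightarrow>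
       trilinear_map M C C X (\<lambda>x y z. k x y z u v w)"
    and kN: "\<And>x y z. x \<in> carrier M \<Longrightarrow> y \<in> carrier C \<Longrightarrow> z \<in> carrier C \<Longrightarrow> trilinear_map N E E X (k x y z)"
  shows "sw K M C X (\<rho> m) (\<lambda>m0 m1. sw K N E X (\<sigma> n) (\<lambda>n0 n1. sw K M C X (\<rho> m0) (\<lambda>m00 m01.
      sw K N E X (\<sigma> n0) (\<lambda>n00 n01. k m00 m01 (alpha C m1) n00 n01 (alpha E n1))))) =
    sw K M C X (\<rho> m) (\<lambda>m0 m1. sw K N E X (\<sigma> n) (\<lambda>n0 n1. sw K C C X (comul C m1) (\<lambda>y1 y2.
      sw K E E X (comul E n1) (\<lambda>z1 z2. k (alpha M m0) y1 y2 (alpha N n0) z1 z2))))"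
proof -
  note [simp] = hom_coalgebraD[OF C(1)] hom_coalgebraD[OF E(1)] hom_comoduleD[OF C(2)] hom_comoduleD[OF E(2)]
  have kc [simp]: "k x y z u v w \<in> carrier X"
    if "x \<in> carrier M" "y \<in> carrier C" "z \<in> carrier C" "u \<in> carrier N" "v \<in> carrier E" "w \<in> carrier E" for x y z u v w
    using kN[OF that(1-3)] that(4-6) unfolding trilinear_map_def by (auto dest: linear_map_closed)
  let ?g = "\<lambda>x y z. sw K N E X (\<sigma> n) (\<lambda>n0 n1. sw K E E X (comul E n1) (\<lambda>z1 z2. k x y z (alpha N n0) z1 z2))"
  have "sw K M C X (\<rho> m) (\<lambda>m0 m1. sw K N E X (\<sigma> n) (\<lambda>n0 n1. sw K M C X (\<rho> m0) (\<lambda>m00 m01.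
      sw K N E X (\<sigma> n0) (\<lambda>n00 n01. k m00 m01 (alpha C m1) n00 n01 (alpha E n1))))) =
    sw K M C X (\<rho> m) (\<lambda>m0 m1. sw K M C X (\<rho> m0) (\<lambda>m00 m01. sw K N E X (\<sigma> n) (\<lambda>n0 n1.
      sw K N E X (\<sigma> n0) (\<lambda>n00 n01. k m00 m01 (alpha C m1) n00 n01 (alpha E n1)))))"
    by (rule sw_cong[OF refl refl], rule sw_swap') simp_all
  also have "\<dots> = sw K M C X (\<rho> m) (\<lambda>m0 m1. sw K M C X (\<rho> m0) (\<lambda>m00 m01. ?g m00 m01 (alpha C m1)))"
    by (rule sw_cong[OF refl refl], rule sw_cong[OF refl refl], rule sw_coact_coassoc[OF E]) (simp_all add: kN)
  also have "\<dots> = sw K M C X (\<rho> m) (\<lambda>m0 m1. sw K C C X (comul C m1) (\<lambda>y1 y2. ?g (alpha M m0) y1 y2))"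
  proof (rule sw_coact_coassoc[OF C X mn(1)])
    show "trilinear_map M C C X ?g"
      using kM unfolding trilinear_map_def by simp
  qed
  also have "\<dots> = sw K M C X (\<rho> m) (\<lambda>m0 m1. sw K N E X (\<sigma> n) (\<lambda>n0 n1. sw K C C X (comul C m1) (\<lambda>y1 y2.
      sw K E E X (comul E n1) (\<lambda>z1 z2. k (alpha M m0) y1 y2 (alpha N n0) z1 z2))))"
    by (rule sw_cong[OF refl refl], rule sw_swap') simp_all
  finally show ?thesis .
qed

context doi_datum
begin

text \<open>The compatibility condition of a monoidal datum with \<open>c\<close> and \<open>d\<close> running over the \<open>C\<close>-legs of
  two tensors, typically \<open>\<rho>(m)\<close> and \<open>\<rho>(n)\<close>. The order of the sums is the one that results from
  expanding the coactions of \<open>a \<cdot> (m \<otimes> n)\<close>.\<close>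

lemma sw_monoidal_pair:
  assumes X [simp]: "hom_space K X" and a [simp]: "a \<in> carrier A"
    and U [simp]: "hom_space K U" "hom_space K W" and s [simp]: "s \<in> carrier (tensor K U C)" "r \<in> carrier (tensor K W C)"
    and k: "\<And>u w. u \<in> carrier U \<Longrightarrow> w \<in> carrier W \<Longrightarrow> trilinear_map A A C X (\<lambda>x y z. k x y u w z)"
  shows "sw K A H X (co a) (\<lambda>a0 a1. sw K U C X s (\<lambda>u u1. sw K W C X r (\<lambda>w w1. sw K A A X (comul A a0) (\<lambda>x y.
        k x y u w (ac (alpha H (alpha H a1)) (u1 \<otimes>\<^bsub>C\<^esub> w1)))))) =
    sw K A A X (comul A a) (\<lambda>a1 a2. sw K A H X (co a1) (\<lambda>x a11. sw K U C X s (\<lambda>u u1. sw K A H X (co a2) (\<lambda>y a21.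
      sw K W C X r (\<lambda>w w1. k x y u w (ac a11 u1 \<otimes>\<^bsub>C\<^esub> ac a21 w1))))))"
proof -
  have kc [simp]: "k x y u w z \<in> carrier X"
    if "x \<in> carrier A" "y \<in> carrier A" "z \<in> carrier C" "u \<in> carrier U" "w \<in> carrier W" for x y z u w
    using k[OF that(4,5)] that(1-3) unfolding trilinear_map_def by (auto dest: linear_map_closed)
  let ?l = "\<lambda>a0 a1 u u1 w w1. sw K A A X (comul A a0) (\<lambda>x y. k x y u w (ac (alpha H (alpha H a1)) (u1 \<otimes>\<^bsub>C\<^esub> w1)))"
  let ?k = "\<lambda>x a11 y a21 u u1 w w1. k x y u w (ac a11 u1 \<otimes>\<^bsub>C\<^esub> ac a21 w1)"
  note c = sw_cong[OF refl refl]
  have "sw K A H X (co a) (\<lambda>a0 a1. sw K U C X s (\<lambda>u u1. sw K W C X r (\<lambda>w w1. ?l a0 a1 u u1 w w1))) =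
     sw K U C X s (\<lambda>u u1. sw K A H X (co a) (\<lambda>a0 a1. sw K W C X r (\<lambda>w w1. ?l a0 a1 u u1 w w1)))"
    by (rule sw_swap') simp_all
  also have "\<dots> = sw K U C X s (\<lambda>u u1. sw K W C X r (\<lambda>w w1. sw K A H X (co a) (\<lambda>a0 a1. ?l a0 a1 u u1 w w1)))"
    by (rule c, rule sw_swap') simp_all
  also have "\<dots> = sw K U C X s (\<lambda>u u1. sw K W C X r (\<lambda>w w1. sw K A A X (comul A a) (\<lambda>a1 a2.
      sw K A H X (co a1) (\<lambda>x a11. sw K A H X (co a2) (\<lambda>y a21. ?k x a11 y a21 u u1 w w1)))))"
    by (rule c, rule c, rule sw_monoidal[OF X k]) simp_all
  also have "\<dots> = sw K U C X s (\<lambda>u u1. sw K A A X (comul A a) (\<lambda>a1 a2. sw K W C X r (\<lambda>w w1.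
      sw K A H X (co a1) (\<lambda>x a11. sw K A H X (co a2) (\<lambda>y a21. ?k x a11 y a21 u u1 w w1)))))"
    by (rule c, rule sw_swap') simp_all
  also have "\<dots> = sw K U C X s (\<lambda>u u1. sw K A A X (comul A a) (\<lambda>a1 a2. sw K A H X (co a1) (\<lambda>x a11.
      sw K W C X r (\<lambda>w w1. sw K A H X (co a2) (\<lambda>y a21. ?k x a11 y a21 u u1 w w1)))))"
    by (rule c, rule c, rule sw_swap') simp_all
  also have "\<dots> = sw K A A X (comul A a) (\<lambda>a1 a2. sw K U C X s (\<lambda>u u1. sw K A H X (co a1) (\<lambda>x a11.
      sw K W C X r (\<lambda>w w1. sw K A H X (co a2) (\<lambda>y a21. ?k x a11 y a21 u u1 w w1)))))"
    by (rule sw_swap') simp_all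
  also have "\<dots> = sw K A A X (comul A a) (\<lambda>a1 a2. sw K A H X (co a1) (\<lambda>x a11. sw K U C X s (\<lambda>u u1.
      sw K W C X r (\<lambda>w w1. sw K A H X (co a2) (\<lambda>y a21. ?k x a11 y a21 u u1 w w1)))))"
    by (rule c, rule sw_swap') simp_all
  also have "\<dots> = sw K A A X (comul A a) (\<lambda>a1 a2. sw K A H X (co a1) (\<lambda>x a11. sw K U C X s (\<lambda>u u1.
      sw K A H X (co a2) (\<lambda>y a21. sw K W C X r (\<lambda>w w1. ?k x a11 y a21 u u1 w w1)))))"
    by (rule c, rule c, rule c, rule sw_swap') simp_all
  finally show ?thesis .
qed

lemma dh_tensor_sel:
  assumes M: "doi_hopf_module K D M" and N: "doi_hopf_module K D N"
  shows "same_space (dh_tensor K D M N) (tensor K M N)"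
    and "a \<in> carrier A \<Longrightarrow> t \<in> carrier (tensor K M N) \<Longrightarrow> act (dh_tensor K D M N) a t =
      sw K A A (tensor K M N) (comul A a) (\<lambda>a1 a2. sw K M N (tensor K M N) t (\<lambda>m n. tens K M N (act M a1 m) (act N a2 n)))"
    and "t \<in> carrier (tensor K M N) \<Longrightarrow> coact (dh_tensor K D M N) t =
      sw K M N (tensor K (tensor K M N) C) t (\<lambda>m n.
        sw K M C (tensor K (tensor K M N) C) (coact M m) (\<lambda>m0 m1.
          sw K N C (tensor K (tensor K M N) C) (coact N n) (\<lambda>n0 n1.
            tens K (tensor K M N) C (tens K M N m0 n0) (ai (ai (m1 \<otimes>\<^bsub>C\<^esub> n1))))))"
proof -
  note [simp] = dh_module_facts[OF M] dh_module_facts[OF N]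
  show "same_space (dh_tensor K D M N) (tensor K M N)"
    unfolding dh_tensor_def Let_def by (rule same_space_make_dh_module)
  show "act (dh_tensor K D M N) a t =
      sw K A A (tensor K M N) (comul A a) (\<lambda>a1 a2. sw K M N (tensor K M N) t (\<lambda>m n. tens K M N (act M a1 m) (act N a2 n)))"
    if "a \<in> carrier A" "t \<in> carrier (tensor K M N)"
    unfolding dh_tensor_def Let_def make_dh_module_sel datum.simps
    by (intro sweedler_eqI) (use that in simp_all)
  show "coact (dh_tensor K D M N) t =
      sw K M N (tensor K (tensor K M N) C) t (\<lambda>m n.
        sw K M C (tensor K (tensor K M N) C) (coact M m) (\<lambda>m0 m1.
          sw K N C (tensor K (tensor K M N) C) (coact N n) (\<lambda>n0 n1.
            tens K (tensor K M N) C (tens K M N m0 n0) (ai (ai (m1 \<otimes>\<^bsub>C\<^esub> n1))))))"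
    if "t \<in> carrier (tensor K M N)"
    unfolding dh_tensor_def Let_def make_dh_module_sel datum.simps
    by (intro sweedler_eqI) (use that in \<open>simp_all del: ai_simps(6)\<close>)
qed

lemma dh_tensor_lin:
  assumes M: "doi_hopf_module K D M" and N: "doi_hopf_module K D N"
  shows "t \<in> carrier (tensor K M N) \<Longrightarrow> linear_map K A (tensor K M N) (\<lambda>a. act (dh_tensor K D M N) a t)"
    and "a \<in> carrier A \<Longrightarrow> linear_map K (tensor K M N) (tensor K M N) (act (dh_tensor K D M N) a)"
    and "linear_map K (tensor K M N) (tensor K (tensor K M N) C) (coact (dh_tensor K D M N))"
proof -
  note [simp] = dh_module_facts[OF M] dh_module_facts[OF N]
  note s = dh_tensor_sel[OF M N]
  show "linear_map K A (tensor K M N) (\<lambda>a. act (dh_tensor K D M N) a t)" if [simp]: "t \<in> carrier (tensor K M N)"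
    by (subst linear_map_cong[OF hom_space_module[OF A_alg(1)] s(2)]) simp_all
  show "linear_map K (tensor K M N) (tensor K M N) (act (dh_tensor K D M N) a)" if [simp]: "a \<in> carrier A"
    by (subst linear_map_cong[OF hom_space_module s(2)]) simp_all
  show "linear_map K (tensor K M N) (tensor K (tensor K M N) C) (coact (dh_tensor K D M N))"
    by (subst linear_map_cong[OF hom_space_module s(3)]) simp_all
qed

text \<open>All axioms are equations between maps that are linear in the tensor, hence are checked on \<open>m \<otimes> n\<close>.
  Coassociativity uses that \<open>\<Delta>\<^sub>C\<close> is multiplicative; compatibility of action and coaction is the
  compatibility condition of a monoidal datum.\<close>

theorem doi_hopf_module_tensor:
  assumes M: "doi_hopf_module K D M" and N: "doi_hopf_module K D N"
  shows "doi_hopf_module K D (dh_tensor K D M N)"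
proof -
  let ?P = "dh_tensor K D M N" and ?T = "tensor K M N"
  note s = dh_tensor_sel[OF M N] and l = dh_tensor_lin[OF M N]
  note [simp] = dh_module_facts[OF M] dh_module_facts[OF N] same_space_rules[OF s(1)] l
    linear_map_closed[OF l(2)] linear_map_closed[OF l(3)] linear_map_compose[OF _ l(1)]
    linear_map_compose[OF _ l(2)] linear_map_compose[OF _ l(3)]
  note ext = tensor_ext'[of M N]
  show ?thesis
  proof (rule doi_hopf_moduleI, goal_cases)
    case (4 t)
    then show ?case
      by (intro ext[where t = t and X = ?T and f = "act ?P \<one>\<^bsub>A\<^esub>"]) (simp_all add: s)
  next
    case (5 a t)
    then show ?case
      by (intro ext[where t = t and X = ?T and f = "\<lambda>t. alpha ?P (act ?P a t)"]) (simp_all add: s)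
  next
    case (6 a b t)
    then show ?case
      by (intro ext[where t = t and X = ?T and f = "\<lambda>t. act ?P (alpha A a) (act ?P b t)"]) (simp_all add: s)
  next
    case (7 t)
    then show ?case
      by (intro ext[where t = t and X = ?T and f = "\<lambda>t. sw K ?P C ?P (coact ?P t) (\<lambda>m0 m1. counit C m1 \<odot>\<^bsub>?P\<^esub> m0)"])
        (simp_all add: s)
  next
    case (8 t)
    then show ?case
      by (intro ext[where t = t and X = "tensor K ?T C" and g = "\<lambda>t. coact ?P (alpha ?P t)"]) (simp_all add: s)
  next
    case (9 t)
    then show ?case
    proof (intro ext[where t = t and X = "tensor K ?T (tensor K C C)" and f = "\<lambda>t. sw K ?P C (tensor K ?P (tensor K C C)) (coact ?P t) (\<lambda>m0 m1.
         sw K ?P C (tensor K ?P (tensor K C C)) (coact ?P m0) (\<lambda>m00 m01.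
         tens K ?P (tensor K C C) m00 (tens K C C m01 (alpha C m1))))"], goal_cases)
      case (6 m n)
      have "sw K M C (tensor K ?T (tensor K C C)) (coact M m) (\<lambda>m0 m1. sw K N C (tensor K ?T (tensor K C C)) (coact N n) (\<lambda>n0 n1.
         sw K M C (tensor K ?T (tensor K C C)) (coact M m0) (\<lambda>m00 m01.
         sw K N C (tensor K ?T (tensor K C C)) (coact N n0) (\<lambda>n00 n01.
           tens K ?T (tensor K C C) (tens K M N m00 n00) (tens K C C (ai (ai (m01 \<otimes>\<^bsub>C\<^esub> n01)))
             (ai (ai (alpha C m1 \<otimes>\<^bsub>C\<^esub> alpha C n1)))))))) =
        sw K M C (tensor K ?T (tensor K C C)) (coact M m) (\<lambda>m0 m1. sw K N C (tensor K ?T (tensor K C C)) (coact N n) (\<lambda>n0 n1.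
         sw K C C (tensor K ?T (tensor K C C)) (comul C m1) (\<lambda>y1 y2.
         sw K C C (tensor K ?T (tensor K C C)) (comul C n1) (\<lambda>z1 z2.
           tens K ?T (tensor K C C) (tens K M N (alpha M m0) (alpha N n0)) (tens K C C (ai (ai (y1 \<otimes>\<^bsub>C\<^esub> z1)))
             (ai (ai (y2 \<otimes>\<^bsub>C\<^esub> z2))))))))"
        by (rule sw_coact_coassoc_pair[OF C_bialg(2) doi_hopf_moduleD(2)[OF M] C_bialg(2) doi_hopf_moduleD(2)[OF N]])
          (use 6 in \<open>simp_all add: trilinear_map_def\<close>)
      then show ?case using 6 by (simp add: s)
    qed (simp_all add: s)
  next
    case (10 a t)
    then show ?case
    proof (intro ext[where t = t and X = "tensor K ?T C" and f = "\<lambda>t. coact ?P (act ?P a t)"], goal_cases)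
      case (6 m n)
      have "sw K A H (tensor K ?T C) (co a) (\<lambda>a0 a1. sw K M C (tensor K ?T C) (coact M m) (\<lambda>m0 m1.
         sw K N C (tensor K ?T C) (coact N n) (\<lambda>n0 n1. sw K A A (tensor K ?T C) (comul A a0) (\<lambda>x y.
        tens K ?T C (tens K M N (act M x m0) (act N y n0)) (ai (ai (ac (alpha H (alpha H a1)) (m1 \<otimes>\<^bsub>C\<^esub> n1)))))))) =
       sw K A A (tensor K ?T C) (comul A a) (\<lambda>a1 a2. sw K A H (tensor K ?T C) (co a1) (\<lambda>x a11.
         sw K M C (tensor K ?T C) (coact M m) (\<lambda>m0 m1. sw K A H (tensor K ?T C) (co a2) (\<lambda>y a21.
         sw K N C (tensor K ?T C) (coact N n) (\<lambda>n0 n1.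
         tens K ?T C (tens K M N (act M x m0) (act N y n0)) (ai (ai (ac a11 m1 \<otimes>\<^bsub>C\<^esub> ac a21 n1))))))))"
        by (rule sw_monoidal_pair) (use 6 in \<open>simp_all add: trilinear_map_def\<close>)
      then show ?case using 6 by (simp add: s)
    qed (simp_all add: s)
  qed simp_all
qed

end

section \<open>The functor \<open>F\<close>\<close>

locale doi_morphism = doi_datum K H A C co ac + tgt: doi_datum K H A' C co' ac
  for K :: "('k, 'r) ring_scheme" and H :: "('k, 'h) hom_bialg" and A :: "('k, 'a) hom_bialg"
    and C :: "('k, 'c) hom_bialg" and co ac and A' :: "('k, 'b) hom_bialg" and co' +
  fixes l :: "'a \<Rightarrow> 'b"
  assumes morphism: "monoidal_morphism K
    \<lparr>datum_H = H, datum_A = A, datum_C = C, datum_coact = co, datum_act = ac\<rparr>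
    \<lparr>datum_H = H, datum_A = A', datum_C = C, datum_coact = co', datum_act = ac\<rparr> l"
begin

lemmas morphism_unfolded = morphism[unfolded monoidal_morphism_def hom_bialgebra_map_def datum.simps]

lemma l_lin: "linear_map K A A' l"
  using morphism_unfolded by blast

lemma l_simps [simp]:
  "a \<in> carrier A \<Longrightarrow> l a \<in> carrier A'"
  "linear_map K A A' l"
  "linear_map K V A f \<Longrightarrow> linear_map K V A' (\<lambda>x. l (f x))"
  "a \<in> carrier A \<Longrightarrow> l (alpha A a) = alpha A' (l a)"
  "a \<in> carrier A \<Longrightarrow> b \<in> carrier A \<Longrightarrow> l (a \<otimes>\<^bsub>A\<^esub> b) = l a \<otimes>\<^bsub>A'\<^esub> l b"
  "l \<one>\<^bsub>A\<^esub> = \<one>\<^bsub>A'\<^esub>"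
  "a \<in> carrier A \<Longrightarrow> counit A' (l a) = counit A a"
  using morphism_unfolded linear_map_facts[OF l_lin] by blast+

lemma l_alpha_inv [simp]: "a \<in> carrier A \<Longrightarrow> l (alpha_inv A a) = alpha_inv A' (l a)"
  by (rule alpha_inv_eqI[OF tgt.A_alg(1) tgt.bij_A, symmetric]) (simp_all flip: l_simps(4))

lemma sw_comul_l [simp]:
  assumes "hom_space K X" "bilinear_map K A' A' X f" "a \<in> carrier A"
  shows "sw K A' A' X (comul A' (l a)) f = sw K A A X (comul A a) (\<lambda>x y. f (l x) (l y))"
proof -
  have "comul A' (l a) = sweedler K (tensor K A' A') (comul A a) (\<lambda>a1 a2. tens K A' A' (l a1) (l a2))"
    using morphism_unfolded assms by blast
  also have "\<dots> = sw K A A (tensor K A' A') (comul A a) (\<lambda>a1 a2. tens K A' A' (l a1) (l a2))"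
    by (rule sweedler_eqI) (use assms in simp_all)
  finally show ?thesis using assms by simp
qed

lemma sw_co_l [simp]:
  assumes "hom_space K X" "bilinear_map K A' H X f" "a \<in> carrier A"
  shows "sw K A' H X (co' (l a)) f = sw K A H X (co a) (\<lambda>x y. f (l x) y)"
proof -
  have "co' (l a) = sweedler K (tensor K A' H) (co a) (\<lambda>a0 a1. tens K A' H (l a0) a1)"
    using morphism_unfolded assms by blast
  also have "\<dots> = sw K A H (tensor K A' H) (co a) (\<lambda>a0 a1. tens K A' H (l a0) a1)"
    by (rule sweedler_eqI) (use assms in simp_all)
  finally show ?thesis using assms by simp
qed

abbreviation "bt M \<equiv> btens K D tgt.D l M"
abbreviation "FS M \<equiv> F_space K D tgt.D l M"
abbreviation "FO M \<equiv> F_obj K D tgt.D l M"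

definition balanced where
  "balanced M X f \<longleftrightarrow> bilinear_map K A' M X f \<and>
     (\<forall>b\<in>carrier A'. \<forall>a\<in>carrier A. \<forall>m\<in>carrier M. f (b \<otimes>\<^bsub>A'\<^esub> l a) (alpha M m) = f (alpha A' b) (act M a m))"

context
  fixes M :: "('k, 'a, 'c, 'm) dh_module"
  assumes M: "doi_hopf_module K D M"
begin

lemmas M_facts [simp] = dh_module_facts[OF M]

abbreviation (input) "AM \<equiv> tensor K A' M"
abbreviation (input) "RM \<equiv> balance_span K D tgt.D l M"

lemma T_module: "module K AM" by simp

lemma balance_span_generators:
  "{tens K A' M (b \<otimes>\<^bsub>A'\<^esub> l a) (alpha M m) \<ominus>\<^bsub>AM\<^esub> tens K A' M (alpha A' b) (act M a m) | b a m.
          b \<in> carrier A' \<and> a \<in> carrier A \<and> m \<in> carrier M} \<subseteq> carrier AM"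
proof -
  interpret AM: module K AM by (rule T_module)
  show ?thesis by (auto intro!: AM.minus_closed)
qed

lemma balance_span_submodule: "submodule RM K AM"
  unfolding balance_span_def Let_def datum.simps
  by (rule lin_span_submodule[OF T_module balance_span_generators])

text \<open>A balanced map vanishes on the relations that define \<open>F(M)\<close>, so that its value does not depend on
  the tensor that represents an element. As in \<open>sweedler_eqI\<close>, \<open>f\<close> and \<open>g\<close> may differ outside the
  carriers.\<close>

lemma bsweedler_coset:
  assumes X: "hom_space K X" and g: "balanced M X g"
    and fg: "\<And>b m. b \<in> carrier A' \<Longrightarrow> m \<in> carrier M \<Longrightarrow> f b m = g b m" and t: "t \<in> carrier AM"
  shows "bsweedler K X (RM +>\<^bsub>AM\<^esub> t) f = sw K A' M X t g"
proof -
  have b: "bilinear_map K A' M X g" and rel: "\<And>b a m. b \<in> carrier A' \<Longrightarrow> a \<in> carrier A \<Longrightarrow> m \<in> carrier M \<Longrightarrow>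
      g (b \<otimes>\<^bsub>A'\<^esub> l a) (alpha M m) = g (alpha A' b) (act M a m)" using g unfolding balanced_def by blast+
  interpret X: module K X using X by simp
  have lin: "linear_map K AM X (\<lambda>t. sw K A' M X t g)" using X b by simp
  have eq: "sweedler K X t f = sw K A' M X t g" if "t \<in> carrier AM" for t
    by (rule sweedler_eqI) (use X b fg that in simp_all)
  have lin': "linear_map K AM X (\<lambda>t. sweedler K X t f)"
    by (subst linear_map_cong[OF T_module eq]) (use lin in simp_all)
  have gc: "b \<in> carrier A' \<Longrightarrow> m \<in> carrier M \<Longrightarrow> g b m \<in> carrier X" for b m
    using bilinear_map_closed[OF b] .
  have "sweedler K X w f = \<zero>\<^bsub>X\<^esub>" if "w \<in> RM" for w
  proof (rule linear_map_vanishes_on_span[OF T_module _ lin' balance_span_generators _ that[unfolded balance_span_def Let_def datum.simps]])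
    fix s assume "s \<in> {tens K A' M (b \<otimes>\<^bsub>A'\<^esub> l a) (alpha M m) \<ominus>\<^bsub>AM\<^esub> tens K A' M (alpha A' b) (act M a m) | b a m.
          b \<in> carrier A' \<and> a \<in> carrier A \<and> m \<in> carrier M}"
    then obtain b' a m where s: "s = tens K A' M (b' \<otimes>\<^bsub>A'\<^esub> l a) (alpha M m) \<ominus>\<^bsub>AM\<^esub> tens K A' M (alpha A' b') (act M a m)"
      and c [simp]: "b' \<in> carrier A'" "a \<in> carrier A" "m \<in> carrier M" by blast
    have "sweedler K X s f = sweedler K X (tens K A' M (b' \<otimes>\<^bsub>A'\<^esub> l a) (alpha M m)) f \<ominus>\<^bsub>X\<^esub>
        sweedler K X (tens K A' M (alpha A' b') (act M a m)) f"
      unfolding s by (rule linear_map_minus[OF T_module _ lin']) (use X in simp_all)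
    also have "\<dots> = g (alpha A' b') (act M a m) \<ominus>\<^bsub>X\<^esub> g (alpha A' b') (act M a m)"
      using X b by (simp add: eq rel)
    also have "\<dots> = \<zero>\<^bsub>X\<^esub>" using gc[of "alpha A' b'" "act M a m"] by (simp add: a_minus_def X.M.r_neg)
    finally show "sweedler K X s f = \<zero>\<^bsub>X\<^esub>" .
  qed (use X in simp)
  then show ?thesis
    unfolding bsweedler_def
    by (subst the_elem_image_coset(1)[OF T_module balance_span_submodule _ lin' _ t]) (use X t in \<open>simp_all add: eq\<close>)
qed

lemma F_space_sel:
  "carrier (FS M) = carrier (quotient_space AM RM)" "zero (FS M) = zero (quotient_space AM RM)"
  "add (FS M) = add (quotient_space AM RM)" "smult (FS M) = smult (quotient_space AM RM)"
  "alpha (FS M) = (\<lambda>z. bsweedler K (quotient_space AM RM) z (\<lambda>b m. bt M (alpha A' b) (alpha M m)))"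
  by (simp_all add: F_space_def Let_def module.extend_def hom_space.fields_def)

lemma F_space_module: "module K (FS M)"
  by (rule module_image[OF quotient_space_module[OF T_module balance_span_submodule], where p = id])
    (auto simp: F_space_sel)

lemma F_coset_linear: "linear_map K AM (FS M) (\<lambda>t. RM +>\<^bsub>AM\<^esub> t)"
  using quotient_map_linear[OF T_module balance_span_submodule]
  unfolding linear_map_def F_space_sel .

lemma F_carrier: "carrier (FS M) = (\<lambda>t. RM +>\<^bsub>AM\<^esub> t) ` carrier AM"
  by (simp add: F_space_sel carrier_quotient_space)

lemma btens_coset: "bt M b m = RM +>\<^bsub>AM\<^esub> tens K A' M b m"
  by (simp add: btens_def)

lemma bt_lin [simp]:
  "m \<in> carrier M \<Longrightarrow> linear_map K V A' f \<Longrightarrow> linear_map K V (FS M) (\<lambda>x. bt M (f x) m)"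
  "b \<in> carrier A' \<Longrightarrow> linear_map K V M g \<Longrightarrow> linear_map K V (FS M) (\<lambda>x. bt M b (g x))"
  "b \<in> carrier A' \<Longrightarrow> linear_map K M (FS M) (bt M b)"
  unfolding btens_coset by (rule linear_map_compose[OF _ F_coset_linear], simp)+

lemma bt_closed [simp]: "b \<in> carrier A' \<Longrightarrow> m \<in> carrier M \<Longrightarrow> bt M b m \<in> carrier (FS M)"
  using linear_map_closed[OF bt_lin(3)] .

lemma bt_balanced:
  assumes "b \<in> carrier A'" "a \<in> carrier A" "m \<in> carrier M"
  shows "bt M (b \<otimes>\<^bsub>A'\<^esub> l a) (alpha M m) = bt M (alpha A' b) (act M a m)"
proof -
  have "tens K A' M (b \<otimes>\<^bsub>A'\<^esub> l a) (alpha M m) \<ominus>\<^bsub>AM\<^esub> tens K A' M (alpha A' b) (act M a m) \<in> RM"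
    unfolding balance_span_def Let_def datum.simps
    using assms by (intro subsetD[OF lin_span_submodule(2)[OF T_module balance_span_generators]]) blast
  then show ?thesis
    unfolding btens_coset using assms by (subst coset_eq_iff[OF T_module balance_span_submodule]) simp_all
qed

lemma F_ext:
  assumes z: "z \<in> carrier (FS M)" and f: "linear_map K (FS M) X f" and g: "linear_map K (FS M) X g"
    and fg: "\<And>b m. b \<in> carrier A' \<Longrightarrow> m \<in> carrier M \<Longrightarrow> f (bt M b m) = g (bt M b m)"
  shows "f z = g z"
proof -
  obtain t where t: "t \<in> carrier AM" "z = RM +>\<^bsub>AM\<^esub> t" using z unfolding F_carrier by blast
  have "f (RM +>\<^bsub>AM\<^esub> t) = g (RM +>\<^bsub>AM\<^esub> t)"
    by (rule tensor_ext'[OF _ _ t(1) linear_map_compose[OF F_coset_linear f] linear_map_compose[OF F_coset_linear g]])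
      (simp_all flip: btens_coset add: fg)
  then show ?thesis using t by simp
qed

text \<open>The universal property: a balanced map extends linearly to \<open>F\<close>.\<close>

lemma bsweedler_linear:
  assumes X: "hom_space K X" and g: "balanced M X g"
    and fg: "\<And>b m. b \<in> carrier A' \<Longrightarrow> m \<in> carrier M \<Longrightarrow> f b m = g b m"
  shows "linear_map K (FS M) X (\<lambda>z. bsweedler K X z f)"
    and "b \<in> carrier A' \<Longrightarrow> m \<in> carrier M \<Longrightarrow> bsweedler K X (bt M b m) f = g b m"
proof -
  note e = bsweedler_coset[OF X g fg]
  have b: "bilinear_map K A' M X g" using g unfolding balanced_def by blast
  have lin: "linear_map K AM X (\<lambda>t. sw K A' M X t g)" using X b by simp
  show "b \<in> carrier A' \<Longrightarrow> m \<in> carrier M \<Longrightarrow> bsweedler K X (bt M b m) f = g b m"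
    unfolding btens_coset using X b by (simp add: e)
  interpret AM: module K AM by (rule T_module)
  note q = F_coset_linear
  show "linear_map K (FS M) X (\<lambda>z. bsweedler K X z f)"
  proof (rule linear_mapI)
    fix z assume "z \<in> carrier (FS M)"
    then obtain t where t: "t \<in> carrier AM" "z = RM +>\<^bsub>AM\<^esub> t" unfolding F_carrier by blast
    show "bsweedler K X z f \<in> carrier X" using t e linear_map_closed[OF lin] by simp
    { fix y assume "y \<in> carrier (FS M)"
      then obtain s where s: "s \<in> carrier AM" "y = RM +>\<^bsub>AM\<^esub> s" unfolding F_carrier by blast
      show "bsweedler K X (z \<oplus>\<^bsub>FS M\<^esub> y) f = bsweedler K X z f \<oplus>\<^bsub>X\<^esub> bsweedler K X y f"
        using t s linear_map_add[OF q t(1) s(1)] linear_map_add[OF lin t(1) s(1)] e AM.M.a_closed by metis }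
    { fix k assume k: "k \<in> carrier K"
      show "bsweedler K X (k \<odot>\<^bsub>FS M\<^esub> z) f = k \<odot>\<^bsub>X\<^esub> bsweedler K X z f"
        using t k linear_map_smult[OF q k t(1)] linear_map_smult[OF lin k t(1)] e AM.smult_closed by metis }
  qed
qed

end

end

lemma bsweedler_target_cong:
  assumes "carrier X = carrier X'" "zero X = zero X'" "add X = add X'" "smult X = smult X'"
  shows "bsweedler K X z f = bsweedler K X' z f"
  unfolding bsweedler_def sweedler_def finsum_def finprod_def using assms by simp

context doi_morphism
begin

context
  fixes M :: "('k, 'a, 'c, 'm) dh_module"
  assumes M: "doi_hopf_module K D M"
begin

lemmas M_F [simp] = dh_module_facts[OF M] bt_lin[OF M] bt_closed[OF M]

text \<open>The universal property is available for Hom-spaces as targets, and \<open>F(M)\<close> is one only once its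
  structure map is known to be linear. Hence that map is first constructed with the target \<open>F(M)\<close>
  carrying the identity as its structure map.\<close>

lemma F_space_alpha:
  "linear_map K (FS M) (FS M) (alpha (FS M))"
  "b \<in> carrier A' \<Longrightarrow> m \<in> carrier M \<Longrightarrow> alpha (FS M) (bt M b m) = bt M (alpha A' b) (alpha M m)"
proof -
  let ?X = "FS M\<lparr>alpha := \<lambda>z. z\<rparr>" and ?f = "\<lambda>b m. bt M (alpha A' b) (alpha M m)"
  have lA: "linear_map K A' ?X f = linear_map K A' (FS M) f"
    and lM: "linear_map K M ?X h = linear_map K M (FS M) h"
    and lin': "linear_map K (FS M) ?X k = linear_map K (FS M) (FS M) k" for f h k
    by (simp_all add: linear_map_def)
  have "module K ?X"
    by (rule module_image[OF F_space_module[OF M], where p = id]) auto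
  then have X: "hom_space K ?X" by (simp add: hom_space_def linear_map_def)
  have g: "balanced M ?X ?f"
    unfolding balanced_def
  proof (intro conjI ballI)
    show "bilinear_map K A' M ?X ?f" unfolding bilinear_map_iff lA lM by simp
    fix b a m assume "b \<in> carrier A'" "a \<in> carrier A" "m \<in> carrier M"
    then show "?f (b \<otimes>\<^bsub>A'\<^esub> l a) (alpha M m) = ?f (alpha A' b) (act M a m)"
      using bt_balanced[OF M, of "alpha A' b" "alpha A a" "alpha M m"] by simp
  qed
  have "alpha (FS M) = (\<lambda>z. bsweedler K ?X z ?f)"
    unfolding F_space_sel[OF M] by (intro ext bsweedler_target_cong) (simp_all add: F_space_sel[OF M])
  then show "linear_map K (FS M) (FS M) (alpha (FS M))"
    "b \<in> carrier A' \<Longrightarrow> m \<in> carrier M \<Longrightarrow> alpha (FS M) (bt M b m) = bt M (alpha A' b) (alpha M m)"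
    using bsweedler_linear[OF M X g refl] by (simp_all add: lin')
qed

lemma F_hom_space [simp]: "hom_space K (FS M)"
  by (simp add: hom_space_def F_space_module[OF M] F_space_alpha)

lemmas F_alpha_bt [simp] = F_space_alpha(2)

lemma bt_sw [simp]:
  assumes "hom_space K V" "hom_space K W" "t \<in> carrier (tensor K V W)"
  shows "m \<in> carrier M \<Longrightarrow> (\<And>v w. v \<in> carrier V \<Longrightarrow> w \<in> carrier W \<Longrightarrow> f v w \<in> carrier A') \<Longrightarrow>
      bt M (sw K V W A' t f) m = sw K V W (FS M) t (\<lambda>v w. bt M (f v w) m)"
    and "b \<in> carrier A' \<Longrightarrow> (\<And>v w. v \<in> carrier V \<Longrightarrow> w \<in> carrier W \<Longrightarrow> g v w \<in> carrier M) \<Longrightarrow>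
      bt M b (sw K V W M t g) = sw K V W (FS M) t (\<lambda>v w. bt M b (g v w))"
  by (rule push_linear[where g = "\<lambda>b. bt M b m"] push_linear[where g = "bt M b"]; use assms in simp)+

lemma F_obj_space: "same_space (FO M) (FS M)"
  unfolding F_obj_def Let_def by (rule same_space_make_dh_module)

lemma F_act_balanced:
  assumes "a \<in> carrier A'"
  shows "balanced M (FS M) (\<lambda>b m. bt M (alpha A' a \<otimes>\<^bsub>A'\<^esub> b) (alpha M m))"
  unfolding balanced_def
proof (intro conjI ballI)
  fix b x m assume c: "b \<in> carrier A'" "x \<in> carrier A" "m \<in> carrier M"
  then show "bt M (alpha A' a \<otimes>\<^bsub>A'\<^esub> (b \<otimes>\<^bsub>A'\<^esub> l x)) (alpha M (alpha M m)) =
      bt M (alpha A' a \<otimes>\<^bsub>A'\<^esub> alpha A' b) (alpha M (act M x m))"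
    using bt_balanced[OF M, of "a \<otimes>\<^bsub>A'\<^esub> b" "alpha A x" "alpha M m"] assms
    by (simp add: hom_assoc[OF tgt.A_bialg(1)])
qed (use assms in simp)

lemma F_act_bt [simp]:
  "a \<in> carrier A' \<Longrightarrow> b \<in> carrier A' \<Longrightarrow> m \<in> carrier M \<Longrightarrow>
    act (FO M) a (bt M b m) = bt M (alpha A' a \<otimes>\<^bsub>A'\<^esub> b) (alpha M m)"
  unfolding F_obj_def Let_def make_dh_module_sel datum.simps
  by (rule bsweedler_linear(2)[OF M F_hom_space F_act_balanced]) simp_all

lemma F_act_lin:
  "a \<in> carrier A' \<Longrightarrow> linear_map K (FS M) (FS M) (act (FO M) a)"
  "z \<in> carrier (FS M) \<Longrightarrow> linear_map K A' (FS M) (\<lambda>a. act (FO M) a z)"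
proof -
  show "a \<in> carrier A' \<Longrightarrow> linear_map K (FS M) (FS M) (act (FO M) a)"
    unfolding F_obj_def Let_def make_dh_module_sel datum.simps
    by (rule bsweedler_linear(1)[OF M F_hom_space F_act_balanced]) simp_all
  assume "z \<in> carrier (FS M)"
  then obtain t where t: "t \<in> carrier (tensor K A' M)"
    "z = balance_span K D tgt.D l M +>\<^bsub>tensor K A' M\<^esub> t" unfolding F_carrier[OF M] by blast
  have e: "act (FO M) a z = sw K A' M (FS M) t (\<lambda>b m. bt M (alpha A' a \<otimes>\<^bsub>A'\<^esub> b) (alpha M m))"
    if "a \<in> carrier A'" for a
    unfolding F_obj_def Let_def make_dh_module_sel datum.simps t(2)
    by (rule bsweedler_coset[OF M F_hom_space F_act_balanced[OF that] _ t(1)]) simp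
  show "linear_map K A' (FS M) (\<lambda>a. act (FO M) a z)"
    by (subst linear_map_cong[OF hom_space_module[OF tgt.A_alg(1)] e]) (use t(1) in simp_all)
qed

definition F_coact_fun where
  "F_coact_fun b m = sw K A' H (tensor K (FS M) C) (co' b) (\<lambda>b0 b1.
     sw K M C (tensor K (FS M) C) (coact M m) (\<lambda>m0 m1. tens K (FS M) C (bt M b0 m0) (ai (ai (ac b1 m1)))))"

text \<open>On the \<open>C\<close>-legs this is associativity of the action of \<open>H\<close> on \<open>C\<close>:
  \<open>(b\<^sub>1 x\<^sub>1) \<cdot> \<alpha>(m\<^sub>1) = \<alpha>(b\<^sub>1) \<cdot> (x\<^sub>1 \<cdot> m\<^sub>1)\<close>.\<close>

lemma F_coact_balanced: "balanced M (tensor K (FS M) C) F_coact_fun"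
  unfolding balanced_def F_coact_fun_def
proof (intro conjI ballI)
  fix b x m assume c: "b \<in> carrier A'" "x \<in> carrier A" "m \<in> carrier M"
  then show "sw K A' H (tensor K (FS M) C) (co' (b \<otimes>\<^bsub>A'\<^esub> l x)) (\<lambda>b0 b1.
     sw K M C (tensor K (FS M) C) (coact M (alpha M m)) (\<lambda>m0 m1. tens K (FS M) C (bt M b0 m0) (ai (ai (ac b1 m1))))) =
    sw K A' H (tensor K (FS M) C) (co' (alpha A' b)) (\<lambda>b0 b1.
     sw K M C (tensor K (FS M) C) (coact M (act M x m)) (\<lambda>m0 m1. tens K (FS M) C (bt M b0 m0) (ai (ai (ac b1 m1)))))"
    by (simp add: bt_balanced[OF M] flip: ac_assoc)
qed simp

lemma F_coact_eq:
  assumes [simp]: "b \<in> carrier A'" "m \<in> carrier M"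
  shows "sweedler K (tensor K (FS M) C) (co' b) (\<lambda>b0 b1. sweedler K (tensor K (FS M) C) (coact M m) (\<lambda>m0 m1.
              tens K (FS M) C (bt M b0 m0) (ai (ai (ac b1 m1))))) = F_coact_fun b m"
  unfolding F_coact_fun_def by (intro sweedler_eqI) simp_all

lemma F_coact_lin: "linear_map K (FS M) (tensor K (FS M) C) (coact (FO M))"
  unfolding F_obj_def Let_def make_dh_module_sel datum.simps
  by (rule bsweedler_linear(1)[OF M hom_space_tensor F_coact_balanced F_coact_eq]) simp_all

lemma F_coact_bt [simp]:
  "b \<in> carrier A' \<Longrightarrow> m \<in> carrier M \<Longrightarrow> coact (FO M) (bt M b m) =
    sw K A' H (tensor K (FS M) C) (co' b) (\<lambda>b0 b1.
     sw K M C (tensor K (FS M) C) (coact M m) (\<lambda>m0 m1. tens K (FS M) C (bt M b0 m0) (ai (ai (ac b1 m1)))))"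
  unfolding F_coact_fun_def[symmetric] unfolding F_obj_def Let_def make_dh_module_sel datum.simps
  by (rule bsweedler_linear(2)[OF M hom_space_tensor F_coact_balanced F_coact_eq]) simp_all

lemma F_obj_sw [simp]:
  assumes "hom_space K V" "hom_space K W" "t \<in> carrier (tensor K V W)"
    and g: "\<And>v w. v \<in> carrier V \<Longrightarrow> w \<in> carrier W \<Longrightarrow> g v w \<in> carrier (FS M)"
  shows "a \<in> carrier A' \<Longrightarrow> act (FO M) a (sw K V W (FS M) t g) = sw K V W (FS M) t (\<lambda>v w. act (FO M) a (g v w))"
     "coact (FO M) (sw K V W (FS M) t g) = sw K V W (tensor K (FS M) C) t (\<lambda>v w. coact (FO M) (g v w))"
proof -
  show "act (FO M) a (sw K V W (FS M) t g) = sw K V W (FS M) t (\<lambda>v w. act (FO M) a (g v w))"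
    if "a \<in> carrier A'"
    by (rule push_linear[OF F_act_lin(1)[OF that]]) (use assms in simp_all)
  show "coact (FO M) (sw K V W (FS M) t g) = sw K V W (tensor K (FS M) C) t (\<lambda>v w. coact (FO M) (g v w))"
    by (rule push_linear[OF F_coact_lin]) (use assms in simp_all)
qed

text \<open>The coaction on \<open>b \<otimes> m\<close> combines those of \<open>A'\<close> (over \<open>H\<close>) and \<open>M\<close> (over \<open>C\<close>), and it is
  coassociative because \<open>\<Delta>\<^sub>C(h \<cdot> c) = h\<^sub>1 \<cdot> c\<^sub>1 \<otimes> h\<^sub>2 \<cdot> c\<^sub>2\<close>.\<close>

theorem doi_hopf_module_F: "doi_hopf_module K tgt.D (FO M)"
proof -
  let ?P = "FO M" and ?Q = "FS M"
  note lin = F_act_lin F_coact_lin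
  note [simp] = same_space_rules[OF F_obj_space] lin
    linear_map_closed[OF lin(1)] linear_map_closed[OF lin(3)] linear_map_compose[OF _ lin(1)]
    linear_map_compose[OF _ lin(2)] linear_map_compose[OF _ lin(3)]
  note ext = F_ext[OF M]
  show ?thesis
  proof (rule tgt.doi_hopf_moduleI, goal_cases)
    case (4 z)
    then show ?case
      by (intro ext[where z = z and X = ?Q and f = "act ?P \<one>\<^bsub>A'\<^esub>"]) simp_all
  next
    case (5 a z)
    then show ?case
      by (intro ext[where z = z and X = ?Q and f = "\<lambda>z. alpha ?P (act ?P a z)"]) simp_all
  next
    case (6 a b z)
    then show ?case
      by (intro ext[where z = z and X = ?Q and f = "\<lambda>z. act ?P (alpha A' a) (act ?P b z)"])
        (simp_all add: hom_assoc[OF tgt.A_bialg(1)])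
  next
    case (7 z)
    then show ?case
      by (intro ext[where z = z and X = ?Q and f = "\<lambda>t. sw K ?P C ?P (coact ?P t) (\<lambda>m0 m1. counit C m1 \<odot>\<^bsub>?P\<^esub> m0)"])
        simp_all
  next
    case (8 z)
    then show ?case
      by (intro ext[where z = z and X = "tensor K ?Q C" and g = "\<lambda>t. coact ?P (alpha ?P t)"]) simp_all
  next
    case (9 z)
    then show ?case
    proof (intro ext[where z = z and X = "tensor K ?Q (tensor K C C)" and f = "\<lambda>t. sw K ?P C (tensor K ?P (tensor K C C)) (coact ?P t) (\<lambda>m0 m1.
         sw K ?P C (tensor K ?P (tensor K C C)) (coact ?P m0) (\<lambda>m00 m01.
         tens K ?P (tensor K C C) m00 (tens K C C m01 (alpha C m1))))"], goal_cases)
      case (4 b m)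
      have "sw K A' H (tensor K ?Q (tensor K C C)) (co' b) (\<lambda>m0 m1. sw K M C (tensor K ?Q (tensor K C C)) (coact M m) (\<lambda>n0 n1.
         sw K A' H (tensor K ?Q (tensor K C C)) (co' m0) (\<lambda>m00 m01.
         sw K M C (tensor K ?Q (tensor K C C)) (coact M n0) (\<lambda>n00 n01.
           tens K ?Q (tensor K C C) (bt M m00 n00) (tens K C C (ai (ai (ac m01 n01)))
             (ai (ai (ac (alpha H m1) (alpha C n1)))))))))  =
        sw K A' H (tensor K ?Q (tensor K C C)) (co' b) (\<lambda>m0 m1. sw K M C (tensor K ?Q (tensor K C C)) (coact M m) (\<lambda>n0 n1.
         sw K H H (tensor K ?Q (tensor K C C)) (comul H m1) (\<lambda>y1 y2.
         sw K C C (tensor K ?Q (tensor K C C)) (comul C n1) (\<lambda>z1 z2.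
           tens K ?Q (tensor K C C) (bt M (alpha A' m0) (alpha M n0)) (tens K C C (ai (ai (ac y1 z1)))
             (ai (ai (ac y2 z2))))))))"
        by (rule sw_coact_coassoc_pair[OF H_bialg(2) tgt.co_comodule C_bialg(2) doi_hopf_moduleD(2)[OF M]])
          (use 4 in \<open>simp_all add: trilinear_map_def\<close>)
      then show ?case using 4 by simp
    qed simp_all
  next
    case (10 a z)
    then show ?case
      by (intro ext[where z = z and X = "tensor K ?Q C" and f = "\<lambda>t. coact ?P (act ?P a t)"])
        (simp_all flip: ac_assoc)
  qed simp_all
qed

end

end

section \<open>Functoriality\<close>

context doi_datum
begin

lemma doi_hopf_map_tensor:
  assumes M: "doi_hopf_module K D M" "doi_hopf_module K D M'" and f: "doi_hopf_map K D M M' f"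
    and N: "doi_hopf_module K D N" "doi_hopf_module K D N'" and g: "doi_hopf_map K D N N' g"
  shows "doi_hopf_map K D (dh_tensor K D M N) (dh_tensor K D M' N')
    (\<lambda>t. sw K M N (tensor K M' N') t (\<lambda>m n. tens K M' N' (f m) (g n)))"
proof -
  note P = doi_hopf_module_tensor[OF M(1) N(1)] and P' = doi_hopf_module_tensor[OF M(2) N(2)]
  note s = dh_tensor_sel[OF M(1) N(1)] and s' = dh_tensor_sel[OF M(2) N(2)]
  note l = dh_tensor_lin[OF M(1) N(1)] and l' = dh_tensor_lin[OF M(2) N(2)]
  note [simp] = dh_module_facts[OF M(1)] dh_module_facts[OF N(1)] dh_module_facts[OF M(2)] dh_module_facts[OF N(2)]
    same_space_rules[OF s(1)] same_space_rules[OF s'(1)] l l'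
    linear_map_facts[OF l(2)] linear_map_facts[OF l(3)]
    linear_map_facts[OF l'(2)] linear_map_facts[OF l'(3)]
    doi_hopf_mapD[OF f] doi_hopf_mapD[OF g] sw_coact_map[OF M f] sw_coact_map[OF N g]
  let ?h = "\<lambda>t. sw K M N (tensor K M' N') t (\<lambda>m n. tens K M' N' (f m) (g n))"
  let ?P = "dh_tensor K D M N" and ?P' = "dh_tensor K D M' N'"
  have lh: "linear_map K ?P ?P' ?h" by simp
  note ext = tensor_ext'[of M N]
  show ?thesis
    unfolding doi_hopf_map_iff[OF P P' lh]
  proof (intro conjI ballI, goal_cases)
    case (1 t)
    then show ?case
      by (intro ext[where t = t and X = "tensor K M' N'" and f = "\<lambda>t. ?h (alpha ?P t)"]) simp_all
  next
    case (2 a t)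
    then show ?case
      by (intro ext[where t = t and X = "tensor K M' N'" and f = "\<lambda>t. ?h (act ?P a t)"]) (simp_all add: s s')
  next
    case (3 t)
    then show ?case
      by (intro ext[where t = t and X = "tensor K (tensor K M' N') C" and f = "\<lambda>t. coact ?P' (?h t)"]) (simp_all add: s s')
  qed
qed

lemma doi_hopf_iso_tensor:
  assumes "doi_hopf_iso K D M M'" "doi_hopf_iso K D N N'"
  shows "doi_hopf_iso K D (dh_tensor K D M N) (dh_tensor K D M' N')"
proof -
  obtain f f' where M: "doi_hopf_module K D M" "doi_hopf_module K D M'" "doi_hopf_map K D M M' f" "doi_hopf_map K D M' M f'"
    "\<And>m. m \<in> carrier M \<Longrightarrow> f' (f m) = m" "\<And>n. n \<in> carrier M' \<Longrightarrow> f (f' n) = n"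
    using doi_hopf_isoE[OF assms(1)] by metis
  obtain g g' where N: "doi_hopf_module K D N" "doi_hopf_module K D N'" "doi_hopf_map K D N N' g" "doi_hopf_map K D N' N g'"
    "\<And>m. m \<in> carrier N \<Longrightarrow> g' (g m) = m" "\<And>n. n \<in> carrier N' \<Longrightarrow> g (g' n) = n"
    using doi_hopf_isoE[OF assms(2)] by metis
  note s = dh_tensor_sel[OF M(1) N(1)] and s' = dh_tensor_sel[OF M(2) N(2)]
  note [simp] = dh_module_facts[OF M(1)] dh_module_facts[OF N(1)] dh_module_facts[OF M(2)] dh_module_facts[OF N(2)]
    same_space_rules[OF s(1)] same_space_rules[OF s'(1)] M(5,6) N(5,6)
    doi_hopf_mapD[OF M(3)] doi_hopf_mapD[OF N(3)] doi_hopf_mapD[OF M(4)] doi_hopf_mapD[OF N(4)]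
  show ?thesis
    by (rule doi_hopf_isoI[OF doi_hopf_module_tensor[OF M(1) N(1)] doi_hopf_module_tensor[OF M(2) N(2)]
          doi_hopf_map_tensor[OF M(1-3) N(1-3)], where g = "\<lambda>t. sw K M' N' (tensor K M N) t (\<lambda>m n. tens K M N (f' m) (g' n))"])
      (simp_all add: sw_tens_eq_self)
qed

text \<open>A Hom-space whose action and coaction correspond to those of a module under a linear bijection
  satisfies the module axioms, since each of them can be read off on the other side. This spares
  their verification on the cotensor product.\<close>

lemma doi_hopf_transport:
  assumes M: "doi_hopf_module K D M" and P [simp]: "hom_space K P" and f: "linear_map K M P f"
    and g [simp]: "\<And>p. p \<in> carrier P \<Longrightarrow> g p \<in> carrier M"
    and fg [simp]: "\<And>p. p \<in> carrier P \<Longrightarrow> f (g p) = p" and gf [simp]: "\<And>m. m \<in> carrier M \<Longrightarrow> g (f m) = m"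
    and alpha: "\<And>m. m \<in> carrier M \<Longrightarrow> f (alpha M m) = alpha P (f m)"
    and act: "\<And>a m. a \<in> carrier A \<Longrightarrow> m \<in> carrier M \<Longrightarrow> act P a (f m) = f (act M a m)"
    and coact: "\<And>m. m \<in> carrier M \<Longrightarrow>
      coact P (f m) = sw K M C (tensor K P C) (coact M m) (\<lambda>m0 m1. tens K P C (f m0) m1)"
  shows "doi_hopf_iso K D M P"
proof -
  note Mf [simp] = dh_module_facts[OF M]
  have lg: "linear_map K P M g" by (rule linear_map_inverse[OF _ _ f]) simp_all
  note [simp] = f linear_map_facts[OF f] lg linear_map_compose[OF _ lg]
  have alphaP [simp]: "alpha P (f m) = f (alpha M m)" if "m \<in> carrier M" for m by (simp add: alpha that)
  have alpha' [simp]: "alpha P p = f (alpha M (g p))" if "p \<in> carrier P" for p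
    using alpha[of "g p"] that by simp
  have act' [simp]: "act P a p = f (act M a (g p))" if "a \<in> carrier A" "p \<in> carrier P" for a p
    using act[of a "g p"] that by simp
  have coact' [simp]: "coact P p = sw K M C (tensor K P C) (coact M (g p)) (\<lambda>m0 m1. tens K P C (f m0) m1)"
    if "p \<in> carrier P" for p
    using coact[of "g p"] that by simp
  have la: "linear_map K A P (\<lambda>a. act P a p)" if "p \<in> carrier P" for p
  proof -
    have e: "act P a p = f (act M a (g p))" if "a \<in> carrier A" for a using that \<open>p \<in> carrier P\<close> by simp
    show ?thesis by (subst linear_map_cong[OF hom_space_module[OF A_alg(1)] e]) (use that in simp_all)
  qed
  have lp: "linear_map K P P (act P a)" if "a \<in> carrier A" for a
    by (subst linear_map_cong[OF hom_space_module[OF P] act'[OF that]]) (use that in simp_all)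
  have lc: "linear_map K P (tensor K P C) (coact P)"
    by (subst linear_map_cong[OF hom_space_module[OF P] coact']) simp_all
  have "doi_hopf_module K D P"
  proof (rule doi_hopf_moduleI, goal_cases)
    case (7 p)
    then have "sw K M C P (coact M (g p)) (\<lambda>m0 m1. counit C m1 \<odot>\<^bsub>P\<^esub> f m0) = f (alpha M (g p))" by simp
    then show ?case using 7 by simp
  next
    case (9 p)
    have "sw K M C (tensor K P (tensor K C C)) (coact M (g p)) (\<lambda>m0 m1. sw K M C (tensor K P (tensor K C C)) (coact M m0) (\<lambda>m00 m01.
         tens K P (tensor K C C) (f m00) (tens K C C m01 (alpha C m1)))) =
       sw K M C (tensor K P (tensor K C C)) (coact M (g p)) (\<lambda>m0 m1. sw K C C (tensor K P (tensor K C C)) (comul C m1) (\<lambda>y z.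
         tens K P (tensor K C C) (f (alpha M m0)) (tens K C C y z)))"
      by (rule dh_coassoc[OF M]) (use 9 in \<open>simp_all add: trilinear_map_def\<close>)
    then show ?case using 9 by simp
  qed (simp_all add: la lp lc)
  then show ?thesis
  proof (rule doi_hopf_isoI[OF M, where f = f and g = g])
    show "doi_hopf_map K D M P f"
      unfolding doi_hopf_map_iff[OF M \<open>doi_hopf_module K D P\<close> f] by simp
  qed simp_all
qed

end

context doi_morphism
begin

lemma doi_hopf_iso_F:
  assumes "doi_hopf_iso K D M N"
  shows "doi_hopf_iso K tgt.D (FO M) (FO N)"
proof -
  obtain f g where MN: "doi_hopf_module K D M" "doi_hopf_module K D N" "doi_hopf_map K D M N f" "doi_hopf_map K D N M g"
    "\<And>m. m \<in> carrier M \<Longrightarrow> g (f m) = m" "\<And>n. n \<in> carrier N \<Longrightarrow> f (g n) = n"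
    using doi_hopf_isoE[OF assms] by metis
  note lM = F_act_lin[OF MN(1)] F_coact_lin[OF MN(1)] and lN = F_act_lin[OF MN(2)] F_coact_lin[OF MN(2)]
  note [simp] = M_F[OF MN(1)] M_F[OF MN(2)] F_hom_space[OF MN(1)] F_hom_space[OF MN(2)]
    F_alpha_bt[OF MN(1)] F_alpha_bt[OF MN(2)] F_act_bt[OF MN(1)] F_act_bt[OF MN(2)]
    F_coact_bt[OF MN(1)] F_coact_bt[OF MN(2)] F_obj_sw[OF MN(1)] F_obj_sw[OF MN(2)]
    same_space_rules[OF F_obj_space[OF MN(1)]] same_space_rules[OF F_obj_space[OF MN(2)]]
    doi_hopf_mapD[OF MN(3)] doi_hopf_mapD[OF MN(4)] MN(5,6) sw_coact_map[OF MN(1,2,3)]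
    linear_map_closed[OF lM(1)] linear_map_closed[OF lM(3)] linear_map_compose[OF _ lM(1)] linear_map_compose[OF _ lM(3)]
    linear_map_closed[OF lN(1)] linear_map_closed[OF lN(3)] linear_map_compose[OF _ lN(1)] linear_map_compose[OF _ lN(3)]
    lM lN
  have bf: "balanced M (FS N) (\<lambda>b m. bt N b (f m))"
    unfolding balanced_def by (simp add: bt_balanced[OF MN(2)])
  have bg: "balanced N (FS M) (\<lambda>b m. bt M b (g m))"
    unfolding balanced_def by (simp add: bt_balanced[OF MN(1)])
  define Ff where "Ff z = bsweedler K (FS N) z (\<lambda>b m. bt N b (f m))" for z
  define Fg where "Fg z = bsweedler K (FS M) z (\<lambda>b m. bt M b (g m))" for z
  have lf: "linear_map K (FS M) (FS N) Ff"
    and Ff [simp]: "\<And>b m. b \<in> carrier A' \<Longrightarrow> m \<in> carrier M \<Longrightarrow> Ff (bt M b m) = bt N b (f m)"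
    unfolding Ff_def[abs_def] by (rule bsweedler_linear[OF MN(1) _ bf refl]; simp)+
  have lg: "linear_map K (FS N) (FS M) Fg"
    and Fg [simp]: "\<And>b m. b \<in> carrier A' \<Longrightarrow> m \<in> carrier N \<Longrightarrow> Fg (bt N b m) = bt M b (g m)"
    unfolding Fg_def[abs_def] by (rule bsweedler_linear[OF MN(2) _ bg refl]; simp)+
  note [simp] = lf lg linear_map_closed[OF lf] linear_map_closed[OF lg] linear_map_compose[OF _ lf] linear_map_compose[OF _ lg]
  have lf': "linear_map K (FO M) (FO N) Ff" by simp
  note ext = F_ext[OF MN(1)]
  have "doi_hopf_map K tgt.D (FO M) (FO N) Ff"
    unfolding tgt.doi_hopf_map_iff[OF doi_hopf_module_F[OF MN(1)] doi_hopf_module_F[OF MN(2)] lf']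
  proof (intro conjI ballI, goal_cases)
    case (1 z)
    then show ?case
      by (intro ext[where z = z and X = "FS N" and f = "\<lambda>z. Ff (alpha (FO M) z)"]) simp_all
  next
    case (2 a z)
    then show ?case
      by (intro ext[where z = z and X = "FS N" and f = "\<lambda>z. Ff (act (FO M) a z)"]) simp_all
  next
    case (3 z)
    then show ?case
      by (intro ext[where z = z and X = "tensor K (FS N) C" and f = "\<lambda>z. coact (FO N) (Ff z)"]) simp_all
  qed
  then show ?thesis
  proof (rule tgt.doi_hopf_isoI[OF doi_hopf_module_F[OF MN(1)] doi_hopf_module_F[OF MN(2)], where g = Fg])
    show "Ff (Fg z) = z" if "z \<in> carrier (FO N)" for z
      by (rule F_ext[OF MN(2), where z = z and X = "FS N"]) (use that in simp_all)
    show "Fg (Ff z) = z" if "z \<in> carrier (FO M)" for z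
      by (rule F_ext[OF MN(1), where z = z and X = "FS M"]) (use that in simp_all)
  qed simp
qed

section \<open>\<open>F\<close> maps the regular module to the regular module\<close>

text \<open>The exponents in \<open>b \<otimes> a \<mapsto> \<alpha>\<^sup>-\<^sup>3(b) \<lambda>(\<alpha>\<^sup>-\<^sup>2(a))\<close> are forced: with \<open>\<alpha>\<^sup>p(b) \<lambda>(\<alpha>\<^sup>q(a))\<close>,
  balancedness requires \<open>p = q - 1\<close> and \<open>A'\<close>-linearity requires \<open>p + 2 = -1\<close>.\<close>

theorem F_regular: "doi_hopf_iso K tgt.D (FO (dh_regular K D)) (dh_regular K tgt.D)"
proof -
  let ?A = "dh_regular K D" and ?A' = "dh_regular K tgt.D" and ?b = "alpha_inv A'" and ?a = "alpha_inv A"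
  note A = doi_hopf_module_regular note A' = tgt.doi_hopf_module_regular
  note lA = F_act_lin[OF A] F_coact_lin[OF A]
  note [simp] = dh_regular_sel(2,3) tgt.dh_regular_sel(2,3)
    same_space_rules[OF dh_regular_sel(1)] same_space_rules[OF tgt.dh_regular_sel(1)]
    bt_lin[OF A, unfolded same_space_rules[OF dh_regular_sel(1)]]
    bt_closed[OF A, unfolded same_space_rules[OF dh_regular_sel(1)]] F_hom_space[OF A]
    F_alpha_bt[OF A, unfolded same_space_rules[OF dh_regular_sel(1)]]
    F_act_bt[OF A, unfolded same_space_rules[OF dh_regular_sel(1)]]
    F_coact_bt[OF A, unfolded same_space_rules[OF dh_regular_sel(1)]]
    same_space_rules[OF F_obj_space[OF A]] lA
    linear_map_closed[OF lA(1)] linear_map_closed[OF lA(3)] linear_map_compose[OF _ lA(1)] linear_map_compose[OF _ lA(3)]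
  have coact_lin: "linear_map K A' (tensor K A' C) (coact ?A')"
    using hom_comoduleD(2)[OF tgt.doi_hopf_moduleD(2)[OF A']] by simp
  have [simp]: "linear_map K V A' f \<Longrightarrow> linear_map K V (tensor K A' C) (\<lambda>x. coact ?A' (f x))" for V :: "('k, ('b \<times> 'a \<Rightarrow> 'k) set set) hom_space" and f
    by (rule linear_map_compose[OF _ coact_lin])
  let ?th = "\<lambda>b m. ?b (?b (?b b)) \<otimes>\<^bsub>A'\<^esub> l (?a (?a m))"
  have bal: "balanced ?A A' ?th"
    unfolding balanced_def
  proof (intro conjI ballI)
    fix b a m assume [simp]: "b \<in> carrier A'" "a \<in> carrier A" and "m \<in> carrier ?A"
    then have [simp]: "m \<in> carrier A" by simp
    show "?th (b \<otimes>\<^bsub>A'\<^esub> l a) (alpha ?A m) = ?th (alpha A' b) (act ?A a m)"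
      using hom_assoc[OF tgt.A_bialg(1), of "?b (?b (?b b))" "?b (?b (?b (l a)))" "?b (?b (l m))"] by simp
  qed simp
  define th where "th z = bsweedler K A' z ?th" for z
  have lth: "linear_map K (FS ?A) A' th"
    and th [simp]: "\<And>b m. b \<in> carrier A' \<Longrightarrow> m \<in> carrier A \<Longrightarrow> th (bt ?A b m) = ?th b m"
    using bsweedler_linear[OF A tgt.A_alg(1) bal refl] unfolding th_def[abs_def] by simp_all
  note [simp] = lth linear_map_facts[OF lth]
  have lth': "linear_map K (FO ?A) ?A' th" by simp
  note ext = F_ext[OF A]
  have "doi_hopf_map K tgt.D (FO ?A) ?A' th"
    unfolding tgt.doi_hopf_map_iff[OF doi_hopf_module_F[OF A] A' lth']
  proof (intro conjI ballI, goal_cases)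
    case (1 z)
    then show ?case
      by (intro ext[where z = z and X = A' and f = "\<lambda>z. th (alpha (FO ?A) z)"]) simp_all
  next
    case (2 a z)
    then show ?case
    proof (intro ext[where z = z and X = A' and f = "\<lambda>z. th (act (FO ?A) a z)"], goal_cases)
      case (4 b m)
      then show ?case
        using hom_assoc[OF tgt.A_bialg(1), of "?b (?b a)" "?b (?b (?b b))" "?b (?b (l m))"] by simp
    qed simp_all
  next
    case (3 z)
    have ac_one: "ac (w \<otimes>\<^bsub>H\<^esub> v) \<one>\<^bsub>C\<^esub> = ac (alpha H w) (ac v \<one>\<^bsub>C\<^esub>)"
      if "w \<in> carrier H" "v \<in> carrier H" for w v
      using ac_assoc[of w v "\<one>\<^bsub>C\<^esub>"] that by simp
    \<comment> \<open>with the arguments \<open>\<alpha>\<^sup>3(b)\<close> and \<open>\<alpha>\<^sup>2(m)\<close> the inverses in \<open>th\<close> cancel before a coaction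
      leads into \<open>H\<close>, whose structure map need not be invertible\<close>
    have key: "coact ?A' (th (bt ?A (alpha A' (alpha A' (alpha A' b))) (alpha A (alpha A m)))) =
       sw K (FO ?A) C (tensor K ?A' C) (coact (FO ?A) (bt ?A (alpha A' (alpha A' (alpha A' b))) (alpha A (alpha A m))))
         (\<lambda>m0 m1. tens K ?A' C (th m0) m1)" if "b \<in> carrier A'" "m \<in> carrier A" for b m
      using that ac_one by simp
    show ?case
    proof (intro ext[where z = z and X = "tensor K A' C" and f = "\<lambda>z. coact ?A' (th z)"], goal_cases)
      case (4 b m)
      then show ?case using key[of "?b (?b (?b b))" "?a (?a m)"] by simp
    qed (use 3 in simp_all)
  qed
  then show ?thesis
  proof (rule tgt.doi_hopf_isoI[OF doi_hopf_module_F[OF A] A', where g = "\<lambda>b. bt ?A (alpha A' (alpha A' b)) \<one>\<^bsub>A\<^esub>"])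
    show "bt ?A (alpha A' (alpha A' (th z))) \<one>\<^bsub>A\<^esub> = z" if "z \<in> carrier (FO ?A)" for z
    proof (rule ext[where z = z and X = "FS ?A"])
      fix b m assume "b \<in> carrier A'" "m \<in> carrier ?A"
      then show "bt ?A (alpha A' (alpha A' (th (bt ?A b m)))) \<one>\<^bsub>A\<^esub> = bt ?A b m"
        using bt_balanced[OF A, of "?b b" m "\<one>\<^bsub>A\<^esub>"] by simp
    qed (use that in simp_all)
  qed simp_all
qed

end

section \<open>The functor \<open>G\<close> is restriction of scalars\<close>

context doi_morphism
begin

definition restrict_scalars :: "('k, 'b, 'c, 'n) dh_module \<Rightarrow> ('k, 'a, 'c, 'n) dh_module" where
  "restrict_scalars N = make_dh_module (hom_space.truncate N) (\<lambda>a n. act N (l a) n) (coact N)"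

lemma restrict_scalars_sel:
  "same_space (restrict_scalars N) N"
  "act (restrict_scalars N) = (\<lambda>a n. act N (l a) n)"
  "coact (restrict_scalars N) = coact N"
proof -
  show "same_space (restrict_scalars N) N" unfolding restrict_scalars_def
    using same_space_make_dh_module[of "hom_space.truncate N"] same_space_truncate[of N]
    by (simp add: same_space_def)
qed (simp_all add: restrict_scalars_def)

abbreviation "GO N \<equiv> G_obj K D tgt.D l N"
abbreviation "GS N \<equiv> G_space K tgt.D N"

context
  fixes N :: "('k, 'b, 'c, 'n) dh_module"
  assumes N: "doi_hopf_module K tgt.D N"
begin

lemmas N_facts [simp] = tgt.dh_module_facts[OF N]
lemmas N_sw [simp] = tgt.dh_action_sw[OF N]

theorem doi_hopf_module_restrict_scalars: "doi_hopf_module K D (restrict_scalars N)"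
proof -
  note [simp] = restrict_scalars_sel(2,3) same_space_rules[OF restrict_scalars_sel(1)]
  show ?thesis
  proof (rule doi_hopf_moduleI, goal_cases)
    case (8 m)
    have "sw K N C (tensor K N C) (coact N (alpha N m)) (tens K N C) = coact N (alpha N m)"
      using 8 by (intro sw_tens_eq_self) simp_all
    then show ?case using 8 by simp
  next
    case (9 m)
    have "sw K N C (tensor K N (tensor K C C)) (coact N m) (\<lambda>m0 m1. sw K N C (tensor K N (tensor K C C)) (coact N m0) (\<lambda>m00 m01.
         tens K N (tensor K C C) m00 (tens K C C m01 (alpha C m1)))) =
       sw K N C (tensor K N (tensor K C C)) (coact N m) (\<lambda>m0 m1. sw K C C (tensor K N (tensor K C C)) (comul C m1) (\<lambda>y z.
         tens K N (tensor K C C) (alpha N m0) (tens K C C y z)))"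
      by (rule tgt.dh_coassoc[OF N]) (use 9 in \<open>simp_all add: trilinear_map_def\<close>)
    then show ?case using 9 by simp
  next
    case (10 a m)
    have "sw K N C (tensor K N C) (coact N (act N (l a) m)) (tens K N C) = coact N (act N (l a) m)"
      using 10 by (intro sw_tens_eq_self) simp_all
    then show ?case using 10 by simp
  qed simp_all
qed

context
  assumes bij_N: "alpha_bij N"
begin

abbreviation (input) "NC \<equiv> tensor K N C"
abbreviation (input) "ev t \<equiv> sw K N C N t (\<lambda>n c. counit C c \<odot>\<^bsub>N\<^esub> n)"

lemmas aiN_simps [simp] = alpha_inv_simps[OF N_facts(1) bij_N]

lemma G_space_sel:
  "zero (GS N) = zero NC" "add (GS N) = add NC" "smult (GS N) = smult NC" "alpha (GS N) = alpha NC"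
  by (simp_all add: G_space_def Let_def)

lemma G_carrier_iff:
  "t \<in> carrier (GS N) \<longleftrightarrow> t \<in> carrier NC \<and>
     sw K N C (tensor K N (tensor K C C)) t (\<lambda>n c. tens K N (tensor K C C) (alpha N n) (comul C c)) =
     sw K N C (tensor K N (tensor K C C)) t (\<lambda>n c. sw K N C (tensor K N (tensor K C C)) (coact N n) (\<lambda>n0 n1.
          tens K N (tensor K C C) n0 (tens K C C n1 (alpha C c))))"
proof -
  let ?X = "tensor K N (tensor K C C)"
  have 1: "sweedler K ?X t (\<lambda>n c. tens K N (tensor K C C) (alpha N n) (comul C c)) =
      sw K N C ?X t (\<lambda>n c. tens K N (tensor K C C) (alpha N n) (comul C c))" if "t \<in> carrier NC" for t
    by (rule sweedler_eqI) (use that in \<open>simp_all del: tens_comul\<close>)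
  have 2: "sweedler K ?X t (\<lambda>n c. sweedler K ?X (coact N n) (\<lambda>n0 n1. tens K N (tensor K C C) n0 (tens K C C n1 (alpha C c)))) =
      sw K N C ?X t (\<lambda>n c. sw K N C ?X (coact N n) (\<lambda>n0 n1. tens K N (tensor K C C) n0 (tens K C C n1 (alpha C c))))"
    if "t \<in> carrier NC" for t
    by (intro sweedler_eqI) (use that in simp_all)
  show ?thesis using 1 2 unfolding G_space_def Let_def by auto
qed

lemma G_closed [simp]: "t \<in> carrier (GS N) \<Longrightarrow> t \<in> carrier NC"
  by (simp add: G_carrier_iff)

text \<open>The coaction lands in the cotensor product by coassociativity.\<close>

lemma coact_in_G:
  assumes [simp]: "n \<in> carrier N" shows "coact N n \<in> carrier (GS N)"
proof -
  have "sw K N C (tensor K N (tensor K C C)) (coact N n) (\<lambda>m0 m1. sw K N C (tensor K N (tensor K C C)) (coact N m0) (\<lambda>m00 m01.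
         tens K N (tensor K C C) m00 (tens K C C m01 (alpha C m1)))) =
       sw K N C (tensor K N (tensor K C C)) (coact N n) (\<lambda>m0 m1. sw K C C (tensor K N (tensor K C C)) (comul C m1) (\<lambda>y z.
         tens K N (tensor K C C) (alpha N m0) (tens K C C y z)))"
    by (rule tgt.dh_coassoc[OF N]) (simp_all add: trilinear_map_def)
  then show ?thesis unfolding G_carrier_iff by simp
qed

text \<open>Conversely, applying the counit to the last leg of the equation defining \<open>G\<close> shows that
  its elements are in the image of the coaction. The equation obtained is \<open>\<rho>(ev t) = (\<alpha> \<otimes> \<alpha>)(t)\<close>,
  which accounts for the inverse of \<open>\<alpha>\<^sub>N\<close>.\<close>

lemma G_elem:
  assumes t: "t \<in> carrier (GS N)"
  shows "coact N (alpha_inv N (ev t)) = t"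
proof -
  have t [simp]: "t \<in> carrier NC" and eq: "sw K N C (tensor K N (tensor K C C)) t (\<lambda>n c. tens K N (tensor K C C) (alpha N n) (comul C c)) =
     sw K N C (tensor K N (tensor K C C)) t (\<lambda>n c. sw K N C (tensor K N (tensor K C C)) (coact N n) (\<lambda>n0 n1.
          tens K N (tensor K C C) n0 (tens K C C n1 (alpha C c))))"
    using t unfolding G_carrier_iff by blast+
  let ?k = "\<lambda>x y z. counit C z \<odot>\<^bsub>NC\<^esub> tens K N C x y"
  have tri: "trilinear_map N C C NC ?k" by (simp add: trilinear_map_def)
  have "sw K N C NC t (\<lambda>n c. sw K C C NC (comul C c) (?k (alpha N n))) =
      sw K N C NC t (\<lambda>n c. sw K N C NC (coact N n) (\<lambda>n0 n1. ?k n0 n1 (alpha C c)))"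
    using arg_cong[OF eq, of "\<lambda>s. sw3 N C C NC s ?k"] tri
    by (simp add: sw3_left sw3_right del: tens_comul)
  also have "\<dots> = sw K N C NC t (\<lambda>n c. counit C c \<odot>\<^bsub>NC\<^esub> coact N n)"
    by (simp add: sw_tens_eq_self)
  also have "\<dots> = coact N (ev t)"
    by (simp add: linear_map_smult[OF N_facts(10)])
  also have "sw K N C NC t (\<lambda>n c. sw K C C NC (comul C c) (?k (alpha N n))) = sw K N C NC t (\<lambda>n c. tens K N C (alpha N n) (alpha C c))"
    by simp
  finally have e: "coact N (ev t) = sw K N C NC t (\<lambda>n c. tens K N C (alpha N n) (alpha C c))" by simp
  let ?b = "\<lambda>t. sw K N C NC t (\<lambda>n c. tens K N C (alpha_inv N n) (ai c))"
  have "coact N (ev t) = coact N (alpha N (alpha_inv N (ev t)))" by simp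
  also have "\<dots> = sw K N C NC (coact N (alpha N (alpha_inv N (ev t)))) (tens K N C)"
    by (rule sw_tens_eq_self[symmetric]) simp_all
  also have "\<dots> = sw K N C NC (coact N (alpha_inv N (ev t))) (\<lambda>n c. tens K N C (alpha N n) (alpha C c))"
    by (subst N_facts(13)) simp_all
  finally have "?b (sw K N C NC (coact N (alpha_inv N (ev t))) (\<lambda>n c. tens K N C (alpha N n) (alpha C c))) =
      ?b (sw K N C NC t (\<lambda>n c. tens K N C (alpha N n) (alpha C c)))" using e by simp
  then show ?thesis by (simp add: sw_tens_eq_self)
qed

lemma G_carrier: "carrier (GS N) = coact N ` carrier N"
proof (intro equalityI subsetI)
  fix t assume t: "t \<in> carrier (GS N)"
  then have "t \<in> carrier NC" unfolding G_carrier_iff by blast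
  then have "alpha_inv N (ev t) \<in> carrier N" by simp
  then show "t \<in> coact N ` carrier N" using G_elem[OF t] by (metis imageI)
qed (auto simp: coact_in_G)

lemma G_coact_lin [simp]: "linear_map K N (GS N) (coact N)"
  using N_facts(10) coact_in_G unfolding linear_map_def G_space_sel by auto

lemma G_hom_space [simp]: "hom_space K (GS N)"
proof -
  have m: "module K (GS N)"
  proof (rule module_image[where V = N and p = "coact N"])
    show "coact N ` carrier N = carrier (GS N)" by (simp add: G_carrier)
  qed (auto simp: G_space_sel linear_map_add[OF N_facts(10)] linear_map_smult[OF N_facts(10)]
      linear_map_zero[OF _ _ N_facts(10)])
  have a: "alpha NC (coact N n) = coact N (alpha N n)" if "n \<in> carrier N" for n
    using hom_comodule_iff[OF C_bialg(2) N_facts(1,10)] tgt.doi_hopf_moduleD(2)[OF N] that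
    by (simp add: alpha_tensor_sw)
  have "linear_map K (GS N) (GS N) (alpha (GS N))"
  proof (rule linear_mapI)
    show "alpha (GS N) x \<in> carrier (GS N)" if "x \<in> carrier (GS N)" for x
      using that by (auto simp: G_carrier G_space_sel a)
  qed (simp_all add: G_space_sel linear_map_add[OF hom_space_alpha_linear] linear_map_smult[OF hom_space_alpha_linear])
  then show ?thesis using m unfolding hom_space_def by blast
qed

lemma G_incl [simp]: "linear_map K (GS N) NC (\<lambda>t. t)"
  by (simp add: linear_map_def G_space_sel G_carrier_iff)

lemma G_tens_lin [simp]: "c \<in> carrier C \<Longrightarrow> linear_map K (GS N) (tensor K NC C) (\<lambda>e. tens K NC C e c)"
  by (rule linear_map_compose[OF G_incl]) simp

lemma G_obj_space: "same_space (GO N) (GS N)"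
  unfolding G_obj_def Let_def datum.simps by (simp add: same_space_def make_dh_module_def hom_space.extend_def dh_module.fields_def)

lemma G_act:
  assumes [simp]: "a \<in> carrier A" "n \<in> carrier N"
  shows "act (GO N) a (coact N n) = coact N (act N (l a) n)"
proof -
  have "act (GO N) a (coact N n) = sw K A H NC (co a) (\<lambda>a0 a1. sw K N C NC (coact N n) (\<lambda>n c. tens K N C (act N (l a0) n) (ac a1 c)))"
    unfolding G_obj_def Let_def make_dh_module_sel datum.simps by (intro sweedler_eqI) simp_all
  also have "\<dots> = sw K N C NC (coact N (act N (l a) n)) (tens K N C)" by simp
  also have "\<dots> = coact N (act N (l a) n)" by (rule sw_tens_eq_self) simp_all
  finally show ?thesis .
qed

text \<open>The coaction of \<open>G(N)\<close> is defined as the unique element of \<open>G(N) \<otimes> C\<close> with a prescribed image in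
  \<open>(N \<otimes> C) \<otimes> C\<close>. It exists by coassociativity, and it is unique because \<open>x \<mapsto> \<rho>(\<alpha>\<^sup>-\<^sup>1(ev x))\<close> is a
  linear retraction of \<open>N \<otimes> C\<close> onto \<open>G(N)\<close>, which makes the map to \<open>(N \<otimes> C) \<otimes> C\<close> injective.\<close>

lemma G_coact:
  assumes n [simp]: "n \<in> carrier N"
  shows "coact (GO N) (coact N n) = sw K N C (tensor K (GS N) C) (coact N n) (\<lambda>n0 n1. tens K (GS N) C (coact N n0) n1)"
proof -
  let ?T = "tensor K NC C" and ?E = "tensor K (GS N) C"
  let ?r = "sweedler K ?T (coact N n) (\<lambda>n c. sweedler K ?T (comul C c) (\<lambda>c1 c2.
            tens K NC C (tens K N C (alpha N n) c1) (ai c2)))"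
  let ?u = "sw K N C ?E (coact N n) (\<lambda>n0 n1. tens K (GS N) C (coact N n0) n1)"
  let ?j = "\<lambda>u. sw K (GS N) C ?T u (tens K NC C)"
  have j: "sweedler K ?T u (\<lambda>e c. tens K NC C e c) = ?j u" if "u \<in> carrier ?E" for u
    by (rule sweedler_eqI) (use that in simp_all)
  have r: "?r = sw K N C ?T (coact N n) (\<lambda>n c. sw K C C ?T (comul C c) (\<lambda>c1 c2.
            tens K NC C (tens K N C (alpha N n) c1) (ai c2)))"
    by (intro sweedler_eqI) simp_all
  also have "\<dots> = sw K N C ?T (coact N n) (\<lambda>n0 n1. sw K N C ?T (coact N n0) (\<lambda>n00 n01.
            tens K NC C (tens K N C n00 n01) (ai (alpha C n1))))"
    by (rule tgt.dh_coassoc[OF N, symmetric]) (simp_all add: trilinear_map_def)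
  also have "\<dots> = sw K N C ?T (coact N n) (\<lambda>n0 n1. tens K NC C (sw K N C NC (coact N n0) (tens K N C)) n1)"
    by simp
  also have "\<dots> = ?j ?u"
    by (simp add: sw_tens_eq_self coact_in_G linear_map_compose[OF _ G_coact_lin])
  finally have ru: "?r = ?j ?u" .
  have u: "?u \<in> carrier ?E" by (simp add: coact_in_G)
  have inj: "u = v" if uv [simp]: "u \<in> carrier ?E" "v \<in> carrier ?E" and "?j u = ?j v" for u v
  proof -
    let ?g = "\<lambda>s. sw K NC C ?E s (\<lambda>x c. tens K (GS N) C (coact N (alpha_inv N (ev x))) c)"
    have [simp]: "linear_map K NC (GS N) (\<lambda>x. coact N (alpha_inv N (ev x)))"
      by (rule linear_map_compose[OF _ G_coact_lin]) simp
    have [simp]: "linear_map K NC ?E (\<lambda>x. tens K (GS N) C (coact N (alpha_inv N (ev x))) c)" if "c \<in> carrier C" for c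
      using that by simp
    have "?g (?j w) = w" if [simp]: "w \<in> carrier ?E" for w
    proof -
      have "?g (?j w) = sw K (GS N) C ?E w (\<lambda>e c. tens K (GS N) C (coact N (alpha_inv N (ev e))) c)"
        by (simp add: coact_in_G del: N_sw)
      also have "\<dots> = sw K (GS N) C ?E w (tens K (GS N) C)"
        by (rule sw_cong[OF refl refl]) (simp only: G_elem)
      also have "\<dots> = w" by (rule sw_tens_eq_self) simp_all
      finally show ?thesis .
    qed
    then show "u = v" using that by metis
  qed
  have "coact (GO N) (coact N n) = (THE u. u \<in> carrier ?E \<and> sweedler K ?T u (\<lambda>e c. tens K NC C e c) = ?r)"
    unfolding G_obj_def Let_def make_dh_module_sel datum.simps ..
  also have "\<dots> = ?u"
  proof (rule the_equality)
    show "?u \<in> carrier ?E \<and> sweedler K ?T ?u (\<lambda>e c. tens K NC C e c) = ?r"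
      using u j[OF u] ru by simp
    show "u = ?u" if "u \<in> carrier ?E \<and> sweedler K ?T u (\<lambda>e c. tens K NC C e c) = ?r" for u
      using that j[of u] ru inj[OF _ u] by metis
  qed
  finally show ?thesis .
qed

theorem G_iso_restrict_scalars: "doi_hopf_iso K D (restrict_scalars N) (GO N)"
proof -
  note r = restrict_scalars_sel(2,3) same_space_rules[OF restrict_scalars_sel(1)] same_space_rules[OF G_obj_space]
  have a: "alpha NC (coact N n) = coact N (alpha N n)" if "n \<in> carrier N" for n
    using hom_comodule_iff[OF C_bialg(2) N_facts(1,10)] tgt.doi_hopf_moduleD(2)[OF N] that
    by (simp add: alpha_tensor_sw)
  show ?thesis
    by (rule doi_hopf_transport[OF doi_hopf_module_restrict_scalars, where f = "coact N" and g = "\<lambda>t. alpha_inv N (ev t)"])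
      (simp_all add: r G_elem coact_in_G a G_space_sel G_act G_coact)
qed

end

end

end

section \<open>The projection formula\<close>

context doi_datum
begin

lemma alpha_inv_act:
  assumes "doi_hopf_module K D N" "alpha_bij N" "a \<in> carrier A" "n \<in> carrier N"
  shows "alpha_inv N (act N a n) = act N (alpha_inv A a) (alpha_inv N n)"
proof -
  note [simp] = dh_module_facts[OF assms(1)] alpha_inv_simps[OF dh_module_facts(1)[OF assms(1)] assms(2)] assms(3,4)
  show ?thesis by (rule alpha_inv_eqI[OF dh_module_facts(1)[OF assms(1)] assms(2)]) simp_all
qed

lemma sw_coact_alpha_inv:
  assumes N: "doi_hopf_module K D N" and b: "alpha_bij N" and X: "hom_space K X" and g: "bilinear_map K N C X g"
    and n: "n \<in> carrier N"
  shows "sw K N C X (coact N (alpha_inv N n)) g = sw K N C X (coact N n) (\<lambda>x y. g (alpha_inv N x) (ai y))"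
proof -
  note [simp] = dh_module_facts[OF N] alpha_inv_simps[OF dh_module_facts(1)[OF N] b] X n
  have [simp]: "linear_map K N X (\<lambda>x. g (alpha_inv N x) c)" if "c \<in> carrier C" for c
    by (rule linear_map_compose[OF _ bilinear_mapD(2)[OF g that]]) simp
  have [simp]: "linear_map K C X (\<lambda>y. g x (ai y))" if "x \<in> carrier N" for x
    by (rule linear_map_compose[OF _ bilinear_mapD(1)[OF g that]]) simp
  have "sw K N C X (coact N (alpha N (alpha_inv N n))) (\<lambda>x y. g (alpha_inv N x) (ai y)) =
    sw K N C X (coact N (alpha_inv N n)) (\<lambda>x y. g (alpha_inv N (alpha N x)) (ai (alpha C y)))"
    by (rule dh_module_facts(13)[OF N]) simp_all
  then show ?thesis by simp
qed

text \<open>Where the convolution product of \<open>u\<close> and \<open>v\<close> is the unit, acting first with one leg through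
  \<open>v\<close> and then with the neighbouring leg through \<open>u\<close> cancels: coassociativity makes the two legs the
  comultiplication of one element. The instances are an antipode and the identity, in both orders, and
  the pair \<open>\<lambda>\<close>, \<open>S \<circ> \<lambda>\<close>.\<close>

lemma convolution_cancel:
  assumes N: "doi_hopf_module K D N" and B: "hom_coalgebra K B" "alpha_bij B"
    and u: "linear_map K B A u" "\<And>b. b \<in> carrier B \<Longrightarrow> u (alpha B b) = alpha A (u b)"
    and v: "linear_map K B A v" "\<And>b. b \<in> carrier B \<Longrightarrow> v (alpha B b) = alpha A (v b)"
    and conv: "\<And>b. b \<in> carrier B \<Longrightarrow> sw K B B A (comul B b) (\<lambda>x y. u x \<otimes>\<^bsub>A\<^esub> v y) = counit B b \<odot>\<^bsub>A\<^esub> \<one>\<^bsub>A\<^esub>"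
    and X: "hom_space K X" and g: "bilinear_map K B N X g" and b: "b \<in> carrier B" and n: "n \<in> carrier N"
  shows "sw K B B X (comul B b) (\<lambda>b1 b2. sw K B B X (comul B b1) (\<lambda>x y. g x (act N (u y) (act N (v b2) n)))) =
    g (alpha B (alpha B b)) (alpha N (alpha N n))"
proof -
  note [simp] = dh_module_facts[OF N] hom_coalgebraD[OF B(1)] X b n u v
    alpha_inv_simps[OF hom_coalgebraD(1)[OF B(1)] B(2)]
    linear_map_facts[OF u(1)] linear_map_facts[OF v(1)]
  have gl [simp]: "linear_map K V X (\<lambda>x. g (f x) w)" if "linear_map K V B f" "w \<in> carrier N" for V :: "('k, 'd) hom_space" and f w
    by (rule linear_map_compose[OF that(1) bilinear_mapD(2)[OF g that(2)]])
  have gB [simp]: "linear_map K B X (\<lambda>x. g (f x) w)" if "linear_map K B B f" "w \<in> carrier N" for f w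
    by (rule linear_map_compose[OF that(1) bilinear_mapD(2)[OF g that(2)]])
  have gNB [simp]: "linear_map K B X (\<lambda>x. g z (f x))" if "linear_map K B N f" "z \<in> carrier B" for f z
    by (rule linear_map_compose[OF that(1) bilinear_mapD(1)[OF g that(2)]])
  have gNA [simp]: "linear_map K A X (\<lambda>x. g z (f x))" if "linear_map K A N f" "z \<in> carrier B" for f z
    by (rule linear_map_compose[OF that(1) bilinear_mapD(1)[OF g that(2)]])
  have gc [simp]: "g x y \<in> carrier X" if "x \<in> carrier B" "y \<in> carrier N" for x y
    by (rule bilinear_map_closed[OF g that])
  let ?b = "alpha_inv B"
  have vb: "v x = alpha A (v (?b x))" if "x \<in> carrier B" for x using that by (simp flip: v(2))
  have ub: "u x = alpha A (u (?b x))" if "x \<in> carrier B" for x using that by (simp flip: u(2))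
  \<comment> \<open>the inverse structure map in \<open>?k\<close> turns \<open>b2\<close> into the \<open>\<alpha>(b2)\<close> that coassociativity expects\<close>
  let ?k = "\<lambda>x y w. g x (act N (u y) (act N (v (?b w)) n))"
  have "sw K B B X (comul B b) (\<lambda>b1 b2. sw K B B X (comul B b1) (\<lambda>x y. g x (act N (u y) (act N (v b2) n)))) =
     sw K B B X (comul B b) (\<lambda>b1 b2. sw K B B X (comul B b1) (\<lambda>x y. ?k x y (alpha B b2)))"
    by simp
  also have "\<dots> = sw K B B X (comul B b) (\<lambda>b1 b2. sw K B B X (comul B b2) (\<lambda>y1 y2. ?k (alpha B b1) y1 y2))"
    by (rule sw_coassoc[OF B(1)]) (simp_all add: trilinear_map_def)
  also have "\<dots> = sw K B B X (comul B b) (\<lambda>b1 b2. counit B b2 \<odot>\<^bsub>X\<^esub> g (alpha B b1) (alpha N (alpha N n)))"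
  proof (rule sw_cong[OF refl refl])
    fix b1 b2 assume b12 [simp]: "b1 \<in> carrier B" "b2 \<in> carrier B"
    let ?h = "\<lambda>w. g (alpha B b1) (act N (alpha_inv A w) (alpha N n))"
    have h: "linear_map K A X ?h" by simp
    have "sw K B B X (comul B b2) (\<lambda>y1 y2. ?k (alpha B b1) y1 y2) = sw K B B X (comul B b2) (\<lambda>x y. ?h (u x \<otimes>\<^bsub>A\<^esub> v y))"
    proof (rule sw_cong[OF refl refl])
      fix y1 y2 assume y [simp]: "y1 \<in> carrier B" "y2 \<in> carrier B"
      have "act N (u y1) (act N (v (?b y2)) n) = act N (alpha A (u (?b y1))) (act N (v (?b y2)) n)"
        by (subst ub[of y1]) simp_all
      also have "\<dots> = act N (u (?b y1) \<otimes>\<^bsub>A\<^esub> v (?b y2)) (alpha N n)" by (simp del: u(2) v(2))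
      also have "u (?b y1) \<otimes>\<^bsub>A\<^esub> v (?b y2) = alpha_inv A (u y1 \<otimes>\<^bsub>A\<^esub> v y2)"
        by (subst ub[of y1], simp, subst vb[of y2], simp, simp del: u(2) v(2))
      finally show "?k (alpha B b1) y1 y2 = ?h (u y1 \<otimes>\<^bsub>A\<^esub> v y2)" by simp
    qed
    also have "\<dots> = ?h (sw K B B A (comul B b2) (\<lambda>x y. u x \<otimes>\<^bsub>A\<^esub> v y))"
      by (rule push_linear[OF h, symmetric]) simp_all
    also have "\<dots> = counit B b2 \<odot>\<^bsub>X\<^esub> ?h \<one>\<^bsub>A\<^esub>"
      by (simp only: conv b12, rule linear_map_smult[OF h]) simp_all
    finally show "sw K B B X (comul B b2) (\<lambda>y1 y2. ?k (alpha B b1) y1 y2) = counit B b2 \<odot>\<^bsub>X\<^esub> g (alpha B b1) (alpha N (alpha N n))"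
      by simp
  qed
  also have "\<dots> = g (alpha B (alpha B b)) (alpha N (alpha N n))"
    by (rule sw_counit(2)[OF B(1)]) simp_all
  finally show ?thesis .
qed

end

context doi_morphism
begin

context
  fixes M :: "('k, 'a, 'c, 'm) dh_module" and N :: "('k, 'b, 'c, 'n) dh_module"
  assumes M: "doi_hopf_module K D M" and N: "doi_hopf_module K tgt.D N" and bij_N: "alpha_bij N"
begin

abbreviation "MN \<equiv> dh_tensor K D M (restrict_scalars N)"
abbreviation "FMN \<equiv> dh_tensor K tgt.D (FO M) N"
abbreviation (input) "mn \<equiv> tensor K M N"
abbreviation (input) "fmn \<equiv> tensor K (FS M) N"
abbreviation (input) "bi \<equiv> alpha_inv A'"
abbreviation (input) "ni \<equiv> alpha_inv N"

lemmas pf_facts [simp] = dh_module_facts[OF M] tgt.dh_module_facts[OF N] tgt.dh_action_sw[OF N]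
  alpha_inv_simps[OF tgt.dh_module_facts(1)[OF N] bij_N] M_F[OF M] F_hom_space[OF M] F_alpha_bt[OF M]
  F_act_bt[OF M] F_coact_bt[OF M] F_obj_sw[OF M] bt_sw[OF M] same_space_rules[OF F_obj_space[OF M]]
  F_act_lin[OF M] linear_map_facts[OF F_act_lin(1)[OF M]]
  linear_map_facts[OF F_coact_lin[OF M]] F_coact_lin[OF M]
  linear_map_compose[OF _ F_act_lin(2)[OF M]]

lemma MN_module: "doi_hopf_module K D MN"
  by (rule doi_hopf_module_tensor[OF M doi_hopf_module_restrict_scalars[OF N]])

lemma FMN_module: "doi_hopf_module K tgt.D FMN"
  by (rule tgt.doi_hopf_module_tensor[OF doi_hopf_module_F[OF M] N])

lemma MN_sel:
  "same_space MN mn"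
  "a \<in> carrier A \<Longrightarrow> t \<in> carrier mn \<Longrightarrow> act MN a t =
      sw K A A mn (comul A a) (\<lambda>a1 a2. sw K M N mn t (\<lambda>m n. tens K M N (act M a1 m) (act N (l a2) n)))"
  "t \<in> carrier mn \<Longrightarrow> coact MN t =
      sw K M N (tensor K mn C) t (\<lambda>m n. sw K M C (tensor K mn C) (coact M m) (\<lambda>m0 m1.
          sw K N C (tensor K mn C) (coact N n) (\<lambda>n0 n1. tens K mn C (tens K M N m0 n0) (ai (ai (m1 \<otimes>\<^bsub>C\<^esub> n1))))))"
  using dh_tensor_sel[OF M doi_hopf_module_restrict_scalars[OF N]]
  by (simp_all add: restrict_scalars_sel(2,3) same_space_rules[OF restrict_scalars_sel(1)])

lemma FMN_sel:
  "same_space FMN fmn"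
  "a \<in> carrier A' \<Longrightarrow> t \<in> carrier fmn \<Longrightarrow> act FMN a t =
      sw K A' A' fmn (comul A' a) (\<lambda>a1 a2. sw K (FS M) N fmn t (\<lambda>m n. tens K (FS M) N (act (FO M) a1 m) (act N a2 n)))"
  "t \<in> carrier fmn \<Longrightarrow> coact FMN t =
      sw K (FS M) N (tensor K fmn C) t (\<lambda>m n. sw K (FS M) C (tensor K fmn C) (coact (FO M) m) (\<lambda>m0 m1.
          sw K N C (tensor K fmn C) (coact N n) (\<lambda>n0 n1. tens K fmn C (tens K (FS M) N m0 n0) (ai (ai (m1 \<otimes>\<^bsub>C\<^esub> n1))))))"
  using tgt.dh_tensor_sel[OF doi_hopf_module_F[OF M] N] by simp_all

lemmas MN_lin = dh_tensor_lin[OF M doi_hopf_module_restrict_scalars[OF N],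
    unfolded same_space_rules[OF restrict_scalars_sel(1)]]
lemmas FMN_lin = tgt.dh_tensor_lin[OF doi_hopf_module_F[OF M] N, unfolded same_space_rules[OF F_obj_space[OF M]]]

lemmas bt_MN [simp] = bt_lin[OF MN_module, unfolded same_space_rules[OF MN_sel(1)]]
  bt_closed[OF MN_module, unfolded same_space_rules[OF MN_sel(1)]]
  F_hom_space[OF MN_module] F_alpha_bt[OF MN_module, unfolded same_space_rules[OF MN_sel(1)]]
  F_act_bt[OF MN_module, unfolded same_space_rules[OF MN_sel(1)]]
  F_coact_bt[OF MN_module, unfolded same_space_rules[OF MN_sel(1)]]
  F_obj_sw[OF MN_module] bt_sw[OF MN_module, unfolded same_space_rules[OF MN_sel(1)]]

lemmas pf_spaces [simp] = same_space_rules[OF MN_sel(1)] same_space_rules[OF FMN_sel(1)]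
  same_space_rules[OF F_obj_space[OF MN_module]]
  MN_sel(2,3) FMN_sel(2,3)
  MN_lin linear_map_closed[OF MN_lin(2)] linear_map_closed[OF MN_lin(3)]
  linear_map_compose[OF _ MN_lin(2)] linear_map_compose[OF _ MN_lin(3)]
  FMN_lin linear_map_closed[OF FMN_lin(2)] linear_map_closed[OF FMN_lin(3)]
  linear_map_compose[OF _ FMN_lin(2)] linear_map_compose[OF _ FMN_lin(3)]

text \<open>The exponent \<open>-2\<close> in \<open>(b\<^sub>1 \<otimes> m) \<otimes> \<alpha>\<^sup>-\<^sup>2(b\<^sub>2 \<cdot> n)\<close> is forced by \<open>A'\<close>-linearity, as
  \<open>\<alpha>(a) b\<close> acts on \<open>\<alpha>(n)\<close> like \<open>\<alpha>\<^sup>2(a)\<close> after \<open>b\<close> does on \<open>n\<close>.\<close>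

definition Phi_fun where
  "Phi_fun b t = sw K A' A' fmn (comul A' b) (\<lambda>b1 b2. sw K M N fmn t (\<lambda>m n.
     tens K (FS M) N (bt M b1 m) (ni (ni (act N b2 n)))))"

lemma Phi_balanced: "balanced MN fmn Phi_fun"
  unfolding balanced_def
proof (intro conjI ballI)
  show "bilinear_map K A' MN fmn Phi_fun" unfolding Phi_fun_def by simp
  fix b a t assume b [simp]: "b \<in> carrier A'" and a [simp]: "a \<in> carrier A" and "t \<in> carrier MN"
  then have t: "t \<in> carrier mn" by simp
  show "Phi_fun (b \<otimes>\<^bsub>A'\<^esub> l a) (alpha MN t) = Phi_fun (alpha A' b) (act MN a t)"
    by (rule tensor_ext'[where V = M and W = N and t = t and X = fmn and f = "\<lambda>t. Phi_fun (b \<otimes>\<^bsub>A'\<^esub> l a) (alpha MN t)"])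
      (use t in \<open>simp_all add: Phi_fun_def bt_balanced[OF M]\<close>)
qed

definition Phi where "Phi z = bsweedler K fmn z Phi_fun"

lemma Phi_lin: "linear_map K (FS MN) fmn Phi"
  and Phi_bt: "b \<in> carrier A' \<Longrightarrow> t \<in> carrier mn \<Longrightarrow> Phi (bt MN b t) = Phi_fun b t"
  using bsweedler_linear[OF MN_module _ Phi_balanced refl] unfolding Phi_def[abs_def] by simp_all

lemmas Phi_simps [simp] = Phi_lin linear_map_facts[OF Phi_lin]

lemma Phi_bt_tens [simp]: "b \<in> carrier A' \<Longrightarrow> m \<in> carrier M \<Longrightarrow> n \<in> carrier N \<Longrightarrow> Phi (bt MN b (tens K M N m n)) =
   sw K A' A' fmn (comul A' b) (\<lambda>b1 b2. tens K (FS M) N (bt M b1 m) (ni (ni (act N b2 n))))"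
  by (simp add: Phi_bt Phi_fun_def)

lemma FMN_ext:
  assumes z: "z \<in> carrier (FS MN)" and f: "linear_map K (FS MN) X f" and g: "linear_map K (FS MN) X g"
    and fg: "\<And>b m n. b \<in> carrier A' \<Longrightarrow> m \<in> carrier M \<Longrightarrow> n \<in> carrier N \<Longrightarrow>
      f (bt MN b (tens K M N m n)) = g (bt MN b (tens K M N m n))"
  shows "f z = g z"
proof (rule F_ext[OF MN_module z f g])
  fix b t assume b: "b \<in> carrier A'" and "t \<in> carrier MN"
  then have t: "t \<in> carrier mn" by simp
  note lb = bt_MN(3)[OF b]
  show "f (bt MN b t) = g (bt MN b t)"
    by (rule tensor_ext'[OF _ _ t linear_map_compose[OF lb f] linear_map_compose[OF lb g]])
      (use b fg in simp_all)
qed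

text \<open>Colinearity on \<open>b \<otimes> (m \<otimes> n)\<close> is the compatibility condition of a monoidal datum for the coactions
  of \<open>m\<close> and \<open>n\<close>.\<close>

theorem Phi_doi_hopf_map: "doi_hopf_map K tgt.D (FO MN) FMN Phi"
proof -
  have lin: "linear_map K (FO MN) FMN Phi" by simp
  note lMN = F_act_lin[OF MN_module] F_coact_lin[OF MN_module]
  note [simp] = lMN linear_map_closed[OF lMN(1)] linear_map_closed[OF lMN(3)]
    linear_map_compose[OF _ lMN(1)] linear_map_compose[OF _ lMN(3)]
  show ?thesis
    unfolding tgt.doi_hopf_map_iff[OF doi_hopf_module_F[OF MN_module] FMN_module lin]
  proof (intro conjI ballI, goal_cases)
    case (1 z)
    then show ?case
      by (intro FMN_ext[where z = z and X = fmn and f = "\<lambda>z. Phi (alpha (FO MN) z)"])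
        (simp_all add: tgt.alpha_inv_act[OF N bij_N])
  next
    case (2 a z)
    have assoc: "act N x (act N y n) = act N (bi x \<otimes>\<^bsub>A'\<^esub> y) (alpha N n)"
      if "x \<in> carrier A'" "y \<in> carrier A'" "n \<in> carrier N" for x y n
      using that tgt.dh_module_facts(9)[OF N, of "bi x" y n] by simp
    from 2 show ?case
      by (intro FMN_ext[where z = z and X = fmn and f = "\<lambda>z. Phi (act (FO MN) a z)"])
        (simp_all add: tgt.alpha_inv_act[OF N bij_N] assoc)
  next
    case (3 z)
    then show ?case
    proof (intro FMN_ext[where z = z and X = "tensor K fmn C" and f = "\<lambda>z. coact FMN (Phi z)"], goal_cases)
      case (4 b m n)
      let ?X = "tensor K fmn C"
      have "sw K A' H ?X (co' b) (\<lambda>b0 b1. sw K M C ?X (coact M m) (\<lambda>u u1. sw K N C ?X (coact N n) (\<lambda>w w1.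
         sw K A' A' ?X (comul A' b0) (\<lambda>x y. tens K fmn C (tens K (FS M) N (bt M x u) (ni (ni (act N y w))))
           (ai (ai (ai (ai (ac (alpha H (alpha H b1)) (u1 \<otimes>\<^bsub>C\<^esub> w1)))))))))) =
        sw K A' A' ?X (comul A' b) (\<lambda>a1 a2. sw K A' H ?X (co' a1) (\<lambda>x a11. sw K M C ?X (coact M m) (\<lambda>u u1.
         sw K A' H ?X (co' a2) (\<lambda>y a21. sw K N C ?X (coact N n) (\<lambda>w w1.
           tens K fmn C (tens K (FS M) N (bt M x u) (ni (ni (act N y w))))
           (ai (ai (ai (ai (ac a11 u1 \<otimes>\<^bsub>C\<^esub> ac a21 w1))))))))))"
        by (rule tgt.sw_monoidal_pair) (use 4 in \<open>simp_all add: trilinear_map_def\<close>)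
      then show ?case using 4 by (simp add: tgt.sw_coact_alpha_inv[OF N bij_N] tgt.sw_coact_act[OF N])
    qed simp_all
  qed
qed

context
  fixes S :: "'b \<Rightarrow> 'b"
  assumes antip: "antipode K A' S"
begin

lemma antipode_simps [simp]:
  "linear_map K A' A' S" "b \<in> carrier A' \<Longrightarrow> S b \<in> carrier A'"
  "linear_map K V A' f \<Longrightarrow> linear_map K V A' (\<lambda>x. S (f x))"
  "b \<in> carrier A' \<Longrightarrow> S (alpha A' b) = alpha A' (S b)"
proof -
  show lS: "linear_map K A' A' S" using antip unfolding antipode_def by blast
  show "b \<in> carrier A' \<Longrightarrow> S b \<in> carrier A'" by (rule linear_map_closed[OF lS])
  show "linear_map K V A' f \<Longrightarrow> linear_map K V A' (\<lambda>x. S (f x))" by (rule linear_map_compose[OF _ lS])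
  show "b \<in> carrier A' \<Longrightarrow> S (alpha A' b) = alpha A' (S b)" using antip unfolding antipode_def by blast
qed

lemma antipode_alpha_inv [simp]: "b \<in> carrier A' \<Longrightarrow> S (bi b) = bi (S b)"
  by (rule alpha_inv_eqI[OF tgt.A_alg(1) tgt.bij_A, symmetric]) (simp_all flip: antipode_simps(4))

lemmas sw_antip = sw_antipode[OF tgt.bialgebras(2) antip]

lemma cancel_S_id:
  assumes "hom_space K X" "bilinear_map K A' N X g" "b \<in> carrier A'" "n \<in> carrier N"
  shows "sw K A' A' X (comul A' b) (\<lambda>b1 b2. sw K A' A' X (comul A' b1) (\<lambda>x y. g x (act N (S y) (act N b2 n)))) =
    g (alpha A' (alpha A' b)) (alpha N (alpha N n))"
  by (rule tgt.convolution_cancel[OF N tgt.A_bialg(2) tgt.bij_A _ _ _ _ _ assms, where v = "\<lambda>b. b"])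
    (use sw_antip(1)[OF tgt.A_alg(1) lin_id] in simp_all)

lemma cancel_id_S:
  assumes "hom_space K X" "bilinear_map K A' N X g" "b \<in> carrier A'" "n \<in> carrier N"
  shows "sw K A' A' X (comul A' b) (\<lambda>b1 b2. sw K A' A' X (comul A' b1) (\<lambda>x y. g x (act N y (act N (S b2) n)))) =
    g (alpha A' (alpha A' b)) (alpha N (alpha N n))"
  by (rule tgt.convolution_cancel[OF N tgt.A_bialg(2) tgt.bij_A _ _ _ _ _ assms, where u = "\<lambda>b. b"])
    (use sw_antip(2)[OF tgt.A_alg(1) lin_id] in simp_all)

lemma cancel_l_S:
  assumes "hom_space K X" "bilinear_map K A N X g" "a \<in> carrier A" "n \<in> carrier N"
  shows "sw K A A X (comul A a) (\<lambda>a1 a2. sw K A A X (comul A a1) (\<lambda>x y. g x (act N (l y) (act N (S (l a2)) n)))) =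
    g (alpha A (alpha A a)) (alpha N (alpha N n))"
proof (rule tgt.convolution_cancel[OF N A_bialg(2) bij_A _ _ _ _ _ assms, where v = "\<lambda>a. S (l a)"])
  fix a assume [simp]: "a \<in> carrier A"
  show "sw K A A A' (comul A a) (\<lambda>x y. l x \<otimes>\<^bsub>A'\<^esub> S (l y)) = counit A a \<odot>\<^bsub>A'\<^esub> \<one>\<^bsub>A'\<^esub>"
    using sw_antip(2)[OF tgt.A_alg(1) lin_id, of "l a"] by simp
qed simp_all

text \<open>The antipode undoes the action of \<open>b\<^sub>2\<close> on \<open>N\<close> in \<open>\<Phi>\<close>.\<close>

definition Theta_fun where
  "Theta_fun b m n = sw K A' A' (FS MN) (comul A' b) (\<lambda>b1 b2.
     bt MN (bi (bi b1)) (tens K M N m (act N (bi (bi (S b2))) n)))"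

lemma Theta_simps [simp]:
  "b \<in> carrier A' \<Longrightarrow> m \<in> carrier M \<Longrightarrow> n \<in> carrier N \<Longrightarrow> Theta_fun b m n \<in> carrier (FS MN)"
  "linear_map K V A' f \<Longrightarrow> hom_space K V \<Longrightarrow> m \<in> carrier M \<Longrightarrow> n \<in> carrier N \<Longrightarrow>
     linear_map K V (FS MN) (\<lambda>x. Theta_fun (f x) m n)"
  "linear_map K V M g \<Longrightarrow> hom_space K V \<Longrightarrow> b \<in> carrier A' \<Longrightarrow> n \<in> carrier N \<Longrightarrow>
     linear_map K V (FS MN) (\<lambda>x. Theta_fun b (g x) n)"
  "linear_map K V N h \<Longrightarrow> hom_space K V \<Longrightarrow> b \<in> carrier A' \<Longrightarrow> m \<in> carrier M \<Longrightarrow>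
     linear_map K V (FS MN) (\<lambda>x. Theta_fun b m (h x))"
  "b \<in> carrier A' \<Longrightarrow> m \<in> carrier M \<Longrightarrow> linear_map K N (FS MN) (Theta_fun b m)"
  unfolding Theta_fun_def by simp_all

text \<open>The identity \<open>\<Theta> \<circ> \<Phi> = id\<close> on generators, in a form that can be stated before \<open>\<Theta>\<close> is known
  to be balanced: \<open>b\<^sub>2\<close> from \<open>\<Phi>\<close> is cancelled by the antipode of the second leg of \<open>b\<^sub>1\<close> in \<open>\<Theta>\<close>.\<close>

lemma bt_eq_Theta:
  assumes [simp]: "b \<in> carrier A'" "m \<in> carrier M" "n \<in> carrier N"
  shows "bt MN b (tens K M N m n) =
    sw K A' A' (FS MN) (comul A' b) (\<lambda>b1 b2. Theta_fun b1 m (ni (ni (act N b2 n))))"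
  using cancel_S_id[of "FS MN" "\<lambda>x w. bt MN (bi (bi x)) (tens K M N m (ni (ni w)))" b n]
  by (simp add: Theta_fun_def tgt.alpha_inv_act[OF N bij_N] del: tgt.dh_module_facts(9)[OF N])

text \<open>Read from right to left: \<open>a\<^sub>1\<close> is moved across the balanced tensor and acts on both factors of
  \<open>M \<otimes> N\<close>, and its action on the second factor is cancelled by that of \<open>S(\<lambda>(a\<^sub>2))\<close>.\<close>

lemma bt_expand:
  assumes [simp]: "p \<in> carrier A'" "a \<in> carrier A" "m \<in> carrier M" "y \<in> carrier N"
  shows "bt MN (alpha A' p) (tens K M N (act M a m) y) =
    sw K A A (FS MN) (comul A a) (\<lambda>a1 a2. bt MN (p \<otimes>\<^bsub>A'\<^esub> bi (bi (l a1)))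
      (tens K M N (alpha M m) (act N (bi (S (l a2))) (ni y))))"
proof -
  let ?g = "\<lambda>x w. bt MN (alpha A' p) (tens K M N (act M (alpha_inv A (alpha_inv A x)) m) (ni (ni w)))"
  have "sw K A A (FS MN) (comul A a) (\<lambda>a1 a2. bt MN (p \<otimes>\<^bsub>A'\<^esub> bi (bi (l a1)))
      (tens K M N (alpha M m) (act N (bi (S (l a2))) (ni y)))) =
    sw K A A (FS MN) (comul A a) (\<lambda>a1 a2. bt MN (p \<otimes>\<^bsub>A'\<^esub> l (alpha_inv A (alpha_inv A a1)))
      (alpha MN (tens K M N m (ni (act N (bi (S (l a2))) (ni y))))))"
    by simp
  also have "\<dots> = sw K A A (FS MN) (comul A a) (\<lambda>a1 a2. bt MN (alpha A' p)
      (act MN (alpha_inv A (alpha_inv A a1)) (tens K M N m (ni (act N (bi (S (l a2))) (ni y))))))"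
    by (rule sw_cong[OF refl refl], rule bt_balanced[OF MN_module]) simp_all
  also have "\<dots> = sw K A A (FS MN) (comul A a) (\<lambda>a1 a2. sw K A A (FS MN) (comul A a1) (\<lambda>x x'.
      ?g x (act N (l x') (act N (S (l a2)) y))))"
    by (simp add: tgt.alpha_inv_act[OF N bij_N] del: tgt.dh_module_facts(9)[OF N])
  also have "\<dots> = ?g (alpha A (alpha A a)) (alpha N (alpha N y))"
    by (rule cancel_l_S) simp_all
  finally show ?thesis by simp
qed

text \<open>On the right-hand side, \<open>bt_expand\<close> moves \<open>a\<close> to the left of the balanced tensor, and
  \<open>bt_eq_Theta\<close> rewrites the resulting generators as values of \<open>\<Theta>\<close>. The element of \<open>N\<close> is then acted
  on by legs of \<open>b\<close>, \<open>\<lambda>(a)\<close>, \<open>S(\<lambda>(a))\<close> and \<open>S(b)\<close>, in this order from the outside. The inner pair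
  cancels, and after it the outer pair.\<close>

lemma Theta_balanced:
  assumes [simp]: "b \<in> carrier A'" "a \<in> carrier A" "m \<in> carrier M" "n \<in> carrier N"
  shows "Theta_fun (b \<otimes>\<^bsub>A'\<^esub> l a) (alpha M m) n = Theta_fun (alpha A' b) (act M a m) n"
proof -
  let ?X = "FS MN"
  note ap = tgt.alpha_inv_act[OF N bij_N]
  note N9 = tgt.dh_module_facts(9)[OF N]
  have act_mult: "act N (x \<otimes>\<^bsub>A'\<^esub> y) w = act N (alpha A' x) (act N y (ni w))"
    if "x \<in> carrier A'" "y \<in> carrier A'" "w \<in> carrier N" for x y w
    using that by simp
  note c = sw_cong[OF refl refl]
  let ?F = "\<lambda>b2 a2 p1 p2 q1 q2. Theta_fun (bi (bi p1) \<otimes>\<^bsub>A'\<^esub> bi (bi (l q1))) (alpha M m)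
      (ni (ni (act N (bi (bi p2) \<otimes>\<^bsub>A'\<^esub> bi (bi (l q2))) (act N (bi (S (l a2))) (ni (act N (bi (S b2)) n))))))"
  have "Theta_fun (alpha A' b) (act M a m) n =
    sw K A' A' ?X (comul A' b) (\<lambda>b1 b2. bt MN (alpha A' (bi (bi b1))) (tens K M N (act M a m) (act N (bi (S b2)) n)))"
    by (simp add: Theta_fun_def)
  also have "\<dots> = sw K A' A' ?X (comul A' b) (\<lambda>b1 b2. sw K A A ?X (comul A a) (\<lambda>a1 a2.
      bt MN (bi (bi b1) \<otimes>\<^bsub>A'\<^esub> bi (bi (l a1))) (tens K M N (alpha M m) (act N (bi (S (l a2))) (ni (act N (bi (S b2)) n))))))"
    by (rule c, rule bt_expand) simp_all
  also have "\<dots> = sw K A' A' ?X (comul A' b) (\<lambda>b1 b2. sw K A A ?X (comul A a) (\<lambda>a1 a2.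
      sw K A' A' ?X (comul A' (bi (bi b1) \<otimes>\<^bsub>A'\<^esub> bi (bi (l a1)))) (\<lambda>x y.
        Theta_fun x (alpha M m) (ni (ni (act N y (act N (bi (S (l a2))) (ni (act N (bi (S b2)) n)))))))))"
    by (rule c, rule c, rule bt_eq_Theta) simp_all
  also have "\<dots> = sw K A' A' ?X (comul A' b) (\<lambda>b1 b2. sw K A A ?X (comul A a) (\<lambda>a1 a2.
      sw K A' A' ?X (comul A' b1) (\<lambda>p1 p2. sw K A A ?X (comul A a1) (\<lambda>q1 q2. ?F b2 a2 p1 p2 q1 q2))))"
    by (simp flip: l_alpha_inv del: N9)
  also have "\<dots> = sw K A' A' ?X (comul A' b) (\<lambda>b1 b2. sw K A' A' ?X (comul A' b1) (\<lambda>p1 p2.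
      sw K A A ?X (comul A a) (\<lambda>a1 a2. sw K A A ?X (comul A a1) (\<lambda>q1 q2. ?F b2 a2 p1 p2 q1 q2))))"
    by (rule c, rule sw_swap') simp_all
  also have "\<dots> = sw K A' A' ?X (comul A' b) (\<lambda>b1 b2. sw K A' A' ?X (comul A' b1) (\<lambda>p1 p2.
      Theta_fun (bi (bi p1) \<otimes>\<^bsub>A'\<^esub> l a) (alpha M m) (ni (ni (ni (act N p2 (act N (S b2) (alpha N n))))))))"
  proof (rule c, rule c)
    fix b1 b2 p1 p2 assume [simp]: "b1 \<in> carrier A'" "b2 \<in> carrier A'" "p1 \<in> carrier A'" "p2 \<in> carrier A'"
    let ?g = "\<lambda>x w. Theta_fun (bi (bi p1) \<otimes>\<^bsub>A'\<^esub> bi (bi (l x))) (alpha M m) (ni (ni (act N (bi p2) (ni (ni w)))))"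
    have "sw K A A ?X (comul A a) (\<lambda>a1 a2. sw K A A ?X (comul A a1) (\<lambda>q1 q2. ?F b2 a2 p1 p2 q1 q2)) =
      sw K A A ?X (comul A a) (\<lambda>a1 a2. sw K A A ?X (comul A a1) (\<lambda>q1 q2.
        ?g q1 (act N (l q2) (act N (S (l a2)) (act N (bi (S b2)) n)))))"
      by (simp add: ap act_mult del: N9)
    also have "\<dots> = ?g (alpha A (alpha A a)) (alpha N (alpha N (act N (bi (S b2)) n)))"
      by (rule cancel_l_S) simp_all
    also have "\<dots> = Theta_fun (bi (bi p1) \<otimes>\<^bsub>A'\<^esub> l a) (alpha M m) (ni (ni (ni (act N p2 (act N (S b2) (alpha N n))))))"
      by (simp add: ap del: N9)
    finally show "sw K A A ?X (comul A a) (\<lambda>a1 a2. sw K A A ?X (comul A a1) (\<lambda>q1 q2. ?F b2 a2 p1 p2 q1 q2)) =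
      Theta_fun (bi (bi p1) \<otimes>\<^bsub>A'\<^esub> l a) (alpha M m) (ni (ni (ni (act N p2 (act N (S b2) (alpha N n))))))" .
  qed
  also have "\<dots> = Theta_fun (bi (bi (alpha A' (alpha A' b))) \<otimes>\<^bsub>A'\<^esub> l a) (alpha M m) (ni (ni (ni (alpha N (alpha N (alpha N n))))))"
    by (rule cancel_id_S[where g = "\<lambda>x w. Theta_fun (bi (bi x) \<otimes>\<^bsub>A'\<^esub> l a) (alpha M m) (ni (ni (ni w)))"]) simp_all
  finally show ?thesis by simp
qed

text \<open>\<open>\<Theta>\<close> as a bilinear map on \<open>F(M)\<close> and \<open>N\<close>.\<close>

definition psi where "psi z n = bsweedler K (FS MN) z (\<lambda>b m. Theta_fun b m n)"

lemma psi_balanced: "n \<in> carrier N \<Longrightarrow> balanced M (FS MN) (\<lambda>b m. Theta_fun b m n)"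
  unfolding balanced_def by (simp add: Theta_balanced)

lemma psi_bt [simp]: "b \<in> carrier A' \<Longrightarrow> m \<in> carrier M \<Longrightarrow> n \<in> carrier N \<Longrightarrow> psi (bt M b m) n = Theta_fun b m n"
  unfolding psi_def using bsweedler_linear(2)[OF M F_hom_space[OF MN_module] psi_balanced refl] by blast

lemma psi_lin [simp]:
  "n \<in> carrier N \<Longrightarrow> linear_map K (FS M) (FS MN) (\<lambda>z. psi z n)"
  "z \<in> carrier (FS M) \<Longrightarrow> linear_map K N (FS MN) (psi z)"
proof -
  show "n \<in> carrier N \<Longrightarrow> linear_map K (FS M) (FS MN) (\<lambda>z. psi z n)"
    unfolding psi_def using bsweedler_linear(1)[OF M F_hom_space[OF MN_module] psi_balanced refl] by blast
  assume "z \<in> carrier (FS M)"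
  then obtain t where t: "t \<in> carrier (tensor K A' M)"
    "z = balance_span K D tgt.D l M +>\<^bsub>tensor K A' M\<^esub> t" unfolding F_carrier[OF M] by blast
  have e: "psi z n = sw K A' M (FS MN) t (\<lambda>b m. Theta_fun b m n)" if "n \<in> carrier N" for n
    unfolding psi_def t(2)
    by (rule bsweedler_coset[OF M F_hom_space[OF MN_module] psi_balanced[OF that] refl t(1)])
  show "linear_map K N (FS MN) (psi z)"
    by (subst linear_map_cong[OF hom_space_module e]) (use t(1) in simp_all)
qed

lemma psi_lin' [simp]:
  "n \<in> carrier N \<Longrightarrow> linear_map K V (FS M) f \<Longrightarrow> linear_map K V (FS MN) (\<lambda>x. psi (f x) n)"
  "z \<in> carrier (FS M) \<Longrightarrow> linear_map K V N g \<Longrightarrow> linear_map K V (FS MN) (\<lambda>x. psi z (g x))"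
  by (rule linear_map_compose[OF _ psi_lin(1)] linear_map_compose[OF _ psi_lin(2)]; assumption)+

lemma psi_closed [simp]: "z \<in> carrier (FS M) \<Longrightarrow> n \<in> carrier N \<Longrightarrow> psi z n \<in> carrier (FS MN)"
  by (rule linear_map_closed[OF psi_lin(2)])

lemma Phi_sw [simp]:
  "hom_space K V \<Longrightarrow> hom_space K W \<Longrightarrow> t \<in> carrier (tensor K V W) \<Longrightarrow>
    (\<And>v w. v \<in> carrier V \<Longrightarrow> w \<in> carrier W \<Longrightarrow> f v w \<in> carrier (FS MN)) \<Longrightarrow>
    Phi (sw K V W (FS MN) t f) = sw K V W fmn t (\<lambda>v w. Phi (f v w))"
  by (rule push_linear[OF Phi_lin]) simp_all

theorem Phi_iso: "doi_hopf_iso K tgt.D (FO MN) FMN"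
proof (rule tgt.doi_hopf_isoI[OF doi_hopf_module_F[OF MN_module] FMN_module Phi_doi_hopf_map,
      where g = "\<lambda>t. sw K (FS M) N (FS MN) t psi"])
  let ?Psi = "\<lambda>t. sw K (FS M) N (FS MN) t psi"
  show "?Psi t \<in> carrier (FO MN)" if "t \<in> carrier FMN" for t using that by simp
  show "Phi (?Psi t) = t" if "t \<in> carrier FMN" for t
  proof (rule tensor_ext'[where V = "FS M" and W = N and t = t and X = fmn and f = "\<lambda>t. Phi (?Psi t)"])
    fix z n assume zn [simp]: "z \<in> carrier (FS M)" "n \<in> carrier N"
    have "Phi (psi z n) = tens K (FS M) N z n"
    proof (rule F_ext[OF M zn(1), where X = fmn])
      fix b m assume bm [simp]: "b \<in> carrier A'" "m \<in> carrier M"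
      show "Phi (psi (bt M b m) n) = tens K (FS M) N (bt M b m) n"
        using cancel_id_S[of fmn "\<lambda>x w. tens K (FS M) N (bt M (bi (bi x)) m) (ni (ni (ni (ni w))))" b "alpha N (alpha N n)"]
        by (simp add: Theta_fun_def tgt.alpha_inv_act[OF N bij_N] del: tgt.dh_module_facts(9)[OF N])
    qed simp_all
    then show "Phi (?Psi (tens K (FS M) N z n)) = tens K (FS M) N z n" by simp
  qed (use that in simp_all)
  show "?Psi (Phi z) = z" if "z \<in> carrier (FO MN)" for z
    by (rule FMN_ext[where z = z and X = "FS MN"]) (use that in \<open>simp_all flip: bt_eq_Theta\<close>)
qed

end

end

end

section \<open>Reversing the order of tensor factors\<close>

context hom_calculus
begin

text \<open>The co-opposite and the opposite bialgebra.\<close>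

definition cop :: "('k, 'v) hom_bialg \<Rightarrow> ('k, 'v) hom_bialg" where
  "cop B = B\<lparr>comul := \<lambda>b. sw K B B (tensor K B B) (comul B b) (\<lambda>x y. tens K B B y x)\<rparr>"

definition opp :: "('k, 'v) hom_bialg \<Rightarrow> ('k, 'v) hom_bialg" where
  "opp B = B\<lparr>mult := \<lambda>x y. y \<otimes>\<^bsub>B\<^esub> x\<rparr>"

lemma cop_sel:
  "same_space (cop B) B" "mult (cop B) = mult B" "one (cop B) = one B" "counit (cop B) = counit B"
  "comul (cop B) = (\<lambda>b. sw K B B (tensor K B B) (comul B b) (\<lambda>x y. tens K B B y x))"
  by (simp_all add: cop_def same_space_def)

lemma opp_sel:
  "same_space (opp B) B" "mult (opp B) = (\<lambda>x y. y \<otimes>\<^bsub>B\<^esub> x)" "one (opp B) = one B" "counit (opp B) = counit B"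
  "comul (opp B) = comul B"
  by (simp_all add: opp_def same_space_def)

lemmas cop_rules = cop_sel(2-5) same_space_rules[OF cop_sel(1)]
lemmas opp_rules = opp_sel(2-5) same_space_rules[OF opp_sel(1)]

lemma hom_algebra_cop: "hom_algebra K (cop B) = hom_algebra K B"
  unfolding hom_algebra_def bilinear_map_def by (simp only: cop_rules)

lemma hom_algebra_opp:
  assumes "hom_algebra K B" shows "hom_algebra K (opp B)"
proof -
  note [simp] = hom_algebraD[OF assms]
  show ?thesis unfolding hom_algebra_def by (simp add: opp_rules hom_assoc[OF assms])
qed

lemma hom_coalgebra_opp: "hom_coalgebra K (opp B) = hom_coalgebra K B"
  unfolding hom_coalgebra_def linear_form_def
  by (simp only: opp_rules same_space_sweedler[OF opp_sel(1)])

text \<open>Coassociativity for the exchanged legs is coassociativity read backwards.\<close>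

lemma hom_coalgebra_cop:
  assumes "hom_coalgebra K B" shows "hom_coalgebra K (cop B)"
proof -
  note [simp] = hom_coalgebraD[OF assms] sw_comul_alpha[OF assms] sw_counit[OF assms]
  have lin: "linear_map K (cop B) (tensor K (cop B) (cop B)) (comul (cop B))"
    by (simp add: cop_rules)
  have form: "linear_form K (cop B) (counit (cop B))"
    using hom_coalgebraD(3)[OF assms] unfolding linear_form_def by (simp add: cop_rules)
  have "hom_space K (cop B)" by (simp add: cop_rules)
  moreover have "sw K B B (tensor K B (tensor K B B)) (comul B c) (\<lambda>x y. sw K B B (tensor K B (tensor K B B)) (comul B x)
      (\<lambda>x1 x2. tens K B (tensor K B B) (alpha B y) (tens K B B x2 x1))) =
    sw K B B (tensor K B (tensor K B B)) (comul B c) (\<lambda>x y. sw K B B (tensor K B (tensor K B B)) (comul B y)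
      (\<lambda>y1 y2. tens K B (tensor K B B) y2 (tens K B B y1 (alpha B x))))" if "c \<in> carrier B" for c
    using sw_coassoc[OF assms, of "tensor K B (tensor K B B)" c "\<lambda>x y z. tens K B (tensor K B B) z (tens K B B y x)"] that
    by (simp add: trilinear_map_def)
  ultimately show ?thesis
    by (subst hom_coalgebra_iff[OF _ lin form]) (simp_all add: cop_rules)
qed

lemma hom_bialgebra_cop:
  assumes "hom_bialgebra K B" shows "hom_bialgebra K (cop B)"
proof -
  note d = hom_bialgebraD[OF assms]
  note [simp] = d hom_algebraD[OF d(1)] hom_coalgebraD[OF d(2)] sw_comul_mult[OF assms]
  note m = tensor_mult_sw(1)[OF hom_algebra_cop[THEN iffD2, OF d(1)] hom_algebra_cop[THEN iffD2, OF d(1)]]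
  show ?thesis
    unfolding hom_bialgebra_def
  proof (intro conjI ballI)
    fix a b assume "a \<in> carrier (cop B)" "b \<in> carrier (cop B)"
    then have [simp]: "a \<in> carrier B" "b \<in> carrier B" by (simp_all add: cop_rules)
    have "tensor_mult K (cop B) (cop B) (comul (cop B) a) (comul (cop B) b) =
      sw K (cop B) (cop B) (tensor K (cop B) (cop B)) (comul (cop B) a) (\<lambda>a b'. sw K (cop B) (cop B) (tensor K (cop B) (cop B))
       (comul (cop B) b) (\<lambda>a' b''. tens K (cop B) (cop B) (a \<otimes>\<^bsub>cop B\<^esub> a') (b' \<otimes>\<^bsub>cop B\<^esub> b'')))"
      by (rule tensor_mult_sw(1)[where X = "tensor K B B" and f = "tens K B B"]) (simp_all add: hom_algebra_cop cop_rules)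
    then show "comul (cop B) (a \<otimes>\<^bsub>cop B\<^esub> b) = tensor_mult K (cop B) (cop B) (comul (cop B) a) (comul (cop B) b)"
      by (simp add: cop_rules)
  qed (use hom_coalgebra_cop[OF d(2)] in \<open>simp_all add: hom_algebra_cop cop_rules\<close>)
qed

lemma hom_bialgebra_opp:
  assumes "hom_bialgebra K B" shows "hom_bialgebra K (opp B)"
proof -
  note d = hom_bialgebraD[OF assms]
  note [simp] = d hom_algebraD[OF d(1)] hom_coalgebraD[OF d(2)] sw_comul_mult[OF assms]
  interpret K: cring K using hom_space_module[OF hom_algebraD(1)[OF d(1)]] by (rule module.axioms)
  show ?thesis
    unfolding hom_bialgebra_def
  proof (intro conjI ballI)
    fix a b assume "a \<in> carrier (opp B)" "b \<in> carrier (opp B)"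
    then have [simp]: "a \<in> carrier B" "b \<in> carrier B" by (simp_all add: opp_rules)
    have "tensor_mult K (opp B) (opp B) (comul (opp B) a) (comul (opp B) b) =
      sw K (opp B) (opp B) (tensor K (opp B) (opp B)) (comul (opp B) a) (\<lambda>a b'. sw K (opp B) (opp B) (tensor K (opp B) (opp B))
       (comul (opp B) b) (\<lambda>a' b''. tens K (opp B) (opp B) (a \<otimes>\<^bsub>opp B\<^esub> a') (b' \<otimes>\<^bsub>opp B\<^esub> b'')))"
      by (rule tensor_mult_sw(1)[where X = "tensor K B B" and f = "tens K B B"])
        (use hom_algebra_opp[OF d(1)] in \<open>simp_all add: opp_rules\<close>)
    also have "\<dots> = sw K B B (tensor K B B) (comul B a) (\<lambda>a1 a2. sw K B B (tensor K B B) (comul B b) (\<lambda>b1 b2.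
        tens K B B (b1 \<otimes>\<^bsub>B\<^esub> a1) (b2 \<otimes>\<^bsub>B\<^esub> a2)))" by (simp add: opp_rules)
    also have "\<dots> = sw K B B (tensor K B B) (comul B b) (\<lambda>b1 b2. sw K B B (tensor K B B) (comul B a) (\<lambda>a1 a2.
        tens K B B (b1 \<otimes>\<^bsub>B\<^esub> a1) (b2 \<otimes>\<^bsub>B\<^esub> a2)))" by (rule sw_swap') simp_all
    also have "\<dots> = sw K B B (tensor K B B) (comul B (b \<otimes>\<^bsub>B\<^esub> a)) (tens K B B)" by simp
    also have "\<dots> = comul B (b \<otimes>\<^bsub>B\<^esub> a)" by (rule sw_tens_eq_self) simp_all
    finally show "comul (opp B) (a \<otimes>\<^bsub>opp B\<^esub> b) = tensor_mult K (opp B) (opp B) (comul (opp B) a) (comul (opp B) b)"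
      by (simp add: opp_rules)
  qed (use hom_algebra_opp[OF d(1)] in \<open>simp_all add: hom_coalgebra_opp opp_rules K.m_comm\<close>)
qed

lemma hom_comodule_cong:
  assumes "same_space M M'" "same_space C C'" "comul C = comul C'" "counit C = counit C'"
  shows "hom_comodule K C M \<rho> = hom_comodule K C' M' \<rho>"
  unfolding hom_comodule_def Let_def
  by (simp only: same_space_rules[OF assms(1)] same_space_rules[OF assms(2)] assms(3,4) same_space_sweedler[OF assms(1)])

lemma hom_module_cong:
  assumes "same_space M M'" "same_space A B" "mult A = mult B" "one A = one B"
  shows "hom_module K A M ac = hom_module K B M' ac"
  unfolding hom_module_def bilinear_map_def
  by (simp only: same_space_rules[OF assms(1)] same_space_rules[OF assms(2)] assms(3,4))

end

context doi_datum
begin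

abbreviation "Drev \<equiv> \<lparr>datum_H = H, datum_A = cop A, datum_C = opp C, datum_coact = co, datum_act = ac\<rparr>"

text \<open>Reversing the comultiplication of \<open>A\<close> and the multiplication of \<open>C\<close> together preserves the
  compatibility condition: it becomes the original one with \<open>c\<close>, \<open>d\<close> and the two \<open>A\<close>-legs exchanged.\<close>

lemma monoidal_Drev: "monoidal_datum K Drev"
proof -
  let ?T = "tensor K A (tensor K A C)"
  note u = monoidal_unfolded
  have "comodule_algebra K H (cop A) co"
  proof -
    have "hom_comodule K H (cop A) co"
      using co_comodule hom_comodule_cong[OF cop_sel(1)[of A] same_space_refl refl refl] by blast
    moreover have "tensor_mult K (cop A) H = tensor_mult K A H"
      unfolding tensor_mult_def[abs_def] by (simp only: cop_rules)
    ultimately show ?thesis using u unfolding comodule_algebra_def by (simp only: cop_rules hom_algebra_cop) simp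
  qed
  moreover have "module_coalgebra K H (opp C) ac"
  proof -
    have "hom_module K H (opp C) ac"
      using ac_module hom_module_cong[OF opp_sel(1)[of C] same_space_refl refl refl] by blast
    then show ?thesis using u unfolding module_coalgebra_def
      by (simp only: opp_rules hom_coalgebra_opp) blast
  qed
  moreover have "sweedler K ?T (co a) (\<lambda>a0 a1. sweedler K ?T (comul (cop A) a0) (\<lambda>a01 a02.
            tens K A (tensor K A C) a01 (tens K A C a02 (ac (alpha H (alpha H a1)) (d \<otimes>\<^bsub>C\<^esub> c))))) =
    sweedler K ?T (comul (cop A) a) (\<lambda>a1 a2. sweedler K ?T (co a1) (\<lambda>a10 a11. sweedler K ?T (co a2) (\<lambda>a20 a21.
              tens K A (tensor K A C) a10 (tens K A C a20 (ac a21 d \<otimes>\<^bsub>C\<^esub> ac a11 c)))))"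
    if [simp]: "a \<in> carrier A" "c \<in> carrier C" "d \<in> carrier C" for a c d
  proof -
    have "sweedler K ?T (co a) (\<lambda>a0 a1. sweedler K ?T (comul (cop A) a0) (\<lambda>a01 a02.
            tens K A (tensor K A C) a01 (tens K A C a02 (ac (alpha H (alpha H a1)) (d \<otimes>\<^bsub>C\<^esub> c))))) =
      sw K A H ?T (co a) (\<lambda>a0 a1. sw K A A ?T (comul (cop A) a0) (\<lambda>a01 a02.
            tens K A (tensor K A C) a01 (tens K A C a02 (ac (alpha H (alpha H a1)) (d \<otimes>\<^bsub>C\<^esub> c)))))"
      by (intro sweedler_eqI) (simp_all add: cop_rules)
    also have "\<dots> = sw K A H ?T (co a) (\<lambda>a0 a1. sw K A A ?T (comul A a0) (\<lambda>x y.
            tens K A (tensor K A C) y (tens K A C x (ac (alpha H (alpha H a1)) (d \<otimes>\<^bsub>C\<^esub> c)))))"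
      by (simp add: cop_rules)
    also have "\<dots> = sw K A A ?T (comul A a) (\<lambda>a1 a2. sw K A H ?T (co a1) (\<lambda>x a11. sw K A H ?T (co a2) (\<lambda>y a21.
          tens K A (tensor K A C) y (tens K A C x (ac a11 d \<otimes>\<^bsub>C\<^esub> ac a21 c)))))"
      by (rule sw_monoidal) (simp_all add: trilinear_map_def)
    also have "\<dots> = sw K A A ?T (comul A a) (\<lambda>a1 a2. sw K A H ?T (co a2) (\<lambda>y a21. sw K A H ?T (co a1) (\<lambda>x a11.
          tens K A (tensor K A C) y (tens K A C x (ac a11 d \<otimes>\<^bsub>C\<^esub> ac a21 c)))))"
      by (rule sw_cong[OF refl refl], rule sw_swap') simp_all
    also have "\<dots> = sw K A A ?T (comul (cop A) a) (\<lambda>a1 a2. sw K A H ?T (co a1) (\<lambda>a10 a11. sw K A H ?T (co a2) (\<lambda>a20 a21.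
              tens K A (tensor K A C) a10 (tens K A C a20 (ac a21 d \<otimes>\<^bsub>C\<^esub> ac a11 c)))))"
      by (simp add: cop_rules)
    also have "\<dots> = sweedler K ?T (comul (cop A) a) (\<lambda>a1 a2. sweedler K ?T (co a1) (\<lambda>a10 a11. sweedler K ?T (co a2) (\<lambda>a20 a21.
              tens K A (tensor K A C) a10 (tens K A C a20 (ac a21 d \<otimes>\<^bsub>C\<^esub> ac a11 c)))))"
      by (rule sym, intro sweedler_eqI) (simp_all add: cop_rules)
    finally show ?thesis .
  qed
  ultimately show ?thesis
    using u hom_bialgebra_cop[OF bialgebras(2)] hom_bialgebra_opp[OF bialgebras(3)]
    unfolding monoidal_datum_def Let_def doi_hopf_datum_def datum.simps
    by (simp only: cop_rules(1-3) cop_rules(5-) opp_rules same_space_sweedler[OF opp_sel(1)]) blast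
qed

lemma doi_datum_rev: "doi_datum K H (cop A) (opp C) co ac"
  by (rule doi_datum.intro) (use monoidal_Drev bij_A bij_C in \<open>simp_all add: cop_rules opp_rules\<close>)

lemma doi_hopf_module_rev: "doi_hopf_module K Drev M = doi_hopf_module K D M"
  unfolding doi_hopf_module_def datum.simps
    hom_comodule_cong[OF same_space_refl[of M] opp_sel(1)[of C] opp_sel(5,4)]
    hom_module_cong[OF same_space_refl[of M] cop_sel(1)[of A] cop_sel(2,3)]
  by (simp only: opp_rules(5-) cop_rules(5-))

lemma doi_hopf_map_rev: "doi_hopf_map K Drev M N f = doi_hopf_map K D M N f"
  unfolding doi_hopf_map_def datum.simps by (simp only: opp_rules(5-) cop_rules(5-))

lemma doi_hopf_iso_rev: "doi_hopf_iso K Drev M N = doi_hopf_iso K D M N"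
  unfolding doi_hopf_iso_def doi_hopf_module_rev doi_hopf_map_rev ..

text \<open>The action on a product involves \<open>\<Delta>\<^sub>A\<close> and its coaction the multiplication of \<open>C\<close>, so reversing
  both amounts to exchanging the factors.\<close>

lemma doi_hopf_iso_swap:
  assumes M: "doi_hopf_module K D M" and N: "doi_hopf_module K D N"
  shows "doi_hopf_iso K D (dh_tensor K Drev M N) (dh_tensor K D N M)"
proof -
  interpret r: doi_datum K H "cop A" "opp C" co ac by (rule doi_datum_rev)
  note Mr = doi_hopf_module_rev[THEN iffD2, OF M] and Nr = doi_hopf_module_rev[THEN iffD2, OF N]
  note P = r.doi_hopf_module_tensor[OF Mr Nr, unfolded doi_hopf_module_rev] and P' = doi_hopf_module_tensor[OF N M]
  note s = r.dh_tensor_sel[OF Mr Nr, unfolded cop_rules opp_rules] and s' = dh_tensor_sel[OF N M]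
  note l = r.dh_tensor_lin[OF Mr Nr, unfolded cop_rules opp_rules] and l' = dh_tensor_lin[OF N M]
  note [simp] = dh_module_facts[OF M] dh_module_facts[OF N]
    same_space_rules[OF s(1)] same_space_rules[OF s'(1)] l l'
    linear_map_facts[OF l(2)] linear_map_facts[OF l(3)]
    linear_map_facts[OF l'(2)] linear_map_facts[OF l'(3)]
  let ?h = "\<lambda>t. sw K M N (tensor K N M) t (\<lambda>m n. tens K N M n m)"
  let ?P = "dh_tensor K Drev M N" and ?P' = "dh_tensor K D N M"
  have lh: "linear_map K ?P ?P' ?h" by simp
  note ext = tensor_ext'[of M N]
  have "doi_hopf_map K D ?P ?P' ?h"
    unfolding doi_hopf_map_iff[OF P P' lh]
  proof (intro conjI ballI, goal_cases)
    case (1 t)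
    then show ?case
      by (intro ext[where t = t and X = "tensor K N M" and f = "\<lambda>t. ?h (alpha ?P t)"]) simp_all
  next
    case (2 a t)
    then show ?case
      by (intro ext[where t = t and X = "tensor K N M" and f = "\<lambda>t. ?h (act ?P a t)"]) (simp_all add: s s')
  next
    case (3 t)
    then show ?case
    proof (intro ext[where t = t and X = "tensor K (tensor K N M) C" and f = "\<lambda>t. coact ?P' (?h t)"], goal_cases)
      case (6 m n)
      let ?X = "tensor K (tensor K N M) C"
      have "sw K M C ?X (coact M m) (\<lambda>m0 m1. sw K N C ?X (coact N n) (\<lambda>n0 n1.
         tens K (tensor K N M) C (tens K N M n0 m0) (ai (ai (n1 \<otimes>\<^bsub>C\<^esub> m1))))) =
       sw K N C ?X (coact N n) (\<lambda>n0 n1. sw K M C ?X (coact M m) (\<lambda>m0 m1.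
         tens K (tensor K N M) C (tens K N M n0 m0) (ai (ai (n1 \<otimes>\<^bsub>C\<^esub> m1)))))"
        by (rule sw_swap') (use 6 in simp_all)
      then show ?case using 6 by (simp add: s s')
    qed (simp_all add: s s')
  qed
  then show ?thesis
  proof (rule doi_hopf_isoI[OF P P', where g = "\<lambda>t. sw K N M (tensor K M N) t (\<lambda>n m. tens K M N m n)"])
    show "?h (sw K N M (tensor K M N) t (\<lambda>n m. tens K M N m n)) = t" if "t \<in> carrier ?P'" for t
      using that by (simp add: sw_tens_eq_self)
    show "sw K N M (tensor K M N) (?h t) (\<lambda>n m. tens K M N m n) = t" if "t \<in> carrier ?P" for t
      using that by (simp add: sw_tens_eq_self)
  qed simp
qed

end

context doi_morphism
begin

lemma doi_morphism_rev: "doi_morphism K H (cop A) (opp C) co ac (cop A') co' l"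
proof (rule doi_morphism.intro)
  show "doi_datum K H (cop A) (opp C) co ac" "doi_datum K H (cop A') (opp C) co' ac"
    by (rule doi_datum_rev tgt.doi_datum_rev)+
  have "comul (cop A') (l a) = sweedler K (tensor K A' A') (comul (cop A) a) (\<lambda>a1 a2. tens K A' A' (l a1) (l a2))"
    if [simp]: "a \<in> carrier A" for a
  proof -
    have "sweedler K (tensor K A' A') (comul (cop A) a) (\<lambda>a1 a2. tens K A' A' (l a1) (l a2)) =
       sw K A A (tensor K A' A') (comul (cop A) a) (\<lambda>a1 a2. tens K A' A' (l a1) (l a2))"
      by (rule sweedler_eqI) (simp_all add: cop_rules)
    then show ?thesis by (simp add: cop_rules)
  qed
  then show "doi_morphism_axioms K H (cop A) (opp C) co ac (cop A') co' l"
    using morphism_unfolded monoidal_Drev tgt.monoidal_Drev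
    unfolding doi_morphism_axioms_def monoidal_morphism_def hom_bialgebra_map_def datum.simps
    by (simp only: cop_rules(1-3) cop_rules(5-)) blast
qed

text \<open>The construction of \<open>F\<close> refers neither to a comultiplication of \<open>A\<close> or \<open>A'\<close> nor to the multiplication
  of \<open>C\<close>.\<close>

lemma F_obj_rev: "F_obj K Drev tgt.Drev l M = FO M"
proof -
  have b: "balance_span K Drev tgt.Drev l M = balance_span K D tgt.D l M"
    unfolding balance_span_def datum.simps Let_def by (simp only: cop_rules)
  have q: "btens K Drev tgt.Drev l M = btens K D tgt.D l M"
    unfolding btens_def[abs_def] datum.simps b by (simp only: cop_rules)
  have f: "F_space K Drev tgt.Drev l M = F_space K D tgt.D l M"
    unfolding F_space_def datum.simps b q Let_def by (simp only: cop_rules)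
  show ?thesis
    unfolding F_obj_def datum.simps f q Let_def by (simp only: cop_rules opp_rules)
qed

lemma antipode_cop:
  assumes "twisted_antipode K A' S" shows "antipode K (cop A') S"
proof -
  have lS: "linear_map K A' A' S" using assms unfolding twisted_antipode_def by blast
  note [simp] = lS linear_map_facts[OF lS]
  have "sweedler K A' (comul A' b) (\<lambda>b1 b2. S b2 \<otimes>\<^bsub>A'\<^esub> b1) = sw K A' A' A' (comul A' b) (\<lambda>b1 b2. S b2 \<otimes>\<^bsub>A'\<^esub> b1)"
    "sweedler K A' (comul A' b) (\<lambda>b1 b2. b2 \<otimes>\<^bsub>A'\<^esub> S b1) = sw K A' A' A' (comul A' b) (\<lambda>b1 b2. b2 \<otimes>\<^bsub>A'\<^esub> S b1)"
    "sweedler K A' (comul (cop A') b) (\<lambda>b1 b2. S b1 \<otimes>\<^bsub>A'\<^esub> b2) = sw K A' A' A' (comul (cop A') b) (\<lambda>b1 b2. S b1 \<otimes>\<^bsub>A'\<^esub> b2)"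
    "sweedler K A' (comul (cop A') b) (\<lambda>b1 b2. b1 \<otimes>\<^bsub>A'\<^esub> S b2) = sw K A' A' A' (comul (cop A') b) (\<lambda>b1 b2. b1 \<otimes>\<^bsub>A'\<^esub> S b2)"
    if "b \<in> carrier A'" for b
    by (rule sweedler_eqI; use that in \<open>simp add: cop_rules\<close>)+
  then show ?thesis using assms
    unfolding antipode_def twisted_antipode_def
    by (simp add: cop_rules(1-3,5-) same_space_sweedler[OF cop_sel(1)]) (simp add: cop_rules)
qed

section \<open>The two isomorphisms\<close>

text \<open>\<open>\<Phi>\<close> is an isomorphism for \<open>N\<close> with scalars restricted in place of \<open>G(N)\<close>.\<close>

theorem projection_formula:
  assumes M: "doi_hopf_module K D M" and N: "doi_hopf_module K tgt.D N" and bij: "alpha_bij N"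
    and S: "antipode K A' S"
  shows "doi_hopf_iso K tgt.D (dh_tensor K tgt.D (FO M) N) (FO (dh_tensor K D M (GO N)))"
proof -
  have "doi_hopf_iso K D M M"
    using M unfolding doi_hopf_iso_def
    by (intro conjI exI[of _ "\<lambda>x. x"]) (simp_all add: doi_hopf_map_iff dh_module_facts sw_tens_eq_self)
  from doi_hopf_iso_F[OF doi_hopf_iso_tensor[OF this G_iso_restrict_scalars[OF N bij]]]
  show ?thesis
    using tgt.doi_hopf_iso_sym[OF Phi_iso[OF M N bij S]] tgt.doi_hopf_iso_trans by blast
qed

text \<open>Over the reversed datum, with the twisted antipode as its antipode, \<open>\<Phi>\<close> is an isomorphism from
  \<open>F(M \<otimes> N)\<close> to \<open>F(M) \<otimes> N\<close>; exchanging the factors on both sides expresses it over the given datum.\<close>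

theorem projection_formula_twisted:
  assumes M: "doi_hopf_module K D M" and N: "doi_hopf_module K tgt.D N" and bij: "alpha_bij N"
    and S: "twisted_antipode K A' S"
  shows "doi_hopf_iso K tgt.D (dh_tensor K tgt.D N (FO M)) (FO (dh_tensor K D (GO N) M))"
proof -
  interpret r: doi_morphism K H "cop A" "opp C" co ac "cop A'" co' l by (rule doi_morphism_rev)
  note R = doi_hopf_module_restrict_scalars[OF N]
  have MM: "doi_hopf_iso K D M M"
    using M unfolding doi_hopf_iso_def
    by (intro conjI exI[of _ "\<lambda>x. x"]) (simp_all add: doi_hopf_map_iff dh_module_facts sw_tens_eq_self)
  have 1: "doi_hopf_iso K tgt.D (FO (dh_tensor K Drev M (restrict_scalars N))) (dh_tensor K tgt.Drev (FO M) N)"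
    using r.Phi_iso[OF doi_hopf_module_rev[THEN iffD2, OF M] tgt.doi_hopf_module_rev[THEN iffD2, OF N] bij antipode_cop[OF S]]
    unfolding F_obj_rev tgt.doi_hopf_iso_rev .
  have 2: "doi_hopf_iso K tgt.D (dh_tensor K tgt.Drev (FO M) N) (dh_tensor K tgt.D N (FO M))"
    by (rule tgt.doi_hopf_iso_swap[OF doi_hopf_module_F[OF M] N])
  have 3: "doi_hopf_iso K tgt.D (FO (dh_tensor K Drev M (restrict_scalars N))) (FO (dh_tensor K D (restrict_scalars N) M))"
    by (rule doi_hopf_iso_F[OF doi_hopf_iso_swap[OF M R]])
  have 4: "doi_hopf_iso K tgt.D (FO (dh_tensor K D (restrict_scalars N) M)) (FO (dh_tensor K D (GO N) M))"
    by (rule doi_hopf_iso_F[OF doi_hopf_iso_tensor[OF G_iso_restrict_scalars[OF N bij] MM]])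
  show ?thesis
    using tgt.doi_hopf_iso_trans[OF tgt.doi_hopf_iso_sym[OF tgt.doi_hopf_iso_trans[OF 1 2]] tgt.doi_hopf_iso_trans[OF 3 4]] .
qed

end

theorem theorem2p10:
  fixes K :: "('k, 'r) ring_scheme"
    and D :: "('k, 'h, 'a, 'c) datum"
    and D' :: "('k, 'h, 'b, 'c) datum"
    and l :: "'a \<Rightarrow> 'b"
    and M :: "('k, 'a, 'c, 'm) dh_module"
    and N :: "('k, 'b, 'c, 'n) dh_module"
  assumes "field K"
    and "monoidal_morphism K D D' l"
    and "alpha_bij (datum_A D)" and "alpha_bij (datum_A D')" and "alpha_bij (datum_C D)"
  shows "doi_hopf_iso K D' (F_obj K D D' l (dh_regular K D)) (dh_regular K D') \<and>
    (doi_hopf_module K D M \<and> doi_hopf_module K D' N \<and> alpha_bij N \<longrightarrow>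
      (hom_hopf_algebra K (datum_A D') \<longrightarrow>
        doi_hopf_iso K D'
          (dh_tensor K D' (F_obj K D D' l M) N)
          (F_obj K D D' l (dh_tensor K D M (G_obj K D D' l N)))) \<and>
      ((\<exists>S. twisted_antipode K (datum_A D') S) \<longrightarrow>
        doi_hopf_iso K D'
          (dh_tensor K D' N (F_obj K D D' l M))
          (F_obj K D D' l (dh_tensor K D (G_obj K D D' l N) M))))"
proof -
  obtain H A C co ac where D: "D = \<lparr>datum_H = H, datum_A = A, datum_C = C, datum_coact = co, datum_act = ac\<rparr>"
    by (cases D)
  obtain H' A' C' co' ac' where "D' = \<lparr>datum_H = H', datum_A = A', datum_C = C', datum_coact = co', datum_act = ac'\<rparr>"
    by (cases D')
  then have D': "D' = \<lparr>datum_H = H, datum_A = A', datum_C = C, datum_coact = co', datum_act = ac\<rparr>"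
    using assms(2) unfolding D monoidal_morphism_def by simp
  note a = assms(2-5)[unfolded D D' datum.simps]
  interpret doi_morphism K H A C co ac A' co' l
    using a unfolding doi_morphism_def doi_datum_def doi_morphism_axioms_def monoidal_morphism_def by blast
  show ?thesis
    unfolding D D' datum.simps hom_hopf_algebra_def
    using F_regular projection_formula projection_formula_twisted by blast
qed

end
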